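(* Let $A\in\mathbb{R}^{n\times n}$. The second canonical form of $A$ for real-congruence (a direct sum of blocks of Types Tri-(i), Tri-(ii), Tri-(iii)) determines $\text{real-KCF}(A^\top,A)$ under strict real-equivalence uniquely up to permutation of its direct summands. Conversely, $\text{real-KCF}(A^\top,A)$ determines the second canonical form of $A$ for real-congruence uniquely up to permutation of summands, multiplication of any direct summand of type $\widetilde\Gamma_k\otimes[\pm1]$ by $-1$, and multiplication of the parameter $a$ in any direct summand of type $\widetilde\Gamma_k\otimes C(a,b)$ by $-1$. For any direct summand $B$ of Types Tri-(i), Tri-(ii), Tri-(iii), $\text{real-KCF}(B^\top,B)$ is as follows: 1. If $B=T_k(a)$ with $a\in\mathbb{R}$, $a\ne\pm1$, and $a=0$ if $k$ is odd: $(F_\ell,G_\ell)\oplus(F_\ell^\top,G_\ell^\top)$ if $k=2\ell+1$; $(J_\ell(0),I_\ell)\oplus(I_\ell,J_\ell(0))$ if $k=2\ell$ and $a=0$; $(I_\ell,J_\ell(a))\oplus(I_\ell,J_\ell(1/a))$ if $k=2\ell$ and $a\ne0$. 2. If $B=\widehat T_{4k}(a,b)$ with $a,b\in\mathbb{R}$, $a^2+b^2\ne1$, $b>0$: $(I_{2k},C_{2k}(a,b))\oplus\left(I_{2k},C_{2k}\left(\frac{a}{a^2+b^2},\frac{b}{a^2+b^2}\right)\right)$. 3. If $B=\widetilde\Gamma_k\otimes[\pm1]$: $\left(I_k,J_k((-1)^{k+1})\right)$. 4. If $B=\widetilde\Gamma_k\otimes C(a,b)$ with $a,b\in\mathbb{R}$,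 $a^2+b^2=1$, $b>0$: $\left(I_k,J_k((-1)^k)\right)\oplus\left(I_k,J_k((-1)^k)\right)$ if $a=0$, $b=1$, and $\left(I_{2k},C_{2k}\left((-1)^{k+1}(a^2-b^2),\,2|ab|\right)\right)$ if $a\ne0$.
   Context: Two matrices $A,B\in\mathbb{R}^{n\times n}$ are real-congruent if $SAS^\top=B$ for some invertible $S\in\mathbb{R}^{n\times n}$. Two pairs $(A,B),(C,D)$ of real $m\times n$ matrices are strictly real-equivalent if $RAS=C$ and $RBS=D$ for some invertible real matrices $R,S$. Direct sum: $A\oplus B=\begin{bmatrix}A&0\\0&B\end{bmatrix}$, $(A,B)\oplus(C,D)=(A\oplus C,B\oplus D)$; $\otimes$ is the Kronecker product. For integers $k\ge1$: $J_k(\mu)$ is the $k\times k$ upper triangular Jordan block with $\mu$ on the diagonal and $1$ on the superdiagonal. $T_k(\mu)$ is the $k\times k$ tridiagonal matrix with zero diagonal, all superdiagonal entries equal to $1$ and all subdiagonal entries equal to $\mu$ ($T_1(\mu)=0$). $\widetilde\Gamma_k$ is the $k\times k$ tridiagonal matrix with $(1,1)$ entry equal to $1$, all other diagonal entries $0$, all superdiagonal entries equal to $1$, and subdiagonal entries $(\widetilde\Gamma_k)_{i+1,i}=(-1)^i$, $i=1,\dots,k-1$ ($\widetilde\Gamma_1=1$). $C(a,b)=\begin{bmatrix}a&b\\-b&a\end{bmatrix}$; $C_{2k}(a,b)$ is the $2k\times 2k$ block upper bidiagonal matrix with $k$ diagonal blocks equal to $C(a,b)$, blocks $I_2$ on the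 block superdiagonal and zeros elsewhere. For an integer $m\ge1$, $\widehat T_{2m}(a,b)$ is the $2m\times2m$ block tridiagonal matrix consisting of $m\times m$ blocks of size $2\times2$, with zero diagonal blocks, all superdiagonal blocks equal to $I_2$, and all subdiagonal blocks equal to $C(a,b)$; $\widehat T_{4k}(a,b)$ is the case $m=2k$. $F_k=[I_k\ \ 0]$ and $G_k=[0\ \ I_k]$ are $k\times(k+1)$ matrices, for $k\ge0$ ($F_0=G_0$ is the $0\times1$ matrix). Second canonical form for real-congruence: each $A\in\mathbb{R}^{n\times n}$ is real-congruent to a direct sum, uniquely determined up to permutation of summands and the parameter replacements indicated, of blocks of Type Tri-(i): $T_k(a)$, $a\in\mathbb{R}$, $a\ne\pm1$, $a=0$ if $k$ is odd, each nonzero $a$ determined up to replacement by $a^{-1}$; Type Tri-(ii): $\widehat T_{4k}(a,b)$, $a,b\in\mathbb{R}$, $a^2+b^2\ne1$, $b>0$, $(a,b)$ determined up to replacement by $(a/(a^2+b^2),b/(a^2+b^2))$; Type Tri-(iii): $\widetilde\Gamma_k\otimes N$ with $N=\pm1$ or $N=C(a,b)$, $a,b\in\mathbb{R}$, $a^2+b^2=1$, $b>0$. Real Kronecker canonical form (known result): each real pair $(A,B)$ of $m\times n$ matrices is strictly real-equivalent to a direct sum, uniquely determined up to permutation of summands, of pairs of the types $(I_k,J_k(\mu))$ with $\mu\in\mathbb{R}$; $(J_k(0),I_k)$; $(I_{2k},C_{2k}(a,b))$ with $a,b\in\mathbb{R}$, $b>0$; $(F_k,G_k)$; $(F_k^\top,G_k^\top)$.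 This direct sum is denoted $\text{real-KCF}(A,B)$. *)

theory Defs
  imports
    "Jordan_Normal_Form.Jordan_Normal_Form"
    "HOL-Library.Multiset"
begin

text \<open>Matrices are zero-indexed, and \<open>0 \<times> n\<close> and \<open>n \<times> 0\<close> matrices are distinguished by their
  dimensions; this matters for the pairs \<open>(F\<^sub>0, G\<^sub>0)\<close> and \<open>(F\<^sub>0\<^sup>T, G\<^sub>0\<^sup>T)\<close>. Direct sums are
  \<^const>\<open>diag_block_mat\<close>, and \<open>J\<^sub>k(\<mu>)\<close> is \<^const>\<open>jordan_block\<close>.\<close>

definition real_congruent :: "nat \<Rightarrow> real mat \<Rightarrow> real mat \<Rightarrow> bool" where
  "real_congruent n A B \<longleftrightarrow>
     A \<in> carrier_mat n n \<and> B \<in> carrier_mat n n \<and>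
     (\<exists>S \<in> carrier_mat n n. invertible_mat S \<and> S * A * S\<^sup>T = B)"

definition strictly_real_equivalent ::
    "nat \<Rightarrow> nat \<Rightarrow> real mat \<times> real mat \<Rightarrow> real mat \<times> real mat \<Rightarrow> bool" where
  "strictly_real_equivalent m n P Q \<longleftrightarrow>
     fst P \<in> carrier_mat m n \<and> snd P \<in> carrier_mat m n \<and>
     fst Q \<in> carrier_mat m n \<and> snd Q \<in> carrier_mat m n \<and>
     (\<exists>R \<in> carrier_mat m m. \<exists>S \<in> carrier_mat n n. invertible_mat R \<and> invertible_mat S \<and>
        R * fst P * S = fst Q \<and> R * snd P * S = snd Q)"

definition pair_direct_sum :: "(real mat \<times> real mat) list \<Rightarrow> real mat \<times> real mat" where
  "pair_direct_sum Ps = (diag_block_mat (map fst Ps), diag_block_mat (map snd Ps))"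

definition kronecker :: "real mat \<Rightarrow> real mat \<Rightarrow> real mat" where
  "kronecker A B = mat (dim_row A * dim_row B) (dim_col A * dim_col B)
     (\<lambda>(i, j). A $$ (i div dim_row B, j div dim_col B) * B $$ (i mod dim_row B, j mod dim_col B))"

definition T_mat :: "nat \<Rightarrow> real \<Rightarrow> real mat" where
  "T_mat k \<mu> = mat k k (\<lambda>(i, j). if j = Suc i then 1 else if i = Suc j then \<mu> else 0)"

text \<open>The subdiagonal entry in the one-based position \<open>(i + 1, i)\<close> is \<open>(-1)\<^sup>i\<close>; in zero-based
  indexing, the entry in position \<open>(i, j)\<close> with \<open>i = j + 1\<close> is therefore \<open>(-1)\<^sup>i\<close>.\<close>

definition Gamma_mat :: "nat \<Rightarrow> real mat" where
  "Gamma_mat k = mat k k (\<lambda>(i, j).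
     if i = 0 \<and> j = 0 then 1
     else if j = Suc i then 1
     else if i = Suc j then (- 1) ^ i
     else 0)"

definition C2_mat :: "real \<Rightarrow> real \<Rightarrow> real mat" where
  "C2_mat a b = mat_of_rows_list 2 [[a, b], [- b, a]]"

text \<open>The \<open>m \<times> m\<close> block matrix whose \<open>(i, j)\<close> block is the \<open>2 \<times> 2\<close> matrix \<open>X i j\<close>.\<close>

definition block2_mat :: "nat \<Rightarrow> (nat \<Rightarrow> nat \<Rightarrow> real mat) \<Rightarrow> real mat" where
  "block2_mat m X =
     mat (2 * m) (2 * m) (\<lambda>(i, j). X (i div 2) (j div 2) $$ (i mod 2, j mod 2))"

text \<open>The first argument of \<open>C_mat\<close> and \<open>That_mat\<close> is the number of \<open>2 \<times> 2\<close> diagonal blocks: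
  \<open>C_mat k\<close> is \<open>C\<^bsub>2k\<^esub>\<close>, and \<open>That_mat (2 * k)\<close> is the \<open>4k \<times> 4k\<close> matrix.\<close>

definition C_mat :: "nat \<Rightarrow> real \<Rightarrow> real \<Rightarrow> real mat" where
  "C_mat k a b = block2_mat k (\<lambda>i j.
     if i = j then C2_mat a b else if j = Suc i then 1\<^sub>m 2 else 0\<^sub>m 2 2)"

definition That_mat :: "nat \<Rightarrow> real \<Rightarrow> real \<Rightarrow> real mat" where
  "That_mat m a b = block2_mat m (\<lambda>i j.
     if j = Suc i then 1\<^sub>m 2 else if i = Suc j then C2_mat a b else 0\<^sub>m 2 2)"

definition F_mat :: "nat \<Rightarrow> real mat" where
  "F_mat k = mat k (k + 1) (\<lambda>(i, j). if j = i then 1 else 0)"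

definition G_mat :: "nat \<Rightarrow> real mat" where
  "G_mat k = mat k (k + 1) (\<lambda>(i, j). if j = Suc i then 1 else 0)"

abbreviation mat11 :: "real \<Rightarrow> real mat" where
  "mat11 x \<equiv> mat 1 1 (\<lambda>_. x)"

definition tri_i :: "real mat set" where
  "tri_i = {T_mat k a | k a. k \<ge> 1 \<and> a \<noteq> 1 \<and> a \<noteq> -1 \<and> (odd k \<longrightarrow> a = 0)}"

definition tri_ii :: "real mat set" where
  "tri_ii = {That_mat (2 * k) a b | k a b. k \<ge> 1 \<and> a\<^sup>2 + b\<^sup>2 \<noteq> 1 \<and> b > 0}"

definition tri_iii :: "real mat set" where
  "tri_iii =
     {kronecker (Gamma_mat k) (mat11 \<epsilon>) | k \<epsilon>. k \<ge> 1 \<and> \<epsilon> \<in> {1, -1}} \<union>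
     {kronecker (Gamma_mat k) (C2_mat a b) | k a b. k \<ge> 1 \<and> a\<^sup>2 + b\<^sup>2 = 1 \<and> b > 0}"

definition is_second_canonical_form :: "nat \<Rightarrow> real mat \<Rightarrow> real mat list \<Rightarrow> bool" where
  "is_second_canonical_form n A Bs \<longleftrightarrow>
     set Bs \<subseteq> tri_i \<union> tri_ii \<union> tri_iii \<and> real_congruent n A (diag_block_mat Bs)"

text \<open>The parameter replacements under which a summand is regarded as the same.\<close>

inductive tri_replacement :: "real mat \<Rightarrow> real mat \<Rightarrow> bool" where
  refl: "tri_replacement B B"
| T: "\<lbrakk>k \<ge> 1; even k; a \<noteq> 0; a \<noteq> 1; a \<noteq> -1\<rbrakk>
      \<Longrightarrow> tri_replacement (T_mat k a) (T_mat k (1 / a))"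
| That: "\<lbrakk>k \<ge> 1; a\<^sup>2 + b\<^sup>2 \<noteq> 1; b > 0\<rbrakk>
      \<Longrightarrow> tri_replacement (That_mat (2 * k) a b)
            (That_mat (2 * k) (a / (a\<^sup>2 + b\<^sup>2)) (b / (a\<^sup>2 + b\<^sup>2)))"

text \<open>Both \<^const>\<open>tri_replacement\<close> and the following relation are equivalence relations on
  canonical summands, since every listed change is an involution; so a single step per summand,
  combined with a permutation through \<^const>\<open>rel_mset\<close>, is all that is needed.
  The second relation contains the first because the summands of a second canonical form are
  themselves determined only up to these replacements.\<close>

inductive tri_replacement_or_sign :: "real mat \<Rightarrow> real mat \<Rightarrow> bool" where
  replacement: "tri_replacement B B' \<Longrightarrow> tri_replacement_or_sign B B'"
| Gamma_sign: "\<lbrakk>k \<ge> 1; \<epsilon> \<in> {1, -1}; B = kronecker (Gamma_mat k) (mat11 \<epsilon>)\<rbrakk>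
      \<Longrightarrow> tri_replacement_or_sign B (- B)"
| Gamma_C: "\<lbrakk>k \<ge> 1; a\<^sup>2 + b\<^sup>2 = 1; b > 0\<rbrakk>
      \<Longrightarrow> tri_replacement_or_sign
            (kronecker (Gamma_mat k) (C2_mat a b)) (kronecker (Gamma_mat k) (C2_mat (- a) b))"

definition real_kronecker_blocks :: "(real mat \<times> real mat) set" where
  "real_kronecker_blocks =
     {(1\<^sub>m k, jordan_block k \<mu>) | k \<mu>. k \<ge> 1} \<union>
     {(jordan_block k 0, 1\<^sub>m k) | k. k \<ge> 1} \<union>
     {(1\<^sub>m (2 * k), C_mat k a b) | k a b. k \<ge> 1 \<and> b > 0} \<union>
     {(F_mat k, G_mat k) | k. True} \<union>
     {((F_mat k)\<^sup>T, (G_mat k)\<^sup>T) | k. True}"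

text \<open>The list \<open>Ks\<close> enumerates the summands of \<open>real-KCF(A, B)\<close>, for \<open>m \<times> n\<close> matrices; equality of
  two such forms up to permutation of summands is equality of the multisets \<open>mset Ks\<close>.\<close>

definition is_real_KCF ::
    "nat \<Rightarrow> nat \<Rightarrow> real mat \<Rightarrow> real mat \<Rightarrow> (real mat \<times> real mat) list \<Rightarrow> bool" where
  "is_real_KCF m n A B Ks \<longleftrightarrow>
     set Ks \<subseteq> real_kronecker_blocks \<and>
     strictly_real_equivalent m n (A, B) (pair_direct_sum Ks)"

end

theory Submission
  imports Defs
begin

text \<open>A congruence of \<open>A\<close> is a strict equivalence of \<open>(A\<^sup>T, A)\<close>, so only the Kronecker forms of the
  individual summands and the uniqueness of these forms matter.

  Uniqueness is a Krull-Schmidt argument. Over the complex numbers, every endomorphism of a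
  Kronecker block is a pair of upper triangular matrices with one common constant diagonal entry,
  which is its normalised trace \<open>\<chi>\<close>. On endomorphisms \<open>\<chi>\<close> is multiplicative, and since the trace
  is symmetric, \<open>\<chi>(g f) \<noteq> 0\<close> with \<open>f : P \<rightarrow> Q\<close> and \<open>g : Q \<rightarrow> P\<close> makes \<open>f\<close> an isomorphism. If
  \<open>P\<close> occurs \<open>r\<close> times in one decomposition and \<open>t\<close> times in another one, the \<open>r \<times> r\<close> identity
  matrix therefore factors through dimension \<open>t\<close>, so \<open>r \<le> t\<close>. Real forms are compared after
  complexification.

  For the individual summands, permuting rows and columns turns \<open>(B\<^sup>T, B)\<close> into a direct sum of
  pencils \<open>(P, Q)\<close> with \<open>P\<close> upper triangular and invertible and \<open>Q - z P\<close> strictly upper triangular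
  with nonzero superdiagonal; these are equivalent to \<open>(I, J\<^sub>k(z))\<close>. The summands with a parameter
  \<open>C(a, b)\<close> are realifications of complex matrices with parameter \<open>a + \<i>b\<close>.

  Conversely, any one block of the Kronecker form determines the summand it comes from up to the
  permitted replacements, so that summands can be split off one at a time.\<close>

section \<open>Pencils and their morphisms\<close>

text \<open>Passing to the complex numbers is forced by the blocks (I, C_2k(a, b)): a real
  endomorphism may act on every 2 x 2 block as a complex number, so its diagonal need not determine
  a scalar. Over the complex numbers the block becomes J_k(a + ib) plus J_k(a - ib), and b > 0
  singles out one of the two. Traces are taken over rows and columns together because F_0 has no
  rows; dividing by the total size uses characteristic 0.

  The information lost by (A^T, A) shows in the eigenvalues. A common real factor cancels, so the
  sign in \<Gamma>_k \<otimes> [\<plusminus>1] disappears. For a parameter c = a + ib, transposition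
  brings in conj(c): hat T has the eigenvalues c and 1 / conj(c), exchanged by inversion in the unit
  circle, while \<Gamma>_k \<otimes> C(a, b) has \<plusminus> c / conj(c) = \<plusminus> c^2, since
  |c| = 1. Replacing a by -a sends c to -conj(c) and c^2 to its conjugate, which gives the same real
  block. The value c = i is exceptional: c^2 is real, and the block splits into two equal real
  ones.\<close>

lemma index_mult_mat_sum:
  assumes "A \<in> carrier_mat r n" "B \<in> carrier_mat n c" "i < r" "j < c"
  shows "(A * B) $$ (i, j) = (\<Sum>l<n. A $$ (i, l) * B $$ (l, j))"
  using assms by (auto simp: scalar_prod_def lessThan_atLeast0 intro!: sum.cong)

lemma invertible_mat_iff:
  fixes A :: "'a :: comm_ring_1 mat"
  assumes A: "A \<in> carrier_mat n n"
  shows "invertible_mat A \<longleftrightarrow> (\<exists>B \<in> carrier_mat n n. A * B = 1\<^sub>m n \<and> B * A = 1\<^sub>m n)"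
proof
  assume "invertible_mat A"
  then obtain B where B: "A * B = 1\<^sub>m (dim_row A)" "B * A = 1\<^sub>m (dim_row B)"
    unfolding invertible_mat_def inverts_mat_def by auto
  from arg_cong[OF B(1), of dim_col] arg_cong[OF B(2), of dim_col] A
  have "B \<in> carrier_mat n n" by auto
  with B A show "\<exists>B \<in> carrier_mat n n. A * B = 1\<^sub>m n \<and> B * A = 1\<^sub>m n" by auto
next
  assume "\<exists>B \<in> carrier_mat n n. A * B = 1\<^sub>m n \<and> B * A = 1\<^sub>m n"
  then show "invertible_mat A" using A unfolding invertible_mat_def inverts_mat_def by auto
qed

lemma invertible_mat_iff_det:
  fixes A :: "'a :: field mat"
  assumes A: "A \<in> carrier_mat n n"
  shows "invertible_mat A \<longleftrightarrow> det A \<noteq> 0"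
proof
  assume "invertible_mat A"
  then obtain B where B: "B \<in> carrier_mat n n" and AB: "A * B = 1\<^sub>m n"
    using invertible_mat_iff[OF A] by auto
  show "det A \<noteq> 0" using arg_cong[OF AB, of det] by (auto simp: det_mult[OF A B])
next
  assume "det A \<noteq> 0"
  then show "invertible_mat A" using det_non_zero_imp_unit[OF A, where b = "()"]
    unfolding invertible_mat_iff[OF A] Units_def by (auto simp: ring_mat_simps)
qed

lemma invertible_mat_mult:
  fixes A B :: "'a :: comm_ring_1 mat"
  assumes "A \<in> carrier_mat n n" "B \<in> carrier_mat n n" "invertible_mat A" "invertible_mat B"
  shows "invertible_mat (A * B)"
proof -
  obtain A' B' where *: "A' \<in> carrier_mat n n" "A * A' = 1\<^sub>m n" "A' * A = 1\<^sub>m n"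
      "B' \<in> carrier_mat n n" "B * B' = 1\<^sub>m n" "B' * B = 1\<^sub>m n"
    using assms invertible_mat_iff by metis
  have "B * (B' * A') = B * B' * A'" "A' * (A * B) = A' * A * B"
    using assoc_mult_mat[OF assms(2) *(4,1)] assoc_mult_mat[OF *(1) assms(1,2)] by simp_all
  then have "A * B * (B' * A') = 1\<^sub>m n" "B' * A' * (A * B) = 1\<^sub>m n"
    using assms * assoc_mult_mat[OF assms(1,2) mult_carrier_mat[OF *(4,1)]]
      assoc_mult_mat[OF *(4,1) mult_carrier_mat[OF assms(1,2)]] by simp_all
  moreover have "A * B \<in> carrier_mat n n" "B' * A' \<in> carrier_mat n n" using assms * by auto
  ultimately show ?thesis using invertible_mat_iff by blast
qed

text \<open>Sizes are read off the first component, so that lists of blocks of different shapes,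
  including 0 x 1 and 1 x 0, can be summed without size parameters.\<close>

definition is_pencil :: "'a mat \<times> 'a mat \<Rightarrow> bool" where
  "is_pencil P \<longleftrightarrow> snd P \<in> carrier_mat (dim_row (fst P)) (dim_col (fst P))"

text \<open>Morphisms of representations of the Kronecker quiver. An equivalence R A S = C appears
  here with \<open>X\<close> = R and \<open>Y\<close> the inverse of S; in this form maps compose,
  and \<open>X\<close> and \<open>Y\<close> may be rectangular.\<close>

definition pencil_hom ::
    "'a :: semiring_0 mat \<times> 'a mat \<Rightarrow> 'a mat \<times> 'a mat \<Rightarrow> 'a mat \<Rightarrow> 'a mat \<Rightarrow> bool" where
  "pencil_hom P Q X Y \<longleftrightarrow>
     X \<in> carrier_mat (dim_row (fst Q)) (dim_row (fst P)) \<and>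
     Y \<in> carrier_mat (dim_col (fst Q)) (dim_col (fst P)) \<and>
     X * fst P = fst Q * Y \<and> X * snd P = snd Q * Y"

definition pencil_iso :: "'a :: comm_ring_1 mat \<times> 'a mat \<Rightarrow> 'a mat \<times> 'a mat \<Rightarrow> bool" where
  "pencil_iso P Q \<longleftrightarrow> is_pencil P \<and> is_pencil Q \<and>
     (\<exists>X Y. pencil_hom P Q X Y \<and> invertible_mat X \<and> invertible_mat Y)"

lemma pencil_isoI:
  assumes "is_pencil P" "is_pencil Q" "pencil_hom P Q X Y" "invertible_mat X" "invertible_mat Y"
  shows "pencil_iso P Q"
  using assms unfolding pencil_iso_def by blast

lemma pencil_hom_comp:
  assumes "is_pencil P" "is_pencil Q" "is_pencil R" "pencil_hom P Q F F'" "pencil_hom Q R G G'"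
  shows "pencil_hom P R (G * F) (G' * F')"
proof -
  obtain a b where P: "fst P \<in> carrier_mat a b" "snd P \<in> carrier_mat a b"
    using assms(1) by (auto simp: is_pencil_def)
  obtain c d where Q: "fst Q \<in> carrier_mat c d" "snd Q \<in> carrier_mat c d"
    using assms(2) by (auto simp: is_pencil_def)
  obtain e f where R: "fst R \<in> carrier_mat e f" "snd R \<in> carrier_mat e f"
    using assms(3) by (auto simp: is_pencil_def)
  have F: "F \<in> carrier_mat c a" "F' \<in> carrier_mat d b" "F * fst P = fst Q * F'" "F * snd P = snd Q * F'"
    using assms(4) P Q by (auto simp: pencil_hom_def)
  have G: "G \<in> carrier_mat e c" "G' \<in> carrier_mat f d" "G * fst Q = fst R * G'" "G * snd Q = snd R * G'"
    using assms(5) R Q by (auto simp: pencil_hom_def)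
  have "G * F * fst P = G * (fst Q * F')" using P F G by (simp add: assoc_mult_mat)
  also have "\<dots> = G * fst Q * F'" using Q F(1,2) G(1,2) by (simp add: assoc_mult_mat)
  also have "\<dots> = fst R * (G' * F')" unfolding G using R F(1,2) G(1,2) by (simp add: assoc_mult_mat)
  finally have 1: "G * F * fst P = fst R * (G' * F')" .
  have "G * F * snd P = G * (snd Q * F')" using P F G by (simp add: assoc_mult_mat)
  also have "\<dots> = G * snd Q * F'" using Q F(1,2) G(1,2) by (simp add: assoc_mult_mat)
  also have "\<dots> = snd R * (G' * F')" unfolding G using R F(1,2) G(1,2) by (simp add: assoc_mult_mat)
  finally have 2: "G * F * snd P = snd R * (G' * F')" .
  show ?thesis unfolding pencil_hom_def using 1 2 P R F(1,2) G(1,2) by auto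
qed

lemma pencil_hom_id:
  fixes P :: "'a :: semiring_1 mat \<times> 'a mat"
  assumes "is_pencil P"
  shows "pencil_hom P P (1\<^sub>m (dim_row (fst P))) (1\<^sub>m (dim_col (fst P)))"
proof -
  obtain m n where "fst P \<in> carrier_mat m n" "snd P \<in> carrier_mat m n"
    using assms by (auto simp: is_pencil_def)
  then show ?thesis by (auto simp: pencil_hom_def)
qed

lemma pencil_iso_refl: "is_pencil P \<Longrightarrow> pencil_iso P P"
  by (rule pencil_isoI[OF _ _ pencil_hom_id])
    (auto simp: invertible_mat_iff[OF one_carrier_mat] intro: bexI[of _ "1\<^sub>m _"])

lemma pencil_isoE:
  assumes "pencil_iso P Q"
  obtains X Y X' Y' where "dim_row (fst P) = dim_row (fst Q)" "dim_col (fst P) = dim_col (fst Q)"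
    "is_pencil P" "is_pencil Q" "pencil_hom P Q X Y" "pencil_hom Q P X' Y'"
    "X' * X = 1\<^sub>m (dim_row (fst P))" "X * X' = 1\<^sub>m (dim_row (fst P))"
    "Y' * Y = 1\<^sub>m (dim_col (fst P))" "Y * Y' = 1\<^sub>m (dim_col (fst P))"
proof -
  obtain X Y where pq: "is_pencil P" "is_pencil Q" and h: "pencil_hom P Q X Y"
    and inv: "invertible_mat X" "invertible_mat Y" using assms unfolding pencil_iso_def by blast
  obtain m n where P: "fst P \<in> carrier_mat m n" "snd P \<in> carrier_mat m n"
    using pq(1) by (auto simp: is_pencil_def)
  have dims: "dim_row (fst P) = dim_row (fst Q)" "dim_col (fst P) = dim_col (fst Q)"
    using h inv by (auto simp: pencil_hom_def invertible_mat_def)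
  have Q: "fst Q \<in> carrier_mat m n" "snd Q \<in> carrier_mat m n"
    using P dims pq(2) by (auto simp: is_pencil_def)
  have X: "X \<in> carrier_mat m m" "Y \<in> carrier_mat n n" "X * fst P = fst Q * Y" "X * snd P = snd Q * Y"
    using h P Q by (auto simp: pencil_hom_def)
  obtain X' where X': "X' \<in> carrier_mat m m" "X * X' = 1\<^sub>m m" "X' * X = 1\<^sub>m m"
    using inv invertible_mat_iff[OF X(1)] by auto
  obtain Y' where Y': "Y' \<in> carrier_mat n n" "Y * Y' = 1\<^sub>m n" "Y' * Y = 1\<^sub>m n"
    using inv invertible_mat_iff[OF X(2)] by auto
  have inv_eq: "X' * D = C * Y'" if "C \<in> carrier_mat m n" "D \<in> carrier_mat m n" "X * C = D * Y" for C D
  proof -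
    have "X' * D = X' * (D * Y * Y')"
      using that(2) Y' X(2) assoc_mult_mat[OF that(2) X(2) Y'(1)] by simp
    also have "\<dots> = X' * (X * C) * Y'" unfolding that(3)
      by (rule assoc_mult_mat[OF X'(1) mult_carrier_mat[OF that(2) X(2)] Y'(1), symmetric])
    also have "\<dots> = X' * X * C * Y'" unfolding assoc_mult_mat[OF X'(1) X(1) that(1)] ..
    finally show ?thesis using that X'(3) by simp
  qed
  have "pencil_hom Q P X' Y'" unfolding pencil_hom_def
    using inv_eq[OF P(1) Q(1) X(3)] inv_eq[OF P(2) Q(2) X(4)] P Q X' Y' by auto
  then show thesis using that[OF dims pq h _ X'(3)[folded carrier_matD(1)[OF P(1)]]
     X'(2)[folded carrier_matD(1)[OF P(1)]] Y'(3)[folded carrier_matD(2)[OF P(1)]]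
     Y'(2)[folded carrier_matD(2)[OF P(1)]]] P by auto
qed

lemma pencil_iso_sym:
  assumes "pencil_iso P Q"
  shows "pencil_iso Q P"
proof -
  from assms obtain X Y X' Y' where *: "dim_row (fst P) = dim_row (fst Q)" "dim_col (fst P) = dim_col (fst Q)"
    "is_pencil P" "is_pencil Q" "pencil_hom P Q X Y" "pencil_hom Q P X' Y'"
    "X' * X = 1\<^sub>m (dim_row (fst P))" "X * X' = 1\<^sub>m (dim_row (fst P))"
    "Y' * Y = 1\<^sub>m (dim_col (fst P))" "Y * Y' = 1\<^sub>m (dim_col (fst P))" by (rule pencil_isoE)
  then have "invertible_mat X'" "invertible_mat Y'"
    by (auto simp: pencil_hom_def invertible_mat_iff[of _ "dim_row (fst Q)"]
        invertible_mat_iff[of _ "dim_col (fst Q)"])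
  then show ?thesis using * by (auto intro: pencil_isoI)
qed

lemma pencil_iso_trans [trans]:
  assumes "pencil_iso P Q" "pencil_iso Q R"
  shows "pencil_iso P R"
proof -
  from assms obtain X Y X' Y' where *: "is_pencil P" "is_pencil Q" "is_pencil R"
    "pencil_hom P Q X Y" "pencil_hom Q R X' Y'"
    "invertible_mat X" "invertible_mat Y" "invertible_mat X'" "invertible_mat Y'"
    unfolding pencil_iso_def by blast
  then have "dim_row (fst P) = dim_row (fst Q)" "dim_row (fst R) = dim_row (fst Q)"
    "dim_col (fst P) = dim_col (fst Q)" "dim_col (fst R) = dim_col (fst Q)"
    by (auto simp: pencil_hom_def invertible_mat_def)
  with * have "invertible_mat (X' * X)" "invertible_mat (Y' * Y)"
    by (auto simp: pencil_hom_def intro: invertible_mat_mult)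
  with pencil_hom_comp[OF *(1-5)] * show ?thesis by (auto intro: pencil_isoI)
qed

lemma strictly_real_equivalent_iff_iso:
  "strictly_real_equivalent m n P Q \<longleftrightarrow> fst P \<in> carrier_mat m n \<and> pencil_iso P Q"
proof
  assume "strictly_real_equivalent m n P Q"
  then obtain R S where P: "fst P \<in> carrier_mat m n" "snd P \<in> carrier_mat m n"
      and Q: "fst Q \<in> carrier_mat m n" "snd Q \<in> carrier_mat m n"
      and R: "R \<in> carrier_mat m m" "invertible_mat R" and S: "S \<in> carrier_mat n n" "invertible_mat S"
      and eq: "R * fst P * S = fst Q" "R * snd P * S = snd Q"
    unfolding strictly_real_equivalent_def by auto
  obtain S' where S': "S' \<in> carrier_mat n n" "S * S' = 1\<^sub>m n" "S' * S = 1\<^sub>m n"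
    using S invertible_mat_iff by metis
  have "R * fst P = fst Q * S'" "R * snd P = snd Q * S'"
    unfolding eq[symmetric] using P R S S' assoc_mult_mat[of "R * fst P" m n S n S' n]
      assoc_mult_mat[of "R * snd P" m n S n S' n] by simp_all
  moreover have "invertible_mat S'" using S' S invertible_mat_iff by blast
  ultimately show "fst P \<in> carrier_mat m n \<and> pencil_iso P Q"
    using P Q R S' by (auto simp: is_pencil_def pencil_hom_def intro!: pencil_isoI[of _ _ R S'])
next
  assume a: "fst P \<in> carrier_mat m n \<and> pencil_iso P Q"
  then obtain X Y X' Y' where *: "dim_row (fst P) = dim_row (fst Q)" "dim_col (fst P) = dim_col (fst Q)"
    "is_pencil P" "is_pencil Q" "pencil_hom P Q X Y" "pencil_hom Q P X' Y'"
    "X' * X = 1\<^sub>m (dim_row (fst P))" "X * X' = 1\<^sub>m (dim_row (fst P))"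
    "Y' * Y = 1\<^sub>m (dim_col (fst P))" "Y * Y' = 1\<^sub>m (dim_col (fst P))" by (blast elim: pencil_isoE)
  have c: "fst P \<in> carrier_mat m n" "snd P \<in> carrier_mat m n" "fst Q \<in> carrier_mat m n" "snd Q \<in> carrier_mat m n"
    "X \<in> carrier_mat m m" "Y \<in> carrier_mat n n" "X' \<in> carrier_mat m m" "Y' \<in> carrier_mat n n"
    using a * by (auto simp: is_pencil_def pencil_hom_def)
  have eq: "X * fst P * Y' = fst Q" "X * snd P * Y' = snd Q"
    using * c by (auto simp: pencil_hom_def assoc_mult_mat[of _ m n _ n _ n])
  have "invertible_mat X" "invertible_mat Y'" using c * invertible_mat_iff by (metis carrier_matD)+
  then show "strictly_real_equivalent m n P Q"
    using c eq unfolding strictly_real_equivalent_def by blast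
qed

text \<open>The same \<open>X\<close> and \<open>Y\<close> intertwine every linear combination of
  the two components. This is how an eigenvalue is translated to 0 and back.\<close>

lemma pencil_iso_linear:
  assumes "pencil_iso (A, B) (C, D)"
  shows "pencil_iso (a \<cdot>\<^sub>m A + b \<cdot>\<^sub>m B, c \<cdot>\<^sub>m A + d \<cdot>\<^sub>m B) (a \<cdot>\<^sub>m C + b \<cdot>\<^sub>m D, c \<cdot>\<^sub>m C + d \<cdot>\<^sub>m D)"
proof -
  obtain X Y where *: "is_pencil (A, B)" "is_pencil (C, D)" "pencil_hom (A, B) (C, D) X Y"
      "invertible_mat X" "invertible_mat Y" using assms unfolding pencil_iso_def by blast
  obtain m n where A: "A \<in> carrier_mat m n" "B \<in> carrier_mat m n"
    using *(1) by (auto simp: is_pencil_def)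
  have X: "C \<in> carrier_mat m n" "D \<in> carrier_mat m n" "X \<in> carrier_mat m m" "Y \<in> carrier_mat n n"
    "X * A = C * Y" "X * B = D * Y"
    using * A by (auto simp: is_pencil_def pencil_hom_def invertible_mat_def)
  have "X * (x \<cdot>\<^sub>m A + y \<cdot>\<^sub>m B) = (x \<cdot>\<^sub>m C + y \<cdot>\<^sub>m D) * Y" for x y
    using A X by (simp add: mult_add_distrib_mat[of _ m m _ n] add_mult_distrib_mat[of _ m n _ _ n]
        mult_smult_distrib[of _ m m _ n] mult_smult_assoc_mat[of _ m n _ n])
  then show ?thesis
    using * A X by (intro pencil_isoI[of _ _ X Y]) (auto simp: is_pencil_def pencil_hom_def)
qed

section \<open>Direct sums\<close>

text \<open>Binary form of one step of \<open>diag_block_mat\<close>, so that multiplication,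
  transposition, inclusions and projections are treated for two blocks only.\<close>

definition mdsum :: "'a :: zero mat \<Rightarrow> 'a mat \<Rightarrow> 'a mat" where
  "mdsum A B = four_block_mat A (0\<^sub>m (dim_row A) (dim_col B)) (0\<^sub>m (dim_row B) (dim_col A)) B"

definition pdsum :: "'a :: zero mat \<times> 'a mat \<Rightarrow> 'a mat \<times> 'a mat \<Rightarrow> 'a mat \<times> 'a mat" where
  "pdsum P Q = (mdsum (fst P) (fst Q), mdsum (snd P) (snd Q))"

primrec psum :: "('a :: zero mat \<times> 'a mat) list \<Rightarrow> 'a mat \<times> 'a mat" where
  "psum [] = (0\<^sub>m 0 0, 0\<^sub>m 0 0)"
| "psum (P # Ps) = pdsum P (psum Ps)"

lemma dim_mdsum [simp]:
  "dim_row (mdsum A B) = dim_row A + dim_row B" "dim_col (mdsum A B) = dim_col A + dim_col B"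
  by (auto simp: mdsum_def)

lemma mdsum_carrier:
  "A \<in> carrier_mat m n \<Longrightarrow> B \<in> carrier_mat p q \<Longrightarrow> mdsum A B \<in> carrier_mat (m + p) (n + q)"
  by (auto intro!: carrier_matI)

lemma index_mdsum:
  assumes "A \<in> carrier_mat m n" "B \<in> carrier_mat p q" "i < m + p" "j < n + q"
  shows "mdsum A B $$ (i, j) =
    (if i < m then if j < n then A $$ (i, j) else 0 else if j < n then 0 else B $$ (i - m, j - n))"
  using assms by (auto simp: mdsum_def)

lemma diag_block_mat_Cons: "diag_block_mat (A # As) = mdsum A (diag_block_mat As)"
  by (simp add: mdsum_def Let_def)

lemma pair_direct_sum_eq_psum: "pair_direct_sum Ps = psum Ps"
  by (induction Ps)
    (simp_all add: pair_direct_sum_def diag_block_mat_Cons pdsum_def prod_eq_iff del: diag_block_mat.simps(2))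

lemma mdsum_mult:
  assumes "A \<in> carrier_mat m n" "B \<in> carrier_mat p q" "C \<in> carrier_mat n k" "D \<in> carrier_mat q l"
  shows "mdsum A B * mdsum C D = mdsum (A * C) (B * D)"
  unfolding mdsum_def using assms
  by (subst mult_four_block_mat[of _ m n _ q _ p _ _ k _ l]) auto

lemma mdsum_one: "mdsum (1\<^sub>m m) (1\<^sub>m n) = 1\<^sub>m (m + n)"
  by (auto simp: mdsum_def)

lemma mdsum_transpose: "(mdsum A B)\<^sup>T = mdsum (A\<^sup>T) (B\<^sup>T)"
  unfolding mdsum_def by (subst transpose_four_block_mat) auto

lemma mdsum_assoc: "mdsum (mdsum A B) C = mdsum A (mdsum B C)"
  using assoc_four_block_mat[of A B C] unfolding mdsum_def by simp

lemma mdsum_empty [simp]: "mdsum (0\<^sub>m 0 0) A = A" "mdsum A (0\<^sub>m 0 0) = A"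
  by (auto simp: mdsum_def)

lemma pdsum_empty [simp]: "pdsum (0\<^sub>m 0 0, 0\<^sub>m 0 0) P = P" "pdsum P (0\<^sub>m 0 0, 0\<^sub>m 0 0) = P"
  by (simp_all add: pdsum_def)

lemma psum_append: "psum (Ps @ Qs) = pdsum (psum Ps) (psum Qs)"
  by (induction Ps) (auto simp: pdsum_def mdsum_assoc)

lemma is_pencil_pdsum: "is_pencil P \<Longrightarrow> is_pencil Q \<Longrightarrow> is_pencil (pdsum P Q)"
  by (auto simp: is_pencil_def pdsum_def)

lemma is_pencil_psum: "(\<And>P. P \<in> set Ps \<Longrightarrow> is_pencil P) \<Longrightarrow> is_pencil (psum Ps)"
  by (induction Ps) (auto simp: is_pencil_pdsum, simp add: is_pencil_def)

lemma invertible_mat_mdsum: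
  fixes A B :: "'a :: comm_ring_1 mat"
  assumes "A \<in> carrier_mat m m" "B \<in> carrier_mat n n" "invertible_mat A" "invertible_mat B"
  shows "invertible_mat (mdsum A B)"
proof -
  obtain A' B' where *: "A' \<in> carrier_mat m m" "A * A' = 1\<^sub>m m" "A' * A = 1\<^sub>m m"
      "B' \<in> carrier_mat n n" "B * B' = 1\<^sub>m n" "B' * B = 1\<^sub>m n"
    using assms invertible_mat_iff by metis
  with assms show ?thesis
    by (subst invertible_mat_iff[of _ "m + n"])
      (auto intro!: mdsum_carrier bexI[of _ "mdsum A' B'"] simp: mdsum_mult[of _ m m _ n n _ m _ n] mdsum_one)
qed

lemma pencil_iso_pdsum:
  assumes "pencil_iso P P'" "pencil_iso Q Q'"
  shows "pencil_iso (pdsum P Q) (pdsum P' Q')"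
proof -
  from assms obtain X Y X' Y' where *: "is_pencil P" "is_pencil P'" "pencil_hom P P' X Y"
    "invertible_mat X" "invertible_mat Y" "is_pencil Q" "is_pencil Q'" "pencil_hom Q Q' X' Y'"
    "invertible_mat X'" "invertible_mat Y'"
    unfolding pencil_iso_def by blast
  obtain m n where P: "fst P \<in> carrier_mat m n" "snd P \<in> carrier_mat m n"
    using *(1) by (auto simp: is_pencil_def)
  obtain p q where Q: "fst Q \<in> carrier_mat p q" "snd Q \<in> carrier_mat p q"
    using *(6) by (auto simp: is_pencil_def)
  have X: "X \<in> carrier_mat m m" "Y \<in> carrier_mat n n" "fst P' \<in> carrier_mat m n" "snd P' \<in> carrier_mat m n"
    "X * fst P = fst P' * Y" "X * snd P = snd P' * Y"
    using * P by (auto simp: pencil_hom_def is_pencil_def invertible_mat_def)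
  have X': "X' \<in> carrier_mat p p" "Y' \<in> carrier_mat q q" "fst Q' \<in> carrier_mat p q" "snd Q' \<in> carrier_mat p q"
    "X' * fst Q = fst Q' * Y'" "X' * snd Q = snd Q' * Y'"
    using * Q by (auto simp: pencil_hom_def is_pencil_def invertible_mat_def)
  have "pencil_hom (pdsum P Q) (pdsum P' Q') (mdsum X X') (mdsum Y Y')"
    unfolding pencil_hom_def pdsum_def using P Q X X'
    by (auto simp: mdsum_mult[of _ m m _ p p _ n _ q] mdsum_mult[of _ m n _ p q _ n _ q])
  then show ?thesis using * X X'
    by (intro pencil_isoI[of _ _ "mdsum X X'" "mdsum Y Y'"] invertible_mat_mdsum is_pencil_pdsum) auto
qed

section \<open>Uniqueness of decompositions into blocks with scalar endomorphisms\<close>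

text \<open>A rank inequality obtained from determinants: for t < r both factors are padded with
  zeros to size r x r. The product does not change, but the padded right factor has a zero
  row.\<close>

lemma det_mult_nonzero_imp_le:
  fixes A :: "'a :: field mat"
  assumes A: "A \<in> carrier_mat r t" and B: "B \<in> carrier_mat t r" and det: "det (A * B) \<noteq> 0"
  shows "r \<le> t"
proof (rule ccontr)
  assume "\<not> r \<le> t"
  then have tr: "t < r" by simp
  define A' where "A' = mat r r (\<lambda>(i, j). if j < t then A $$ (i, j) else 0)"
  define B' where "B' = mat r r (\<lambda>(i, j). if i < t then B $$ (i, j) else 0)"
  have c: "A' \<in> carrier_mat r r" "B' \<in> carrier_mat r r" by (auto simp: A'_def B'_def)
  have "A * B = A' * B'"
  proof (rule eq_matI)
    fix i j assume "i < dim_row (A' * B')" "j < dim_col (A' * B')"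
    then have ij: "i < r" "j < r" using c by auto
    have "(\<Sum>l<t. A $$ (i, l) * B $$ (l, j)) = (\<Sum>l<r. A' $$ (i, l) * B' $$ (l, j))"
      using ij tr by (intro sum.mono_neutral_cong_left) (auto simp: A'_def B'_def)
    then show "(A * B) $$ (i, j) = (A' * B') $$ (i, j)"
      by (simp only: index_mult_mat_sum[OF A B ij] index_mult_mat_sum[OF c ij])
  qed (use A B c in auto)
  moreover have "det B' = 0"
  proof -
    have "B' = mat\<^sub>r r r (\<lambda>i. if i = t then 0\<^sub>v r else row B' i)"
      using tr by (intro eq_matI) (auto simp: B'_def)
    then show ?thesis using det_row_0[OF tr, of "row B'"] c by auto
  qed
  ultimately show False using det det_mult[OF c] by simp
qed

text \<open>Adding the traces on the row and the column side keeps the value informative for blocks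
  without rows or without columns.\<close>

definition pencil_trace :: "'a :: comm_monoid_add mat \<Rightarrow> 'a mat \<Rightarrow> 'a" where
  "pencil_trace X Y = (\<Sum>i<dim_row X. X $$ (i, i)) + (\<Sum>i<dim_row Y. Y $$ (i, i))"

lemma sum_diag_mult_comm:
  fixes A :: "'a :: comm_semiring_0 mat"
  assumes "A \<in> carrier_mat m n" "B \<in> carrier_mat n m"
  shows "(\<Sum>i<m. (A * B) $$ (i, i)) = (\<Sum>i<n. (B * A) $$ (i, i))"
proof -
  have "(\<Sum>i<m. (A * B) $$ (i, i)) = (\<Sum>i<m. \<Sum>l<n. A $$ (i, l) * B $$ (l, i))"
    using assms by (intro sum.cong HOL.refl index_mult_mat_sum) auto
  also have "\<dots> = (\<Sum>l<n. \<Sum>i<m. B $$ (l, i) * A $$ (i, l))"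
    by (subst sum.swap) (simp add: mult.commute)
  also have "\<dots> = (\<Sum>i<n. (B * A) $$ (i, i))"
    using assms by (intro sum.cong HOL.refl index_mult_mat_sum[symmetric]) auto
  finally show ?thesis .
qed

lemma pencil_trace_comm:
  fixes P Q :: "'a :: comm_semiring_0 mat \<times> 'a mat"
  assumes "pencil_hom P Q F F'" "pencil_hom Q P G G'"
  shows "pencil_trace (G * F) (G' * F') = pencil_trace (F * G) (F' * G')"
proof -
  note * = assms[unfolded pencil_hom_def]
  show ?thesis unfolding pencil_trace_def
    using * sum_diag_mult_comm[of G "dim_row (fst P)" "dim_row (fst Q)" F]
      sum_diag_mult_comm[of G' "dim_col (fst P)" "dim_col (fst Q)" F'] by auto
qed

text \<open>Holds for every \<open>c\<close> if the matrix has no rows, as on the row side of (F_0,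
  G_0); only both sides of an endomorphism together determine the constant.\<close>

definition scalar_diag :: "'a \<Rightarrow> 'a mat \<Rightarrow> bool" where
  "scalar_diag c A \<longleftrightarrow> (\<forall>i < dim_row A. A $$ (i, i) = c)"

text \<open>A concrete form of having a local endomorphism ring with the scalars as residue field:
  in the given basis every endomorphism is a scalar plus a strictly triangular part. Positive total
  size makes the scalar unique.\<close>

definition local_pencil :: "'a :: comm_ring_1 mat \<times> 'a mat \<Rightarrow> bool" where
  "local_pencil P \<longleftrightarrow> is_pencil P \<and> dim_row (fst P) + dim_col (fst P) > 0 \<and>
     (\<forall>X Y. pencil_hom P P X Y \<longrightarrow>
        upper_triangular X \<and> upper_triangular Y \<and> (\<exists>c. scalar_diag c X \<and> scalar_diag c Y))"

definition chi :: "'a :: field mat \<times> 'a mat \<Rightarrow> 'a mat \<Rightarrow> 'a mat \<Rightarrow> 'a" where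
  "chi P X Y = pencil_trace X Y / of_nat (dim_row (fst P) + dim_col (fst P))"

lemma upper_triangular_mult_diag:
  fixes A B :: "'a :: semiring_0 mat"
  assumes A: "A \<in> carrier_mat n n" "upper_triangular A" and B: "B \<in> carrier_mat n n" "upper_triangular B"
    and i: "i < n"
  shows "(A * B) $$ (i, i) = A $$ (i, i) * B $$ (i, i)"
proof -
  have "(A * B) $$ (i, i) = (\<Sum>l<n. if l = i then A $$ (i, i) * B $$ (i, i) else 0)"
    unfolding index_mult_mat_sum[OF A(1) B(1) i i]
  proof (rule sum.cong)
    fix l assume "l \<in> {..<n}"
    then show "A $$ (i, l) * B $$ (l, i) = (if l = i then A $$ (i, i) * B $$ (i, i) else 0)"
      using upper_triangularD[OF A(2), of l i] upper_triangularD[OF B(2), of i l] A(1) B(1) i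
      by (cases l i rule: linorder_cases) auto
  qed simp
  then show ?thesis using i by simp
qed

lemma scalar_diag_invertible:
  fixes A :: "'a :: field mat"
  assumes "A \<in> carrier_mat n n" "upper_triangular A" "scalar_diag c A" "c \<noteq> 0"
  shows "invertible_mat A"
proof -
  have "0 \<notin> set (diag_mat A)" using assms by (auto simp: diag_mat_def scalar_diag_def)
  then show ?thesis
    unfolding invertible_mat_iff_det[OF assms(1)] det_upper_triangular[OF assms(2,1)]
    by (simp add: prod_list_zero_iff)
qed

lemma local_pencil_endo:
  fixes P :: "'a :: field_char_0 mat \<times> 'a mat"
  assumes "local_pencil P" "pencil_hom P P X Y"
  shows "upper_triangular X" "upper_triangular Y" "scalar_diag (chi P X Y) X" "scalar_diag (chi P X Y) Y"
proof -
  obtain c where c: "upper_triangular X" "upper_triangular Y" "scalar_diag c X" "scalar_diag c Y"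
    using assms unfolding local_pencil_def by blast
  have "pencil_trace X Y = of_nat (dim_row (fst P) + dim_col (fst P)) * c"
    using c assms(2) by (auto simp: pencil_trace_def scalar_diag_def pencil_hom_def algebra_simps)
  moreover have "(of_nat (dim_row (fst P) + dim_col (fst P)) :: 'a) \<noteq> 0"
    using assms(1) unfolding local_pencil_def of_nat_eq_0_iff by linarith
  ultimately have "chi P X Y = c" by (simp add: chi_def)
  with c show "upper_triangular X" "upper_triangular Y" "scalar_diag (chi P X Y) X" "scalar_diag (chi P X Y) Y"
    by auto
qed

lemma local_pencil_is_pencil: "local_pencil P \<Longrightarrow> is_pencil P"
  by (simp add: local_pencil_def)

lemma chi_unique:
  fixes P :: "'a :: field_char_0 mat \<times> 'a mat"
  assumes "local_pencil P" "pencil_hom P P X Y" "scalar_diag c X" "scalar_diag c Y"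
  shows "chi P X Y = c"
proof -
  have "0 < dim_row X \<or> 0 < dim_row Y"
    using assms(1,2) by (auto simp: local_pencil_def pencil_hom_def)
  then show ?thesis using local_pencil_endo(3,4)[OF assms(1,2)] assms(3,4)
    unfolding scalar_diag_def by metis
qed

lemma chi_mult:
  fixes P :: "'a :: field_char_0 mat \<times> 'a mat"
  assumes "local_pencil P" "pencil_hom P P X Y" "pencil_hom P P X' Y'"
  shows "chi P (X * X') (Y * Y') = chi P X Y * chi P X' Y'"
proof (rule chi_unique[OF assms(1)])
  have "is_pencil P" using assms(1) by (simp add: local_pencil_def)
  then show "pencil_hom P P (X * X') (Y * Y')" using assms pencil_hom_comp by blast
  have c: "X \<in> carrier_mat (dim_row (fst P)) (dim_row (fst P))" "Y \<in> carrier_mat (dim_col (fst P)) (dim_col (fst P))"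
    "X' \<in> carrier_mat (dim_row (fst P)) (dim_row (fst P))" "Y' \<in> carrier_mat (dim_col (fst P)) (dim_col (fst P))"
    using assms by (auto simp: pencil_hom_def)
  note e = local_pencil_endo[OF assms(1,2)] local_pencil_endo[OF assms(1,3)]
  show "scalar_diag (chi P X Y * chi P X' Y') (X * X')"
    using e(3,7) c unfolding scalar_diag_def
    by (auto simp del: index_mult_mat(1) simp: upper_triangular_mult_diag[OF c(1) e(1) c(3) e(5)])
  show "scalar_diag (chi P X Y * chi P X' Y') (Y * Y')"
    using e(4,8) c unfolding scalar_diag_def
    by (auto simp del: index_mult_mat(1) simp: upper_triangular_mult_diag[OF c(2) e(2) c(4) e(6)])
qed

lemma chi_one:
  fixes P :: "'a :: field_char_0 mat \<times> 'a mat"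
  assumes "local_pencil P"
  shows "chi P (1\<^sub>m (dim_row (fst P))) (1\<^sub>m (dim_col (fst P))) = 1"
  using assms by (intro chi_unique pencil_hom_id) (auto simp: local_pencil_def scalar_diag_def)

lemma chi_zero: "chi P (0\<^sub>m m m) (0\<^sub>m n n) = 0"
  by (simp add: chi_def pencil_trace_def)

lemma chi_add:
  assumes "X \<in> carrier_mat m m" "X' \<in> carrier_mat m m" "Y \<in> carrier_mat n n" "Y' \<in> carrier_mat n n"
  shows "chi P (X + X') (Y + Y') = chi P X Y + chi P X' Y'"
  using assms by (auto simp: chi_def pencil_trace_def sum.distrib add_divide_distrib)

text \<open>Exchanging the factors keeps the trace, so the composite on \<open>Q\<close> has nonzero
  \<chi> as well; the two normalisations differ by a nonzero factor only. Hence both composites are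
  triangular with nonzero diagonal.\<close>

lemma local_pencil_iso_of_chi:
  fixes P Q :: "'a :: field_char_0 mat \<times> 'a mat"
  assumes P: "local_pencil P" and Q: "local_pencil Q"
    and F: "pencil_hom P Q F F'" and G: "pencil_hom Q P G G'"
    and nz: "chi P (G * F) (G' * F') \<noteq> 0"
  shows "pencil_iso P Q"
proof -
  have pen: "is_pencil P" "is_pencil Q" using P Q by (auto simp: local_pencil_def)
  have GF: "pencil_hom P P (G * F) (G' * F')" and FG: "pencil_hom Q Q (F * G) (F' * G')"
    using pencil_hom_comp pen F G by blast+
  have nz': "chi Q (F * G) (F' * G') \<noteq> 0"
    using nz Q unfolding chi_def pencil_trace_comm[OF F G] local_pencil_def of_nat_eq_0_iff divide_eq_0_iff
    by (simp del: of_nat_add)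
  note e = local_pencil_endo[OF P GF] local_pencil_endo[OF Q FG]
  \<comment> \<open>With both products invertible, the rank inequality in the two directions gives r
    = t, and then det A cannot vanish.\<close>
  have iso: "r = t \<and> invertible_mat A" if A: "A \<in> carrier_mat r t" and B: "B \<in> carrier_mat t r"
    and "upper_triangular (B * A)" "scalar_diag c (B * A)" "c \<noteq> 0"
    and "upper_triangular (A * B)" "scalar_diag d (A * B)" "d \<noteq> 0" for A B :: "'a mat" and r t c d
  proof -
    have AB: "A * B \<in> carrier_mat r r" "B * A \<in> carrier_mat t t" using A B by auto
    have det: "det (B * A) \<noteq> 0" "det (A * B) \<noteq> 0"
      using that scalar_diag_invertible AB invertible_mat_iff_det by blast+
    then have rt: "r = t"
      using det_mult_nonzero_imp_le[OF A B] det_mult_nonzero_imp_le[OF B A] by simp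
    with A B det show ?thesis by (simp add: det_mult[of A r B] invertible_mat_iff_det[of A r])
  qed
  have "invertible_mat F"
    using iso[of F _ _ G] F G e nz nz' unfolding pencil_hom_def by blast
  moreover have "invertible_mat F'"
    using iso[of F' _ _ G'] F G e nz nz' unfolding pencil_hom_def by blast
  ultimately show ?thesis using pen F by (auto intro: pencil_isoI)
qed

section \<open>Inclusions and projections of a direct sum of two pencils\<close>

definition inl_mat :: "nat \<Rightarrow> nat \<Rightarrow> 'a :: {zero, one} mat" where
  "inl_mat a b = mat (a + b) a (\<lambda>(i, j). if i = j then 1 else 0)"
definition inr_mat :: "nat \<Rightarrow> nat \<Rightarrow> 'a :: {zero, one} mat" where
  "inr_mat a b = mat (a + b) b (\<lambda>(i, j). if i = a + j then 1 else 0)"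

text \<open>The biproduct identities: \<open>L\<close> and \<open>R\<close> are the inclusions of
  the two summands, their transposes are the projections.\<close>

lemma inl_inr_mat:
  fixes a b
  defines "L \<equiv> inl_mat a b :: 'a :: comm_ring_1 mat" and "R \<equiv> inr_mat a b :: 'a mat"
  shows "L \<in> carrier_mat (a + b) a" "R \<in> carrier_mat (a + b) b"
    "L\<^sup>T * L = 1\<^sub>m a" "R\<^sup>T * R = 1\<^sub>m b" "L\<^sup>T * R = 0\<^sub>m a b" "R\<^sup>T * L = 0\<^sub>m b a"
    "L * L\<^sup>T + R * R\<^sup>T = 1\<^sub>m (a + b)"
proof -
  show c: "L \<in> carrier_mat (a + b) a" "R \<in> carrier_mat (a + b) b"
    by (auto simp: L_def R_def inl_mat_def inr_mat_def)
  have ct: "L\<^sup>T \<in> carrier_mat a (a + b)" "R\<^sup>T \<in> carrier_mat b (a + b)" using c by auto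
  have Lij: "L $$ (i, j) = (if i = j then 1 else 0)" if "i < a + b" "j < a" for i j
    using that by (simp add: L_def inl_mat_def)
  have Rij: "R $$ (i, j) = (if i = a + j then 1 else 0)" if "i < a + b" "j < b" for i j
    using that by (simp add: R_def inr_mat_def)
  note m = index_mult_mat_sum[OF ct(1) c(1)] index_mult_mat_sum[OF ct(1) c(2)]
    index_mult_mat_sum[OF ct(2) c(1)] index_mult_mat_sum[OF ct(2) c(2)]
    index_mult_mat_sum[OF c(1) ct(1)] index_mult_mat_sum[OF c(2) ct(2)]
  show "L\<^sup>T * L = 1\<^sub>m a"
    by (rule eq_matI) (use c in \<open>auto simp del: index_mult_mat(1) simp: m Lij Rij if_distrib[of "\<lambda>x. x * _"] cong: if_cong\<close>)
  show "R\<^sup>T * R = 1\<^sub>m b"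
    by (rule eq_matI) (use c in \<open>auto simp del: index_mult_mat(1) simp: m Lij Rij if_distrib[of "\<lambda>x. x * _"] cong: if_cong\<close>)
  show "L\<^sup>T * R = 0\<^sub>m a b"
    by (rule eq_matI) (use c in \<open>auto simp del: index_mult_mat(1) simp: m Lij Rij if_distrib[of "\<lambda>x. x * _"] cong: if_cong\<close>)
  show "R\<^sup>T * L = 0\<^sub>m b a"
    by (rule eq_matI) (use c in \<open>auto simp del: index_mult_mat(1) simp: m Lij Rij if_distrib[of "\<lambda>x. x * _"] cong: if_cong\<close>)
  show "L * L\<^sup>T + R * R\<^sup>T = 1\<^sub>m (a + b)"
  proof (rule eq_matI)
    fix i j assume "i < dim_row (1\<^sub>m (a + b) :: 'a mat)" "j < dim_col (1\<^sub>m (a + b) :: 'a mat)"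
    then have ij: "i < a + b" "j < a + b" by auto
    have "(\<Sum>l<a. L $$ (i, l) * L $$ (j, l)) = (if i = j \<and> i < a then 1 else 0)"
      using ij by (auto simp: Lij if_distrib[of "\<lambda>x. x * _"] cong: if_cong)
    moreover have "(\<Sum>l<b. R $$ (i, l) * R $$ (j, l)) = (\<Sum>l<b. if l = i - a then (if i = j \<and> a \<le> i then 1 else 0) else 0)"
      using ij by (intro sum.cong) (auto simp: Rij)
    ultimately show "(L * L\<^sup>T + R * R\<^sup>T) $$ (i, j) = 1\<^sub>m (a + b) $$ (i, j)"
      using ij c by (auto simp del: index_mult_mat(1) simp: m)
  qed (use c in auto)
qed

lemma mdsum_inl_inr:
  fixes A B :: "'a :: comm_ring_1 mat"
  assumes A: "A \<in> carrier_mat m n" and B: "B \<in> carrier_mat p q"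
  shows "inl_mat m p * A = mdsum A B * inl_mat n q" "inr_mat m p * B = mdsum A B * inr_mat n q"
proof -
  let ?L = "inl_mat m p :: 'a mat" let ?L' = "inl_mat n q :: 'a mat"
  let ?R = "inr_mat m p :: 'a mat" let ?R' = "inr_mat n q :: 'a mat"
  have inl_index: "inl_mat x y $$ (i, j) = (if i = j then 1 else 0)" if "i < x + y" "j < x" for i j x y
    using that by (simp add: inl_mat_def)
  have inr_index: "inr_mat x y $$ (i, j) = (if i = x + j then 1 else 0)" if "i < x + y" "j < y" for i j x y
    using that by (simp add: inr_mat_def)
  note c = inl_inr_mat(1,2)[of m p, where 'a = 'a] inl_inr_mat(1,2)[of n q, where 'a = 'a]
  note D = mdsum_carrier[OF A B] index_mdsum[OF A B]
  show "?L * A = mdsum A B * ?L'"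
  proof (rule eq_matI)
    fix i j assume "i < dim_row (mdsum A B * ?L')" "j < dim_col (mdsum A B * ?L')"
    then have ij: "i < m + p" "j < n" using A B c by auto
    have "(?L * A) $$ (i, j) = (\<Sum>l<m. if l = i then A $$ (i, j) else 0)"
      using ij unfolding index_mult_mat_sum[OF c(1) A ij] by (intro sum.cong) (auto simp: inl_mat_def)
    also have "\<dots> = (mdsum A B * ?L') $$ (i, j)"
      using ij by (auto simp del: index_mult_mat(1) simp: index_mult_mat_sum[OF D(1) c(3)] D(2) inl_index
        if_distrib[of "\<lambda>x. _ * x"] cong: if_cong)
    finally show "(?L * A) $$ (i, j) = (mdsum A B * ?L') $$ (i, j)" .
  qed (use A B c in auto)
  show "?R * B = mdsum A B * ?R'"
  proof (rule eq_matI)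
    fix i j assume "i < dim_row (mdsum A B * ?R')" "j < dim_col (mdsum A B * ?R')"
    then have ij: "i < m + p" "j < q" using A B c by auto
    have "(?R * B) $$ (i, j) = (\<Sum>l<p. if l = i - m then (if m \<le> i then B $$ (i - m, j) else 0) else 0)"
      using ij unfolding index_mult_mat_sum[OF c(2) B ij] by (intro sum.cong) (auto simp: inr_mat_def)
    also have "\<dots> = (mdsum A B * ?R') $$ (i, j)"
      using ij by (auto simp del: index_mult_mat(1) simp: index_mult_mat_sum[OF D(1) c(4)] D(2) inr_index
        if_distrib[of "\<lambda>x. x * _"] if_distrib[of "\<lambda>x. _ * x"] cong: if_cong)
    finally show "(?R * B) $$ (i, j) = (mdsum A B * ?R') $$ (i, j)" .
  qed (use A B c in auto)
qed

text \<open>Transposing the inclusion identities for the transposed summands gives the projection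
  identities.\<close>

lemma mdsum_inl_inr_transpose:
  fixes A B :: "'a :: comm_ring_1 mat"
  assumes A: "A \<in> carrier_mat m n" and B: "B \<in> carrier_mat p q"
  shows "(inl_mat m p)\<^sup>T * mdsum A B = A * (inl_mat n q)\<^sup>T"
    "(inr_mat m p)\<^sup>T * mdsum A B = B * (inr_mat n q)\<^sup>T"
proof -
  note c = inl_inr_mat(1,2)[of m p, where 'a = 'a] inl_inr_mat(1,2)[of n q, where 'a = 'a]
  have T: "A\<^sup>T \<in> carrier_mat n m" "B\<^sup>T \<in> carrier_mat q p" using A B by auto
  note * = mdsum_inl_inr[OF T]
  have tr: "X\<^sup>T * M = N * Y\<^sup>T"
    if "X \<in> carrier_mat x y" "M \<in> carrier_mat x z" "N \<in> carrier_mat y w" "Y \<in> carrier_mat z w"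
      and eq: "Y * N\<^sup>T = M\<^sup>T * X"
    for X M N Y :: "'a mat" and x y z w
  proof -
    have "(Y * N\<^sup>T)\<^sup>T = N * Y\<^sup>T" using that(3,4) by (subst transpose_mult[of _ z w _ y]) auto
    moreover have "(M\<^sup>T * X)\<^sup>T = X\<^sup>T * M" using that(1,2) by (subst transpose_mult[of _ z x _ y]) auto
    ultimately show ?thesis using eq by simp
  qed
  show "(inl_mat m p)\<^sup>T * mdsum A B = A * (inl_mat n q)\<^sup>T"
    by (rule tr[OF c(1) mdsum_carrier[OF A B] A c(3)]) (simp add: *(1) mdsum_transpose)
  show "(inr_mat m p)\<^sup>T * mdsum A B = B * (inr_mat n q)\<^sup>T"
    by (rule tr[OF c(2) mdsum_carrier[OF A B] B c(4)]) (simp add: *(2) mdsum_transpose)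
qed

lemma pencil_hom_inl_inr:
  fixes Q R :: "'a :: comm_ring_1 mat \<times> 'a mat"
  assumes "is_pencil Q" "is_pencil R"
  defines "a \<equiv> dim_row (fst Q)" and "b \<equiv> dim_row (fst R)"
    and "c \<equiv> dim_col (fst Q)" and "d \<equiv> dim_col (fst R)"
  shows "pencil_hom Q (pdsum Q R) (inl_mat a b) (inl_mat c d)"
    "pencil_hom R (pdsum Q R) (inr_mat a b) (inr_mat c d)"
    "pencil_hom (pdsum Q R) Q ((inl_mat a b)\<^sup>T) ((inl_mat c d)\<^sup>T)"
    "pencil_hom (pdsum Q R) R ((inr_mat a b)\<^sup>T) ((inr_mat c d)\<^sup>T)"
proof -
  have *: "fst Q \<in> carrier_mat a c" "snd Q \<in> carrier_mat a c" "fst R \<in> carrier_mat b d" "snd R \<in> carrier_mat b d"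
    using assms by (auto simp: is_pencil_def)
  note eqs = mdsum_inl_inr[OF *(1,3)] mdsum_inl_inr[OF *(2,4)]
    mdsum_inl_inr_transpose[OF *(1,3)] mdsum_inl_inr_transpose[OF *(2,4)]
  show "pencil_hom Q (pdsum Q R) (inl_mat a b) (inl_mat c d)"
    "pencil_hom R (pdsum Q R) (inr_mat a b) (inr_mat c d)"
    "pencil_hom (pdsum Q R) Q ((inl_mat a b)\<^sup>T) ((inl_mat c d)\<^sup>T)"
    "pencil_hom (pdsum Q R) R ((inr_mat a b)\<^sup>T) ((inr_mat c d)\<^sup>T)"
    unfolding pencil_hom_def using * inl_inr_mat(1,2)[of a b, where 'a = 'a]
      inl_inr_mat(1,2)[of c d, where 'a = 'a] eqs by (auto simp: pdsum_def)
qed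

text \<open>The resolution of the identity is inserted between \<open>X\<close> and
  \<open>Y\<close>: a map through a direct sum is the sum of the maps through its summands.\<close>

lemma mult_split_inl_inr:
  fixes X Y :: "'a :: comm_ring_1 mat"
  assumes X: "X \<in> carrier_mat m (a + b)" and Y: "Y \<in> carrier_mat (a + b) n"
  shows "X * Y = (X * inl_mat a b) * ((inl_mat a b)\<^sup>T * Y) + (X * inr_mat a b) * ((inr_mat a b)\<^sup>T * Y)"
proof -
  define L R where "L = (inl_mat a b :: 'a mat)" and "R = (inr_mat a b :: 'a mat)"
  have L: "L \<in> carrier_mat (a + b) a" and R: "R \<in> carrier_mat (a + b) b"
    and one: "L * L\<^sup>T + R * R\<^sup>T = 1\<^sub>m (a + b)"
    unfolding L_def R_def using inl_inr_mat[of a b, where 'a = 'a] by auto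
  have LT: "L\<^sup>T \<in> carrier_mat a (a + b)" and RT: "R\<^sup>T \<in> carrier_mat b (a + b)" using L R by auto
  have "(X * M) * (M\<^sup>T * Y) = X * ((M * M\<^sup>T) * Y)" if M: "M \<in> carrier_mat (a + b) c" for M c
  proof -
    have MT: "M\<^sup>T \<in> carrier_mat c (a + b)" using M by auto
    show ?thesis
      unfolding assoc_mult_mat[OF X M mult_carrier_mat[OF MT Y]] assoc_mult_mat[OF M MT Y] ..
  qed
  from this[OF L] this[OF R]
  have "(X * L) * (L\<^sup>T * Y) + (X * R) * (R\<^sup>T * Y) = X * ((L * L\<^sup>T) * Y) + X * ((R * R\<^sup>T) * Y)" by simp
  also have "\<dots> = X * ((L * L\<^sup>T) * Y + (R * R\<^sup>T) * Y)"
    using X Y L R LT RT by (intro mult_add_distrib_mat[symmetric]) auto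
  also have "(L * L\<^sup>T) * Y + (R * R\<^sup>T) * Y = (L * L\<^sup>T + R * R\<^sup>T) * Y"
    using Y L R LT RT by (intro add_mult_distrib_mat[symmetric]) auto
  finally show ?thesis using one Y unfolding L_def R_def by simp
qed

text \<open>The matrix of the values \<chi>(G_i F_j) has rank at most the multiplicity of
  \<open>P\<close> in the sum through which the maps pass. A summand equal to \<open>P\<close>
  contributes the rank-one term \<chi>(G_i) \<chi>(F_j), by multiplicativity; every other summand
  contributes 0. Summands isomorphic to \<open>P\<close> are equal to it by hypothesis, so
  \<open>count\<close> measures the right multiplicity; \<open>u\<close> and \<open>v\<close> are
  the two factors of the matrix.\<close>

lemma chi_factor:
  fixes P :: "'a :: field_char_0 mat \<times> 'a mat"
  assumes P: "local_pencil P"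
    and Qs: "\<And>Q. Q \<in> set Qs \<Longrightarrow> local_pencil Q" "\<And>Q. Q \<in> set Qs \<Longrightarrow> pencil_iso P Q \<Longrightarrow> Q = P"
    and F: "\<And>j. j \<in> J \<Longrightarrow> pencil_hom P (psum Qs) (F j) (F' j)"
    and G: "\<And>i. i \<in> I \<Longrightarrow> pencil_hom (psum Qs) P (G i) (G' i)"
  shows "\<exists>u v. \<forall>i \<in> I. \<forall>j \<in> J.
    chi P (G i * F j) (G' i * F' j) = (\<Sum>t<count (mset Qs) P. u i t * v t j)"
  using Qs F G
proof (induction Qs arbitrary: F F' G G')
  case Nil
  have "G i * F j = 0\<^sub>m (dim_row (fst P)) (dim_row (fst P))" "G' i * F' j = 0\<^sub>m (dim_col (fst P)) (dim_col (fst P))"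
    if "i \<in> I" "j \<in> J" for i j
    using Nil(3)[OF that(2)] Nil(4)[OF that(1)]
    by (auto simp: pencil_hom_def scalar_prod_def intro!: eq_matI)
  then show ?case by (simp add: chi_zero)
next
  case (Cons Q Qs)
  let ?R = "psum Qs"
  have pen: "is_pencil P" "is_pencil Q" "is_pencil ?R" "is_pencil (pdsum Q ?R)"
    using P Cons.prems(1)[THEN local_pencil_is_pencil] local_pencil_is_pencil
    by (simp_all add: is_pencil_psum is_pencil_pdsum)
  define a b c d where "a = dim_row (fst Q)" and "b = dim_row (fst ?R)"
    and "c = dim_col (fst Q)" and "d = dim_col (fst ?R)"
  note inj = pencil_hom_inl_inr[OF pen(2,3), folded a_def b_def c_def d_def]
  have F: "pencil_hom P (pdsum Q ?R) (F j) (F' j)" if "j \<in> J" for j using Cons.prems(3) that by simp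
  have G: "pencil_hom (pdsum Q ?R) P (G i) (G' i)" if "i \<in> I" for i using Cons.prems(4) that by simp
  define F1 F1' G1 G1' where "F1 = (\<lambda>j. (inl_mat a b)\<^sup>T * F j)" and "F1' = (\<lambda>j. (inl_mat c d)\<^sup>T * F' j)"
    and "G1 = (\<lambda>i. G i * inl_mat a b)" and "G1' = (\<lambda>i. G' i * inl_mat c d)"
  define F2 F2' G2 G2' where "F2 = (\<lambda>j. (inr_mat a b)\<^sup>T * F j)" and "F2' = (\<lambda>j. (inr_mat c d)\<^sup>T * F' j)"
    and "G2 = (\<lambda>i. G i * inr_mat a b)" and "G2' = (\<lambda>i. G' i * inr_mat c d)"
  have F1: "pencil_hom P Q (F1 j) (F1' j)" and F2: "pencil_hom P ?R (F2 j) (F2' j)" if "j \<in> J" for j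
    unfolding F1_def F1'_def F2_def F2'_def
    using pencil_hom_comp[OF pen(1,4,2) F[OF that] inj(3)] pencil_hom_comp[OF pen(1,4,3) F[OF that] inj(4)] by auto
  have G1: "pencil_hom Q P (G1 i) (G1' i)" and G2: "pencil_hom ?R P (G2 i) (G2' i)" if "i \<in> I" for i
    unfolding G1_def G1'_def G2_def G2'_def
    using pencil_hom_comp[OF pen(2,4,1) inj(1) G[OF that]] pencil_hom_comp[OF pen(3,4,1) inj(2) G[OF that]] by auto
  have split: "chi P (G i * F j) (G' i * F' j)
      = chi P (G1 i * F1 j) (G1' i * F1' j) + chi P (G2 i * F2 j) (G2' i * F2' j)"
    if "i \<in> I" "j \<in> J" for i j
  proof -
    define m n where "m = dim_row (fst P)" and "n = dim_col (fst P)"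
    have car: "G i \<in> carrier_mat m (a + b)" "F j \<in> carrier_mat (a + b) m"
      "G' i \<in> carrier_mat n (c + d)" "F' j \<in> carrier_mat (c + d) n"
      using F[OF that(2)] G[OF that(1)] unfolding pencil_hom_def pdsum_def a_def b_def c_def d_def m_def n_def
      by auto
    have eq: "G i * F j = G1 i * F1 j + G2 i * F2 j" "G' i * F' j = G1' i * F1' j + G2' i * F2' j"
      unfolding G1_def G1'_def G2_def G2'_def F1_def F1'_def F2_def F2'_def
      using mult_split_inl_inr[OF car(1,2)] mult_split_inl_inr[OF car(3,4)] by auto
    have "G1 i * F1 j \<in> carrier_mat m m" "G2 i * F2 j \<in> carrier_mat m m"
      "G1' i * F1' j \<in> carrier_mat n n" "G2' i * F2' j \<in> carrier_mat n n"
      using F1[OF that(2)] F2[OF that(2)] G1[OF that(1)] G2[OF that(1)]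
      unfolding pencil_hom_def m_def n_def by auto
    then show ?thesis unfolding eq by (rule chi_add)
  qed
  obtain u v where uv: "\<And>i j. i \<in> I \<Longrightarrow> j \<in> J \<Longrightarrow>
      chi P (G2 i * F2 j) (G2' i * F2' j) = (\<Sum>t<count (mset Qs) P. u i t * v t j)"
    using Cons.IH[of F2 F2' G2 G2'] Cons.prems(1,2) F2 G2 by auto
  show ?case
  proof (cases "Q = P")
    case True
    \<comment> \<open>The tail occupies the indices below \<open>count (mset Qs) P\<close>; the head
      takes the next one.\<close>
    define u' where "u' = (\<lambda>i t. if t < count (mset Qs) P then u i t else chi P (G1 i) (G1' i))"
    define v' where "v' = (\<lambda>t j. if t < count (mset Qs) P then v t j else chi P (F1 j) (F1' j))"
    have "chi P (G1 i * F1 j) (G1' i * F1' j) = chi P (G1 i) (G1' i) * chi P (F1 j) (F1' j)"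
      if "i \<in> I" "j \<in> J" for i j
      using F1[OF that(2)] G1[OF that(1)] chi_mult[OF P] True by blast
    then have "\<forall>i \<in> I. \<forall>j \<in> J.
      chi P (G i * F j) (G' i * F' j) = (\<Sum>t<count (mset (Q # Qs)) P. u' i t * v' t j)"
      using True split uv by (simp add: u'_def v'_def)
    then show ?thesis by blast
  next
    case False
    then have "\<not> pencil_iso P Q" using Cons.prems(2)[of Q] by auto
    \<comment> \<open>A nonzero value would make \<open>P\<close> and \<open>Q\<close>
      isomorphic.\<close>
    then have "chi P (G1 i * F1 j) (G1' i * F1' j) = 0" if "i \<in> I" "j \<in> J" for i j
      using local_pencil_iso_of_chi[OF P Cons.prems(1) F1[OF that(2)] G1[OF that(1)]] by auto
    then have "\<forall>i \<in> I. \<forall>j \<in> J.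
      chi P (G i * F j) (G' i * F' j) = (\<Sum>t<count (mset (Q # Qs)) P. u i t * v t j)"
      using False split uv by simp
    then show ?thesis by blast
  qed
qed

text \<open>The embeddings \<open>F\<close> and the projections \<open>G\<close> dual to them
  exhibit the r-fold sum of \<open>P\<close> as a direct summand of \<open>M\<close>.\<close>

definition dual_homs where
  "dual_homs P M r F F' G G' \<longleftrightarrow>
    (\<forall>j<r. pencil_hom P M (F j) (F' j) \<and> pencil_hom M P (G j) (G' j)) \<and>
    (\<forall>i<r. \<forall>j<r.
       G i * F j = (if i = j then 1\<^sub>m (dim_row (fst P)) else 0\<^sub>m (dim_row (fst P)) (dim_row (fst P))) \<and>
       G' i * F' j = (if i = j then 1\<^sub>m (dim_col (fst P)) else 0\<^sub>m (dim_col (fst P)) (dim_col (fst P))))"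

lemma dual_homsD:
  assumes "dual_homs P M r F F' G G'"
  shows "j < r \<Longrightarrow> pencil_hom P M (F j) (F' j)" "j < r \<Longrightarrow> pencil_hom M P (G j) (G' j)"
    "i < r \<Longrightarrow> j < r \<Longrightarrow>
       G i * F j = (if i = j then 1\<^sub>m (dim_row (fst P)) else 0\<^sub>m (dim_row (fst P)) (dim_row (fst P)))"
    "i < r \<Longrightarrow> j < r \<Longrightarrow>
       G' i * F' j = (if i = j then 1\<^sub>m (dim_col (fst P)) else 0\<^sub>m (dim_col (fst P)) (dim_col (fst P)))"
  using assms unfolding dual_homs_def by blast+

lemma psum_copies:
  fixes P :: "'a :: comm_ring_1 mat \<times> 'a mat"
  assumes P: "is_pencil P" and Qs: "\<And>Q. Q \<in> set Qs \<Longrightarrow> is_pencil Q"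
  shows "\<exists>F F' G G'. dual_homs P (psum Qs) (count (mset Qs) P) F F' G G'"
  using Qs
proof (induction Qs)
  case Nil
  show ?case by (simp add: dual_homs_def)
next
  case (Cons Q Qs)
  let ?R = "psum Qs" and ?n = "count (mset Qs) P"
  have pen: "is_pencil P" "is_pencil Q" "is_pencil ?R" "is_pencil (pdsum Q ?R)"
    using P Cons.prems by (simp_all add: is_pencil_psum is_pencil_pdsum)
  define a b c d where "a = dim_row (fst Q)" and "b = dim_row (fst ?R)"
    and "c = dim_col (fst Q)" and "d = dim_col (fst ?R)"
  note inj = pencil_hom_inl_inr[OF pen(2,3), folded a_def b_def c_def d_def]
  obtain F F' G G' where "dual_homs P ?R ?n F F' G G'" using Cons.IH Cons.prems by auto
  note F = dual_homsD(1)[OF this] and G = dual_homsD(2)[OF this] and GF = dual_homsD(3,4)[OF this]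
  define m n where "m = dim_row (fst P)" and "n = dim_col (fst P)"
  \<comment> \<open>Indices below \<open>?n\<close> run through the tail. The index
    \<open>?n\<close> occurs only for Q = P, where the inclusion and projection of the head serve
    directly.\<close>
  define f f' g g' where "f = (\<lambda>j. if j < ?n then inr_mat a b * F j else inl_mat a b)"
    and "f' = (\<lambda>j. if j < ?n then inr_mat c d * F' j else inl_mat c d)"
    and "g = (\<lambda>j. if j < ?n then G j * (inr_mat a b)\<^sup>T else (inl_mat a b)\<^sup>T)"
    and "g' = (\<lambda>j. if j < ?n then G' j * (inr_mat c d)\<^sup>T else (inl_mat c d)\<^sup>T)"
  have hom: "pencil_hom P (pdsum Q ?R) (f j) (f' j)" "pencil_hom (pdsum Q ?R) P (g j) (g' j)"
    if "j < ?n \<or> Q = P" for j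
    using that pencil_hom_comp[OF pen(1,3,4) F inj(2)] pencil_hom_comp[OF pen(4,3,1) inj(4) G] inj(1,3)
    by (auto simp: f_def f'_def g_def g'_def)
  have car: "F j \<in> carrier_mat b m" "F' j \<in> carrier_mat d n" "G j \<in> carrier_mat m b" "G' j \<in> carrier_mat n d"
    if "j < ?n" for j
    using F[OF that] G[OF that] by (auto simp: pencil_hom_def m_def n_def b_def d_def)
  have mult: "(X * R\<^sup>T) * (R * Y) = X * Y" "(X * R\<^sup>T) * L = 0\<^sub>m k p" "L\<^sup>T * (R * Y) = 0\<^sub>m p k" "L\<^sup>T * L = 1\<^sub>m p"
    if X: "X \<in> carrier_mat k q" and Y: "Y \<in> carrier_mat q k" and "L = inl_mat p q" "R = inr_mat p q"
    for X Y L R :: "'a mat" and p q k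
  proof -
    have L: "L \<in> carrier_mat (p + q) p" "L\<^sup>T \<in> carrier_mat p (p + q)"
      and R: "R \<in> carrier_mat (p + q) q" "R\<^sup>T \<in> carrier_mat q (p + q)"
      using inl_inr_mat(1,2)[of p q, where 'a = 'a] that by auto
    note orth = inl_inr_mat(3-6)[of p q, where 'a = 'a, folded that(3,4)]
    show "(X * R\<^sup>T) * (R * Y) = X * Y"
      unfolding assoc_mult_mat[OF X R(2) mult_carrier_mat[OF R(1) Y]]
        assoc_mult_mat[OF R(2,1) Y, symmetric] using orth Y by simp
    show "(X * R\<^sup>T) * L = 0\<^sub>m k p"
      unfolding assoc_mult_mat[OF X R(2) L(1)] using orth X by simp
    show "L\<^sup>T * (R * Y) = 0\<^sub>m p k"
      unfolding assoc_mult_mat[OF L(2) R(1) Y, symmetric] using orth Y by simp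
    show "L\<^sup>T * L = 1\<^sub>m p" using orth by simp
  qed
  have Suc_cases: "i < ?n \<or> i = ?n \<and> Q = P" if "i < count (mset (Q # Qs)) P" for i
    using that by (auto split: if_splits)
  have prod: "g i * f j = (if i = j then 1\<^sub>m m else 0\<^sub>m m m) \<and> g' i * f' j = (if i = j then 1\<^sub>m n else 0\<^sub>m n n)"
    if i: "i < count (mset (Q # Qs)) P" and j: "j < count (mset (Q # Qs)) P" for i j
  proof (cases "i < ?n"; cases "j < ?n")
    assume ij: "i < ?n" "j < ?n"
    then show ?thesis
      using mult(1)[OF car(3)[OF ij(1)] car(1)[OF ij(2)] HOL.refl HOL.refl, of a]
        mult(1)[OF car(4)[OF ij(1)] car(2)[OF ij(2)] HOL.refl HOL.refl, of c] GF[OF ij]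
      by (simp add: f_def f'_def g_def g'_def m_def n_def)
  next
    assume ij: "i < ?n" "\<not> j < ?n"
    then have "Q = P" using Suc_cases[OF j] by simp
    then show ?thesis using ij
        mult(2)[OF car(3)[OF ij(1)] car(1)[OF ij(1)] HOL.refl HOL.refl, of a]
        mult(2)[OF car(4)[OF ij(1)] car(2)[OF ij(1)] HOL.refl HOL.refl, of c]
      by (auto simp: f_def f'_def g_def g'_def m_def n_def a_def c_def)
  next
    assume ij: "\<not> i < ?n" "j < ?n"
    then have "Q = P" using Suc_cases[OF i] by simp
    then show ?thesis using ij
        mult(3)[OF car(3)[OF ij(2)] car(1)[OF ij(2)] HOL.refl HOL.refl, of a]
        mult(3)[OF car(4)[OF ij(2)] car(2)[OF ij(2)] HOL.refl HOL.refl, of c]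
      by (auto simp: f_def f'_def g_def g'_def m_def n_def a_def c_def)
  next
    assume ij: "\<not> i < ?n" "\<not> j < ?n"
    then have "Q = P" "i = j" using Suc_cases[OF i] Suc_cases[OF j] by auto
    then show ?thesis using ij inl_inr_mat(3)
      by (auto simp: f_def f'_def g_def g'_def m_def n_def a_def c_def)
  qed
  show ?case
    unfolding dual_homs_def
  proof (intro exI conjI allI impI)
    fix i j assume i: "i < count (mset (Q # Qs)) P" and j: "j < count (mset (Q # Qs)) P"
    show "pencil_hom P (psum (Q # Qs)) (f j) (f' j)" "pencil_hom (psum (Q # Qs)) P (g j) (g' j)"
      using hom Suc_cases[OF j] by auto
    show "g i * f j = (if i = j then 1\<^sub>m (dim_row (fst P)) else 0\<^sub>m (dim_row (fst P)) (dim_row (fst P)))"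
      "g' i * f' j = (if i = j then 1\<^sub>m (dim_col (fst P)) else 0\<^sub>m (dim_col (fst P)) (dim_col (fst P)))"
      using prod[OF i j] unfolding m_def n_def by auto
  qed
qed

theorem local_decomposition_unique:
  fixes Ps Qs :: "('a :: field_char_0 mat \<times> 'a mat) list"
  assumes loc: "\<And>P. P \<in> set Ps \<union> set Qs \<Longrightarrow> local_pencil P"
    and eq: "\<And>P Q. P \<in> set Ps \<union> set Qs \<Longrightarrow> Q \<in> set Ps \<union> set Qs \<Longrightarrow> pencil_iso P Q \<Longrightarrow> P = Q"
    and iso: "pencil_iso (psum Ps) (psum Qs)"
  shows "mset Ps = mset Qs"
proof -
  \<comment> \<open>Stated for arbitrary lists with its own hypotheses, so that it can be applied
    again with the two lists exchanged.\<close>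
  have le: "count (mset Ps) P \<le> count (mset Qs) P"
    if loc: "\<And>P. P \<in> set Ps \<union> set Qs \<Longrightarrow> local_pencil P"
    and eq: "\<And>P Q. P \<in> set Ps \<union> set Qs \<Longrightarrow> Q \<in> set Ps \<union> set Qs \<Longrightarrow> pencil_iso P Q \<Longrightarrow> P = Q"
    and iso: "pencil_iso (psum Ps) (psum Qs)" for P Ps and Qs :: "('a mat \<times> 'a mat) list"
  proof (cases "P \<in> set Ps")
    case True
    then have P: "local_pencil P" using loc by auto
    have pen: "is_pencil P" "is_pencil (psum Ps)" "is_pencil (psum Qs)"
      using loc[THEN local_pencil_is_pencil] True by (simp_all add: is_pencil_psum)
    let ?r = "count (mset Ps) P" and ?t = "count (mset Qs) P"
    have "is_pencil Q" if "Q \<in> set Ps" for Q using loc[THEN local_pencil_is_pencil] that by simp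
    from psum_copies[OF pen(1) this] obtain F F' G G' where "dual_homs P (psum Ps) ?r F F' G G'" by blast
    note F = dual_homsD(1)[OF this] and G = dual_homsD(2)[OF this] and GF = dual_homsD(3,4)[OF this]
    obtain X Y X' Y' where XY: "pencil_hom (psum Ps) (psum Qs) X Y" "pencil_hom (psum Qs) (psum Ps) X' Y'"
      "X' * X = 1\<^sub>m (dim_row (fst (psum Ps)))" "Y' * Y = 1\<^sub>m (dim_col (fst (psum Ps)))"
      by (rule pencil_isoE[OF iso])
    have XF: "pencil_hom P (psum Qs) (X * F j) (Y * F' j)" if "j < ?r" for j
      using pencil_hom_comp[OF pen F[OF that] XY(1)] .
    have GX: "pencil_hom (psum Qs) P (G i * X') (G' i * Y')" if "i < ?r" for i
      using pencil_hom_comp[OF pen(3,2,1) XY(2) G[OF that]] .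
    have "\<exists>u v. \<forall>i \<in> {..<?r}. \<forall>j \<in> {..<?r}.
      chi P (G i * X' * (X * F j)) (G' i * Y' * (Y * F' j)) = (\<Sum>t<?t. u i t * v t j)"
    proof (rule chi_factor[OF P])
      show "Q = P" if "Q \<in> set Qs" "pencil_iso P Q" for Q using eq[of P Q] that True by simp
    qed (use loc XF GX in simp_all)
    then obtain u v where uv: "\<And>i j. i < ?r \<Longrightarrow> j < ?r \<Longrightarrow>
      chi P (G i * X' * (X * F j)) (G' i * Y' * (Y * F' j)) = (\<Sum>t<?t. u i t * v t j)" by auto
    have cancel: "A * B' * (B * C) = A * C" if "A \<in> carrier_mat k l" "C \<in> carrier_mat l k"
      "B \<in> carrier_mat q l" "B' \<in> carrier_mat l q" "B' * B = 1\<^sub>m l" for A B B' C :: "'a mat" and k l q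
      using assoc_mult_mat[OF that(1,4) mult_carrier_mat[OF that(3,2)]]
        assoc_mult_mat[OF that(4,3,2)] that by simp
    have GXF: "G i * X' * (X * F j) = G i * F j" "G' i * Y' * (Y * F' j) = G' i * F' j"
      if "i < ?r" "j < ?r" for i j
    proof -
      note h = G[OF that(1), unfolded pencil_hom_def] F[OF that(2), unfolded pencil_hom_def]
        XY(1,2)[unfolded pencil_hom_def]
      show "G i * X' * (X * F j) = G i * F j" by (rule cancel[OF _ _ _ _ XY(3)]) (use h in blast)+
      show "G' i * Y' * (Y * F' j) = G' i * F' j" by (rule cancel[OF _ _ _ _ XY(4)]) (use h in blast)+
    qed
    \<comment> \<open>The detour through the second decomposition cancels, so the matrix of values
      is the r x r identity, written as a product through dimension t.\<close>
    have one: "(\<Sum>t<?t. u i t * v t j) = (if i = j then 1 else 0)" if "i < ?r" "j < ?r" for i j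
      unfolding uv[OF that, symmetric] GXF[OF that] GF[OF that] using chi_one[OF P] by (simp add: chi_zero)
    define U V where "U = mat ?r ?t (\<lambda>(i, t). u i t)" and "V = mat ?t ?r (\<lambda>(t, j). v t j)"
    have UV: "U \<in> carrier_mat ?r ?t" "V \<in> carrier_mat ?t ?r" by (auto simp: U_def V_def)
    have "U * V = 1\<^sub>m ?r"
    proof (rule eq_matI)
      fix i j assume "i < dim_row (1\<^sub>m ?r :: 'a mat)" "j < dim_col (1\<^sub>m ?r :: 'a mat)"
      then have ij: "i < ?r" "j < ?r" by auto
      then show "(U * V) $$ (i, j) = 1\<^sub>m ?r $$ (i, j)"
        unfolding index_mult_mat_sum[OF UV ij] using one[OF ij] by (simp add: U_def V_def)
    qed (use UV in auto)
    then show ?thesis using det_mult_nonzero_imp_le[OF UV] by simp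
  next
    case False
    then have "count (mset Ps) P = 0" by (simp add: count_eq_zero_iff)
    then show ?thesis by linarith
  qed
  show ?thesis
  proof (intro multiset_eqI antisym)
    fix P
    show "count (mset Ps) P \<le> count (mset Qs) P" by (rule le[OF loc eq iso])
    show "count (mset Qs) P \<le> count (mset Ps) P"
      by (rule le[OF _ _ pencil_iso_sym[OF iso]]) (use loc eq in \<open>simp_all add: Un_commute\<close>)
  qed
qed

section \<open>Kronecker blocks over the complex numbers\<close>

lemma jordan_block_mult_index:
  fixes X :: "'a :: comm_ring_1 mat"
  assumes X: "X \<in> carrier_mat k k" and ij: "i < k" "j < k"
  shows "(X * jordan_block k z) $$ (i, j) = z * X $$ (i, j) + (if j = 0 then 0 else X $$ (i, j - 1))"
    "(jordan_block k z * X) $$ (i, j) = z * X $$ (i, j) + (if Suc i < k then X $$ (Suc i, j) else 0)"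
proof -
  have "(X * jordan_block k z) $$ (i, j)
      = (\<Sum>l<k. (if l = j then z * X $$ (i, j) else 0) + (if l = j - 1 then if j = 0 then 0 else X $$ (i, j - 1) else 0))"
    unfolding index_mult_mat_sum[OF X jordan_block_carrier ij] using ij
    by (intro sum.cong) auto
  also have "\<dots> = z * X $$ (i, j) + (if j = 0 then 0 else X $$ (i, j - 1))"
    using ij by (simp add: sum.distrib)
  finally show "(X * jordan_block k z) $$ (i, j) = z * X $$ (i, j) + (if j = 0 then 0 else X $$ (i, j - 1))" .
  have "(jordan_block k z * X) $$ (i, j)
      = (\<Sum>l<k. (if l = i then z * X $$ (i, j) else 0) + (if l = Suc i then X $$ (Suc i, j) else 0))"
    unfolding index_mult_mat_sum[OF jordan_block_carrier X ij] using ij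
    by (intro sum.cong) auto
  also have "\<dots> = z * X $$ (i, j) + (if Suc i < k then X $$ (Suc i, j) else 0)"
    using ij by (simp add: sum.distrib)
  finally show "(jordan_block k z * X) $$ (i, j) = z * X $$ (i, j) + (if Suc i < k then X $$ (Suc i, j) else 0)" .
qed

lemma scalar_diagI: "(\<And>i. i < dim_row A \<Longrightarrow> A $$ (i, i) = c) \<Longrightarrow> scalar_diag c A"
  by (simp add: scalar_diag_def)

lemma scalar_diagD: "scalar_diag c A \<Longrightarrow> i < dim_row A \<Longrightarrow> A $$ (i, i) = c"
  by (simp add: scalar_diag_def)

text \<open>An entry below the main diagonal can be moved up its diagonal to the first column, where
  it is 0; a diagonal entry can be moved to (0, 0).\<close>

lemma Toeplitz_imp_upper_triangular:
  assumes "Y \<in> carrier_mat k k" "\<And>i. 0 < i \<Longrightarrow> i < k \<Longrightarrow> Y $$ (i, 0) = 0"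
    and shift: "\<And>i j. Suc i < k \<Longrightarrow> Suc j < k \<Longrightarrow> Y $$ (Suc i, Suc j) = Y $$ (i, j)"
  shows "upper_triangular Y" "scalar_diag (Y $$ (0, 0)) Y"
proof -
  have "Y $$ (i, j) = 0" if "j < i" "i < k" for i j
    using that
  proof (induction j arbitrary: i)
    case 0
    then show ?case using assms(2) by simp
  next
    case (Suc j)
    then obtain i' where "i = Suc i'" by (cases i) auto
    then show ?case using Suc shift[of i' j] by simp
  qed
  then show "upper_triangular Y" using assms(1) by auto
  have diag: "Y $$ (i, i) = Y $$ (0, 0)" if "i < k" for i
    using that
  proof (induction i)
    case (Suc i)
    then show ?case using shift[of i i] by simp
  qed simp
  show "scalar_diag (Y $$ (0, 0)) Y" by (rule scalar_diagI, rule diag) (use assms(1) in simp)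
qed

text \<open>The terms with \<open>z\<close> cancel, and the shifts that remain give X(i, j - 1) =
  X(i + 1, j), with zeros supplied at the borders.\<close>

lemma commute_jordan_block:
  fixes X :: "'a :: comm_ring_1 mat"
  assumes X: "X \<in> carrier_mat k k" and comm: "X * jordan_block k z = jordan_block k z * X"
  shows "upper_triangular X" "scalar_diag (X $$ (0, 0)) X"
proof -
  have eq: "(if j = 0 then 0 else X $$ (i, j - 1)) = (if Suc i < k then X $$ (Suc i, j) else 0)"
    if "i < k" "j < k" for i j
    using arg_cong[OF comm, of "\<lambda>M. M $$ (i, j)"] unfolding jordan_block_mult_index[OF X that] by simp
  have "X $$ (i, 0) = 0" if "0 < i" "i < k" for i using eq[of "i - 1" 0] that by simp
  moreover have "X $$ (Suc i, Suc j) = X $$ (i, j)" if "Suc i < k" "Suc j < k" for i j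
    using eq[of i "Suc j"] that by simp
  ultimately show "upper_triangular X" "scalar_diag (X $$ (0, 0)) X"
    using Toeplitz_imp_upper_triangular[OF X] by auto
qed

text \<open>\<open>left_shift\<close> and \<open>right_shift\<close> are F_k and G_k over arbitrary
  coefficients, for use over the complex numbers too.\<close>

definition left_shift :: "nat \<Rightarrow> 'a :: {zero, one} mat" where
  "left_shift k = mat k (k + 1) (\<lambda>(i, j). if j = i then 1 else 0)"

definition right_shift :: "nat \<Rightarrow> 'a :: {zero, one} mat" where
  "right_shift k = mat k (k + 1) (\<lambda>(i, j). if j = Suc i then 1 else 0)"

lemma shift_carrier [simp]:
  "left_shift k \<in> carrier_mat k (Suc k)" "right_shift k \<in> carrier_mat k (Suc k)"
  by (auto simp: left_shift_def right_shift_def)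

lemma shift_dim [simp]:
  "dim_row (left_shift k) = k" "dim_col (left_shift k) = Suc k"
  "dim_row (right_shift k) = k" "dim_col (right_shift k) = Suc k"
  by (auto simp: left_shift_def right_shift_def)

lemma shift_index:
  "i < k \<Longrightarrow> j \<le> k \<Longrightarrow> left_shift k $$ (i, j) = (if j = i then 1 else 0)"
  "i < k \<Longrightarrow> j \<le> k \<Longrightarrow> right_shift k $$ (i, j) = (if j = Suc i then 1 else 0)"
  by (auto simp: left_shift_def right_shift_def)

lemma F_mat_eq: "F_mat k = left_shift k" and G_mat_eq: "G_mat k = right_shift k"
  by (simp_all add: F_mat_def G_mat_def left_shift_def right_shift_def)

lemma shift_mult_index:
  fixes X Y :: "'a :: comm_ring_1 mat"
  assumes X: "X \<in> carrier_mat k k" and Y: "Y \<in> carrier_mat (Suc k) (Suc k)" and ij: "i < k" "j \<le> k"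
  shows "(X * left_shift k) $$ (i, j) = (if j < k then X $$ (i, j) else 0)"
    "(X * right_shift k) $$ (i, j) = (if j = 0 then 0 else X $$ (i, j - 1))"
    "(left_shift k * Y) $$ (i, j) = Y $$ (i, j)"
    "(right_shift k * Y) $$ (i, j) = Y $$ (Suc i, j)"
proof -
  have j: "j < Suc k" using ij by simp
  have "(X * left_shift k) $$ (i, j) = (\<Sum>l<k. if l = j then X $$ (i, j) else 0)"
    unfolding index_mult_mat_sum[OF X shift_carrier(1) ij(1) j] using ij
    by (intro sum.cong) (auto simp: shift_index)
  then show "(X * left_shift k) $$ (i, j) = (if j < k then X $$ (i, j) else 0)" by simp
  have "(X * right_shift k) $$ (i, j) = (\<Sum>l<k. if l = j - 1 then if j = 0 then 0 else X $$ (i, j - 1) else 0)"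
    unfolding index_mult_mat_sum[OF X shift_carrier(2) ij(1) j] using ij
    by (intro sum.cong) (auto simp: shift_index)
  then show "(X * right_shift k) $$ (i, j) = (if j = 0 then 0 else X $$ (i, j - 1))" using ij by simp
  have "(left_shift k * Y) $$ (i, j) = (\<Sum>l<Suc k. if l = i then Y $$ (i, j) else 0)"
    unfolding index_mult_mat_sum[OF shift_carrier(1) Y ij(1) j] using ij
    by (intro sum.cong) (auto simp: shift_index)
  then show "(left_shift k * Y) $$ (i, j) = Y $$ (i, j)" using ij by simp
  have "(right_shift k * Y) $$ (i, j) = (\<Sum>l<Suc k. if l = Suc i then Y $$ (Suc i, j) else 0)"
    unfolding index_mult_mat_sum[OF shift_carrier(2) Y ij(1) j] using ij
    by (intro sum.cong) (auto simp: shift_index)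
  then show "(right_shift k * Y) $$ (i, j) = Y $$ (Suc i, j)" using ij by simp
qed

text \<open>Over an algebraically closed field these are, up to isomorphism, all indecomposable
  pencils; the realified blocks are absent.\<close>

definition kronecker_blocks :: "('a :: comm_ring_1 mat \<times> 'a mat) set" where
  "kronecker_blocks =
     {(1\<^sub>m k, jordan_block k z) | k z. k \<ge> 1} \<union>
     {(jordan_block k 0, 1\<^sub>m k) | k. k \<ge> 1} \<union>
     {(left_shift k, right_shift k) | k. True} \<union>
     {((left_shift k)\<^sup>T, (right_shift k)\<^sup>T) | k. True}"

text \<open>The first equation makes \<open>X\<close> the upper left corner of \<open>Y\<close> and
  clears the last column of \<open>Y\<close> above its bottom entry. The second makes
  \<open>X\<close> the lower right corner and clears the first column below its top entry. Equality
  of the two corners is the Toeplitz property.\<close>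

lemma shift_endo:
  fixes X Y :: "'a :: comm_ring_1 mat"
  assumes X: "X \<in> carrier_mat k k" and Y: "Y \<in> carrier_mat (Suc k) (Suc k)"
    and L: "X * left_shift k = left_shift k * Y" and R: "X * right_shift k = right_shift k * Y"
  shows "\<And>i j. i < k \<Longrightarrow> j < k \<Longrightarrow> X $$ (i, j) = Y $$ (i, j)" "\<And>i. i < k \<Longrightarrow> Y $$ (i, k) = 0"
    "\<And>i j. i < k \<Longrightarrow> j < k \<Longrightarrow> Y $$ (Suc i, Suc j) = Y $$ (i, j)" "\<And>i. i < k \<Longrightarrow> Y $$ (Suc i, 0) = 0"
proof -
  have L: "(if j < k then X $$ (i, j) else 0) = Y $$ (i, j)" if "i < k" "j \<le> k" for i j
    using arg_cong[OF L, of "\<lambda>M. M $$ (i, j)"] unfolding shift_mult_index[OF X Y that] .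
  have R: "(if j = 0 then 0 else X $$ (i, j - 1)) = Y $$ (Suc i, j)" if "i < k" "j \<le> k" for i j
    using arg_cong[OF R, of "\<lambda>M. M $$ (i, j)"] unfolding shift_mult_index[OF X Y that] .
  show XY: "X $$ (i, j) = Y $$ (i, j)" if "i < k" "j < k" for i j using L[of i j] that by simp
  show "Y $$ (i, k) = 0" if "i < k" for i using L[of i k] that by simp
  show "Y $$ (Suc i, 0) = 0" if "i < k" for i using R[of i 0] that by simp
  show "Y $$ (Suc i, Suc j) = Y $$ (i, j)" if "i < k" "j < k" for i j
    using R[of i "Suc j"] XY that by simp
qed

lemma local_pencil_kronecker_blocks:
  fixes P :: "'a :: comm_ring_1 mat \<times> 'a mat"
  assumes "P \<in> kronecker_blocks"
  shows "local_pencil P"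
proof -
  consider k z where "k \<ge> 1" "P = (1\<^sub>m k, jordan_block k z)" | k where "k \<ge> 1" "P = (jordan_block k 0, 1\<^sub>m k)"
    | k where "P = (left_shift k, right_shift k)" | k where "P = ((left_shift k)\<^sup>T, (right_shift k)\<^sup>T)"
    using assms unfolding kronecker_blocks_def by blast
  then show ?thesis
  proof cases
    case 1
    show ?thesis unfolding local_pencil_def
    proof (intro conjI allI impI)
      fix X Y assume h: "pencil_hom P P X Y"
      then have X: "X \<in> carrier_mat k k" and XY: "X = Y" and "X * jordan_block k z = jordan_block k z * Y"
        using 1 by (auto simp: pencil_hom_def)
      then show "upper_triangular X" "upper_triangular Y" "\<exists>c. scalar_diag c X \<and> scalar_diag c Y"
        using commute_jordan_block[OF X, of z] by auto
    qed (use 1 in \<open>auto simp: is_pencil_def\<close>)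
  next
    case 2
    show ?thesis unfolding local_pencil_def
    proof (intro conjI allI impI)
      fix X Y assume h: "pencil_hom P P X Y"
      then have X: "X \<in> carrier_mat k k" and XY: "X = Y" and "X * jordan_block k 0 = jordan_block k 0 * Y"
        using 2 by (auto simp: pencil_hom_def)
      then show "upper_triangular X" "upper_triangular Y" "\<exists>c. scalar_diag c X \<and> scalar_diag c Y"
        using commute_jordan_block[OF X, of 0] by auto
    qed (use 2 in \<open>auto simp: is_pencil_def\<close>)
  next
    case 3
    show ?thesis unfolding local_pencil_def
    proof (intro conjI allI impI)
      fix X Y assume h: "pencil_hom P P X Y"
      then have X: "X \<in> carrier_mat k k" and Y: "Y \<in> carrier_mat (Suc k) (Suc k)"
        and "X * left_shift k = left_shift k * Y" "X * right_shift k = right_shift k * Y"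
        using 3 by (auto simp: pencil_hom_def)
      note e = shift_endo[OF this]
      have eY: "Y $$ (Suc i, Suc j) = Y $$ (i, j)" if "Suc i < Suc k" "Suc j < Suc k" for i j
        using e(3)[of i j] that by simp
      have "Y $$ (i, 0) = 0" if "0 < i" "i < Suc k" for i using e(4)[of "i - 1"] that by simp
      note T = Toeplitz_imp_upper_triangular[OF Y this eY]
      show u: "upper_triangular Y" using T(1) .
      have "scalar_diag (Y $$ (0, 0)) X"
      proof (rule scalar_diagI)
        fix i assume "i < dim_row X"
        then show "X $$ (i, i) = Y $$ (0, 0)" using scalar_diagD[OF T(2), of i] e(1)[of i i] X Y by simp
      qed
      then show "\<exists>c. scalar_diag c X \<and> scalar_diag c Y" using T(2) by blast
      show "upper_triangular X"
      proof (rule upper_triangularI)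
        fix i j assume "j < i" "i < dim_row X"
        then show "X $$ (i, j) = 0" using upper_triangularD[OF u, of j i] e(1)[of i j] X Y by simp
      qed
    qed (use 3 in \<open>auto simp: is_pencil_def\<close>)
  next
    case 4
    show ?thesis unfolding local_pencil_def
    proof (intro conjI allI impI)
      fix X Y assume h: "pencil_hom P P X Y"
      then have X: "X \<in> carrier_mat (Suc k) (Suc k)" and Y: "Y \<in> carrier_mat k k"
        and eq: "X * (left_shift k)\<^sup>T = (left_shift k)\<^sup>T * Y" "X * (right_shift k)\<^sup>T = (right_shift k)\<^sup>T * Y"
        using 4 by (auto simp: pencil_hom_def)
      \<comment> \<open>Transposition reduces to \<open>shift_endo\<close> with the roles of
        \<open>X\<close> and \<open>Y\<close> exchanged.\<close>
      have T: "X\<^sup>T \<in> carrier_mat (Suc k) (Suc k)" "Y\<^sup>T \<in> carrier_mat k k" using X Y by auto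
      have "Y\<^sup>T * left_shift k = left_shift k * X\<^sup>T" "Y\<^sup>T * right_shift k = right_shift k * X\<^sup>T"
        using arg_cong[OF eq(1), of transpose_mat] arg_cong[OF eq(2), of transpose_mat] X Y
        by (simp_all add: transpose_mult[of _ "Suc k" "Suc k" _ k] transpose_mult[of _ "Suc k" k _ k])
      note e = shift_endo[OF T(2,1) this]
      \<comment> \<open>Below the diagonal the known zeros of \<open>X\<close> are those in its last
        row, so they are propagated upwards: \<open>m\<close> is the distance from the last row,
        \<open>d\<close> the distance from the main diagonal.\<close>
      have low: "X $$ (k - m, k - m - d) = 0" if "0 < d" "m + d \<le> k" for m d
        using that
      proof (induction m)
        case 0
        then show ?case using e(2)[of "k - d"] X by simp
      next
        case (Suc m)
        have "k - m = Suc (k - Suc m)" "k - m - d = Suc (k - Suc m - d)" using Suc.prems by auto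
        then show ?case using e(3)[of "k - Suc m - d" "k - Suc m"] X Suc by simp
      qed
      have low: "X $$ (i, j) = 0" if "j < i" "i < Suc k" for i j
        using low[of "i - j" "k - i"] that by simp
      then show "upper_triangular X" using X by auto
      have eq: "Y $$ (i, j) = X $$ (i, j)" if "i < k" "j < k" for i j
        using e(1)[of j i] that X Y by simp
      show "upper_triangular Y"
      proof (rule upper_triangularI)
        fix i j assume "j < i" "i < dim_row Y"
        then show "Y $$ (i, j) = 0" using low[of j i] eq[of i j] Y by simp
      qed
      have diag: "X $$ (i, i) = X $$ (0, 0)" if "i < Suc k" for i
        using that
      proof (induction i)
        case (Suc i)
        then show ?case using e(3)[of i i] X by simp
      qed simp
      have "scalar_diag (X $$ (0, 0)) X" by (rule scalar_diagI, rule diag) (use X in simp)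
      moreover have "scalar_diag (X $$ (0, 0)) Y"
      proof (rule scalar_diagI)
        fix i assume "i < dim_row Y"
        then show "Y $$ (i, i) = X $$ (0, 0)" using diag[of i] eq[of i i] Y by simp
      qed
      ultimately show "\<exists>c. scalar_diag c X \<and> scalar_diag c Y" by blast
    qed (use 4 in \<open>auto simp: is_pencil_def\<close>)
  qed
qed

section \<open>Invariants that separate the blocks\<close>

lemma det_jordan_block: "det (jordan_block k z) = (z :: 'a :: field) ^ k"
  by (subst det_upper_triangular[of _ k]) (auto simp: prod_list_diag_prod)

lemma pencil_iso_det:
  fixes A B C D :: "'a :: field mat"
  assumes iso: "pencil_iso (A, B) (C, D)" and A: "A \<in> carrier_mat n n"
  shows "det A = 0 \<longleftrightarrow> det C = 0" "det B = 0 \<longleftrightarrow> det D = 0"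
proof -
  obtain X Y where *: "is_pencil (A, B)" "is_pencil (C, D)" "pencil_hom (A, B) (C, D) X Y"
    "invertible_mat X" "invertible_mat Y"
    using iso unfolding pencil_iso_def by blast
  then have c: "B \<in> carrier_mat n n" "C \<in> carrier_mat n n" "D \<in> carrier_mat n n" "X \<in> carrier_mat n n" "Y \<in> carrier_mat n n"
    using A by (auto simp: is_pencil_def pencil_hom_def invertible_mat_def)
  have "det X \<noteq> 0" "det Y \<noteq> 0" using * c invertible_mat_iff_det by auto
  moreover have "det X * det A = det C * det Y" "det X * det B = det D * det Y"
    using * c A by (auto simp: pencil_hom_def det_mult[symmetric])
  ultimately show "det A = 0 \<longleftrightarrow> det C = 0" "det B = 0 \<longleftrightarrow> det D = 0" by auto
qed

lemma pencil_iso_dim: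
  "pencil_iso P Q \<Longrightarrow> dim_row (fst P) = dim_row (fst Q) \<and> dim_col (fst P) = dim_col (fst Q)"
  by (auto elim: pencil_isoE)

text \<open>The shape separates F_k, its transpose and the square blocks. Vanishing of the
  determinant of the first component singles out (J_k(0), I_k). After translation by -z, the
  determinant (w - z)^k of J_k(w - z) separates the remaining eigenvalues.\<close>

lemma pencil_iso_kronecker_blocks:
  fixes P Q :: "'a :: field mat \<times> 'a mat"
  assumes P: "P \<in> kronecker_blocks" and Q: "Q \<in> kronecker_blocks" and iso: "pencil_iso P Q"
  shows "P = Q"
proof -
  have jordan: "z = w" if k: "k \<ge> 1" and iso: "pencil_iso (1\<^sub>m k, jordan_block k z) (1\<^sub>m k, jordan_block k w)"
    for k and z w :: 'a
  proof -
    have "(- z) \<cdot>\<^sub>m 1\<^sub>m k + 1 \<cdot>\<^sub>m jordan_block k x = jordan_block k (x - z)" for x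
      by (rule eq_matI) auto
    with pencil_iso_linear[OF iso, of 1 0 "- z" 1]
    have "pencil_iso (1 \<cdot>\<^sub>m 1\<^sub>m k + 0 \<cdot>\<^sub>m jordan_block k z, jordan_block k 0)
      (1 \<cdot>\<^sub>m 1\<^sub>m k + 0 \<cdot>\<^sub>m jordan_block k w, jordan_block k (w - z))" by simp
    from pencil_iso_det(2)[OF this, of k] k show ?thesis by (simp add: det_jordan_block)
  qed
  have not: "\<not> pencil_iso (1\<^sub>m k, jordan_block k z) (jordan_block k 0, 1\<^sub>m k)" if "k \<ge> 1" for k and z :: 'a
    using pencil_iso_det(1)[of "1\<^sub>m k" _ "jordan_block k 0" _ k] that by (auto simp: det_jordan_block)
  note dim = pencil_iso_dim[OF iso]
  consider k z where "k \<ge> 1" "P = (1\<^sub>m k, jordan_block k z)" | k where "k \<ge> 1" "P = (jordan_block k 0, 1\<^sub>m k)"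
    | k where "P = (left_shift k, right_shift k)" | k where "P = ((left_shift k)\<^sup>T, (right_shift k)\<^sup>T)"
    using P unfolding kronecker_blocks_def by blast
  then show ?thesis
  proof cases
    case (1 k z)
    with Q dim have "(\<exists>w. Q = (1\<^sub>m k, jordan_block k w)) \<or> Q = (jordan_block k 0, 1\<^sub>m k)"
      by (auto simp: kronecker_blocks_def)
    then show ?thesis
    proof (elim disjE exE)
      fix w assume "Q = (1\<^sub>m k, jordan_block k w)"
      with 1 jordan[of k z w] iso show ?thesis by simp
    next
      assume "Q = (jordan_block k 0, 1\<^sub>m k)"
      with 1 not[of k z] iso show ?thesis by simp
    qed
  next
    case (2 k)
    with Q dim have "(\<exists>w. Q = (1\<^sub>m k, jordan_block k w)) \<or> Q = (jordan_block k 0, 1\<^sub>m k)"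
      by (auto simp: kronecker_blocks_def)
    then show ?thesis
    proof (elim disjE exE)
      fix w assume "Q = (1\<^sub>m k, jordan_block k w)"
      with 2 not[of k w] pencil_iso_sym[OF iso] show ?thesis by simp
    qed (use 2 in simp)
  next
    case (3 k)
    with Q dim show ?thesis by (auto simp: kronecker_blocks_def)
  next
    case (4 k)
    with Q dim show ?thesis by (auto simp: kronecker_blocks_def)
  qed
qed

theorem kronecker_form_unique:
  fixes Ps Qs :: "('a :: field_char_0 mat \<times> 'a mat) list"
  assumes "set Ps \<subseteq> kronecker_blocks" "set Qs \<subseteq> kronecker_blocks" "pencil_iso (psum Ps) (psum Qs)"
  shows "mset Ps = mset Qs"
proof (rule local_decomposition_unique[OF _ _ assms(3)])
  have sub: "set Ps \<union> set Qs \<subseteq> kronecker_blocks" using assms by simp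
  fix P assume P: "P \<in> set Ps \<union> set Qs"
  then show "local_pencil P" using local_pencil_kronecker_blocks subsetD[OF sub] by blast
  fix Q assume Q: "Q \<in> set Ps \<union> set Qs" "pencil_iso P Q"
  show "P = Q" by (rule pencil_iso_kronecker_blocks[OF subsetD[OF sub P] subsetD[OF sub Q(1)] Q(2)])
qed

section \<open>Realification of complex matrices\<close>

text \<open>The entry (p, q) of C(Re z, Im z) for p, q < 2, with the sign convention of C(a, b): Im
  z stands above the diagonal.\<close>

definition re_im_entry :: "complex \<Rightarrow> nat \<Rightarrow> nat \<Rightarrow> real" where
  "re_im_entry z p q = (if p = q then Re z else if p = 0 then Im z else - Im z)"

definition realify :: "complex mat \<Rightarrow> real mat" where
  "realify A = mat (2 * dim_row A) (2 * dim_col A)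
     (\<lambda>(i, j). re_im_entry (A $$ (i div 2, j div 2)) (i mod 2) (j mod 2))"

lemma realify_dim [simp]:
  "dim_row (realify A) = 2 * dim_row A" "dim_col (realify A) = 2 * dim_col A"
  by (auto simp: realify_def)

lemma realify_carrier: "A \<in> carrier_mat m n \<Longrightarrow> realify A \<in> carrier_mat (2 * m) (2 * n)"
  by (auto intro!: carrier_matI)

lemma realify_index:
  "i < 2 * dim_row A \<Longrightarrow> j < 2 * dim_col A \<Longrightarrow>
     realify A $$ (i, j) = re_im_entry (A $$ (i div 2, j div 2)) (i mod 2) (j mod 2)"
  by (simp add: realify_def)

lemma sum_lessThan_double:
  fixes f :: "nat \<Rightarrow> 'a :: comm_monoid_add"
  shows "(\<Sum>l<2 * n. f l) = (\<Sum>p<n. f (2 * p) + f (2 * p + 1))"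
  by (induction n) (simp_all add: ac_simps)

lemma re_im_entry_sum: "re_im_entry (\<Sum>x\<in>S. f x) p q = (\<Sum>x\<in>S. re_im_entry (f x) p q)"
  by (simp add: re_im_entry_def sum_negf)

lemma re_im_entry_mult:
  assumes "p < 2" "q < 2"
  shows "re_im_entry (z * w) p q = re_im_entry z p 0 * re_im_entry w 0 q + re_im_entry z p 1 * re_im_entry w 1 q"
  using assms by (auto simp: re_im_entry_def less_2_cases_iff)

text \<open>The map from z to C(Re z, Im z) is a ring homomorphism; grouping the summation index
  into pairs reduces the matrix product to it.\<close>

lemma realify_mult:
  assumes A: "A \<in> carrier_mat m n" and B: "B \<in> carrier_mat n k"
  shows "realify (A * B) = realify A * realify B"
proof (rule eq_matI)
  fix i j assume "i < dim_row (realify A * realify B)" "j < dim_col (realify A * realify B)"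
  then have ij: "i < 2 * m" "j < 2 * k" and ij2: "i div 2 < m" "j div 2 < k" using A B by auto
  have "(realify A * realify B) $$ (i, j) = (\<Sum>p<n. re_im_entry (A $$ (i div 2, p) * B $$ (p, j div 2)) (i mod 2) (j mod 2))"
    unfolding index_mult_mat_sum[OF realify_carrier[OF A] realify_carrier[OF B] ij] sum_lessThan_double
    using A B ij by (intro sum.cong HOL.refl) (simp add: realify_index re_im_entry_mult)
  also have "\<dots> = realify (A * B) $$ (i, j)"
    using A B ij ij2 by (simp del: index_mult_mat(1) add: realify_index re_im_entry_sum index_mult_mat_sum[OF A B ij2])
  finally show "realify (A * B) $$ (i, j) = (realify A * realify B) $$ (i, j)" ..
qed (use A B in auto)

lemma realify_one: "realify (1\<^sub>m n) = 1\<^sub>m (2 * n)"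
proof (rule eq_matI)
  fix i j assume "i < dim_row (1\<^sub>m (2 * n) :: real mat)" "j < dim_col (1\<^sub>m (2 * n) :: real mat)"
  then have ij: "i < 2 * n" "j < 2 * n" "i div 2 < n" "j div 2 < n" by auto
  show "realify (1\<^sub>m n) $$ (i, j) = 1\<^sub>m (2 * n) $$ (i, j)"
  proof (cases "i = j")
    case True
    then show ?thesis using ij by (simp add: realify_index re_im_entry_def)
  next
    case False
    then have "i div 2 \<noteq> j div 2 \<or> i mod 2 \<noteq> j mod 2" by (metis div_mult_mod_eq)
    then show ?thesis using ij False by (elim disjE) (simp_all add: realify_index re_im_entry_def)
  qed
qed auto

lemma realify_mdsum: "realify (mdsum A B) = mdsum (realify A) (realify B)"
proof (rule eq_matI)
  fix i j assume "i < dim_row (mdsum (realify A) (realify B))" "j < dim_col (mdsum (realify A) (realify B))"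
  then have ij: "i < 2 * dim_row A + 2 * dim_row B" "j < 2 * dim_col A + 2 * dim_col B" by auto
  have shift: "(x - 2 * y) div 2 = x div 2 - y" "(x - 2 * y) mod 2 = x mod 2" if "\<not> x < 2 * y" for x y :: nat
  proof -
    have "2 * y \<le> x" using that by simp
    then obtain z where "x = 2 * y + z" using le_Suc_ex by blast
    then show "(x - 2 * y) div 2 = x div 2 - y" "(x - 2 * y) mod 2 = x mod 2" by simp_all
  qed
  have half: "x div 2 < y \<longleftrightarrow> x < 2 * y" for x y :: nat by auto
  have "realify (mdsum A B) $$ (i, j) = re_im_entry (mdsum A B $$ (i div 2, j div 2)) (i mod 2) (j mod 2)"
    using ij by (intro realify_index) auto
  also have "mdsum A B $$ (i div 2, j div 2) = (if i < 2 * dim_row A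
      then if j < 2 * dim_col A then A $$ (i div 2, j div 2) else 0
      else if j < 2 * dim_col A then 0 else B $$ (i div 2 - dim_row A, j div 2 - dim_col A))"
    unfolding half[symmetric] using ij by (intro index_mdsum) auto
  also have "re_im_entry \<dots> (i mod 2) (j mod 2) = (if i < 2 * dim_row A
      then if j < 2 * dim_col A then realify A $$ (i, j) else 0
      else if j < 2 * dim_col A then 0 else realify B $$ (i - 2 * dim_row A, j - 2 * dim_col A))"
    using ij by (simp add: realify_index shift re_im_entry_def)
  also have "\<dots> = mdsum (realify A) (realify B) $$ (i, j)"
    using ij by (intro index_mdsum[symmetric]) auto
  finally show "realify (mdsum A B) $$ (i, j) = mdsum (realify A) (realify B) $$ (i, j)" .
qed auto

definition map_pencil :: "('a mat \<Rightarrow> 'b mat) \<Rightarrow> 'a mat \<times> 'a mat \<Rightarrow> 'b mat \<times> 'b mat" where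
  "map_pencil h P = (h (fst P), h (snd P))"

lemma map_pencil_simps [simp]:
  "fst (map_pencil h P) = h (fst P)" "snd (map_pencil h P) = h (snd P)" "map_pencil h (A, B) = (h A, h B)"
  by (simp_all add: map_pencil_def)

text \<open>Covers realification (d = 2) and complexification (d = 1): a multiplicative unital
  operation on matrices preserves morphisms and inverses.\<close>

lemma pencil_iso_map:
  fixes h :: "'a :: comm_ring_1 mat \<Rightarrow> 'b :: comm_ring_1 mat"
  assumes carrier: "\<And>A m n. A \<in> carrier_mat m n \<Longrightarrow> h A \<in> carrier_mat (d * m) (d * n)"
    and mult: "\<And>A B m n k. A \<in> carrier_mat m n \<Longrightarrow> B \<in> carrier_mat n k \<Longrightarrow> h (A * B) = h A * h B"
    and one: "\<And>n. h (1\<^sub>m n) = 1\<^sub>m (d * n)"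
    and iso: "pencil_iso P Q"
  shows "pencil_iso (map_pencil h P) (map_pencil h Q)"
proof -
  have inv: "invertible_mat (h X)" if inv: "invertible_mat X" for X
  proof -
    have X: "X \<in> carrier_mat (dim_row X) (dim_row X)" using inv by (auto simp: invertible_mat_def)
    then obtain Y where Y: "Y \<in> carrier_mat (dim_row X) (dim_row X)" "X * Y = 1\<^sub>m (dim_row X)" "Y * X = 1\<^sub>m (dim_row X)"
      using inv invertible_mat_iff[OF X] by blast
    then have "h X * h Y = 1\<^sub>m (d * dim_row X)" "h Y * h X = 1\<^sub>m (d * dim_row X)"
      using mult[OF X Y(1)] mult[OF Y(1) X] one by auto
    then show ?thesis using carrier[OF X] carrier[OF Y(1)] invertible_mat_iff[OF carrier[OF X]] by blast
  qed
  obtain X Y where *: "is_pencil P" "is_pencil Q" "pencil_hom P Q X Y" "invertible_mat X" "invertible_mat Y"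
    using iso unfolding pencil_iso_def by blast
  obtain m n where P: "fst P \<in> carrier_mat m n" "snd P \<in> carrier_mat m n"
    using *(1) by (auto simp: is_pencil_def)
  have Q: "fst Q \<in> carrier_mat m n" "snd Q \<in> carrier_mat m n" and XY: "X \<in> carrier_mat m m" "Y \<in> carrier_mat n n"
    and eq: "X * fst P = fst Q * Y" "X * snd P = snd Q * Y"
    using * P by (auto simp: is_pencil_def pencil_hom_def invertible_mat_def)
  have "h X * h (fst P) = h (fst Q) * h Y" "h X * h (snd P) = h (snd Q) * h Y"
    using eq mult[OF XY(1) P(1)] mult[OF XY(1) P(2)] mult[OF Q(1) XY(2)] mult[OF Q(2) XY(2)] by auto
  then show ?thesis
    using carrier[OF P(1)] carrier[OF P(2)] carrier[OF Q(1)] carrier[OF Q(2)] carrier[OF XY(1)] carrier[OF XY(2)] *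
    by (intro pencil_isoI[of _ _ "h X" "h Y"] inv) (auto simp: is_pencil_def pencil_hom_def)
qed

lemma pencil_iso_realify:
  "pencil_iso P Q \<Longrightarrow> pencil_iso (map_pencil realify P) (map_pencil realify Q)"
  by (rule pencil_iso_map[where d = 2]) (auto simp: realify_carrier realify_mult realify_one)

abbreviation cplx_mat :: "real mat \<Rightarrow> complex mat" where
  "cplx_mat \<equiv> map_mat complex_of_real"

lemma pencil_iso_cplx:
  "pencil_iso P Q \<Longrightarrow> pencil_iso (map_pencil cplx_mat P) (map_pencil cplx_mat Q)"
  by (rule pencil_iso_map[where d = 1]) (auto simp: of_real_hom.mat_hom_mult of_real_hom.mat_hom_one)

lemma map_pencil_realify_pdsum:
  "map_pencil realify (pdsum P Q) = pdsum (map_pencil realify P) (map_pencil realify Q)"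
  by (simp add: pdsum_def map_pencil_def realify_mdsum)

lemma cplx_mat_mdsum: "cplx_mat (mdsum A B) = mdsum (cplx_mat A) (cplx_mat B)"
  by (rule eq_matI) (auto simp: mdsum_def)

lemma map_pencil_cplx_pdsum:
  "map_pencil cplx_mat (pdsum P Q) = pdsum (map_pencil cplx_mat P) (map_pencil cplx_mat Q)"
  by (simp add: pdsum_def map_pencil_def cplx_mat_mdsum)

lemma map_pencil_cplx_psum: "map_pencil cplx_mat (psum Ps) = psum (map (map_pencil cplx_mat) Ps)"
proof (induction Ps)
  case Nil
  have "cplx_mat (0\<^sub>m 0 0) = 0\<^sub>m 0 0" by (rule eq_matI) auto
  then show ?case by simp
qed (simp add: map_pencil_cplx_pdsum)

text \<open>The columns are the eigenvectors \<open>e\<^bsub>2j\<^esub> \<plusminus> \<i> e\<^bsub>2j+1\<^esub>\<close> of the blocks \<open>C(a, b)\<close>.\<close>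

definition splitting_mat :: "nat \<Rightarrow> complex mat" where
  "splitting_mat n = mat (2 * n) (2 * n) (\<lambda>(i, j).
     if j < n then (if i div 2 = j then if even i then 1 else \<i> else 0)
     else (if i div 2 = j - n then if even i then 1 else - \<i> else 0))"

lemma splitting_mat_carrier: "splitting_mat n \<in> carrier_mat (2 * n) (2 * n)"
  by (simp add: splitting_mat_def)

lemma splitting_mat_index:
  "i < 2 * n \<Longrightarrow> j < 2 * n \<Longrightarrow> splitting_mat n $$ (i, j) =
     (if j < n then (if i div 2 = j then if even i then 1 else \<i> else 0)
     else (if i div 2 = j - n then if even i then 1 else - \<i> else 0))"
  by (simp add: splitting_mat_def)

lemma invertible_splitting_mat: "invertible_mat (splitting_mat n)"
proof -
  let ?S = "splitting_mat n"
  \<comment> \<open>The columns of the splitting matrix are orthogonal with squared norm 2, so half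
    the conjugate transpose inverts it.\<close>
  define S' where "S' = mat (2 * n) (2 * n) (\<lambda>(i, j). cnj (?S $$ (j, i)) / 2)"
  have S': "S' \<in> carrier_mat (2 * n) (2 * n)" by (simp add: S'_def)
  have "S' * ?S = 1\<^sub>m (2 * n)"
  proof (rule eq_matI)
    fix i j assume "i < dim_row (1\<^sub>m (2 * n) :: complex mat)" "j < dim_col (1\<^sub>m (2 * n) :: complex mat)"
    then have ij: "i < 2 * n" "j < 2 * n" by auto
    define i' j' where "i' = (if i < n then i else i - n)" and "j' = (if j < n then j else j - n)"
    have i': "i' < n" using ij by (auto simp: i'_def)
    have "(S' * ?S) $$ (i, j) = (\<Sum>p<n. S' $$ (i, 2 * p) * ?S $$ (2 * p, j) + S' $$ (i, 2 * p + 1) * ?S $$ (2 * p + 1, j))"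
      unfolding index_mult_mat_sum[OF S' splitting_mat_carrier ij] sum_lessThan_double ..
    also have "\<dots> = (\<Sum>p<n. if p = i' then if i = j then 1 else 0 else 0)"
      using ij by (intro sum.cong HOL.refl) (auto simp: S'_def splitting_mat_index i'_def)
    also have "\<dots> = 1\<^sub>m (2 * n) $$ (i, j)" using ij i' by simp
    finally show "(S' * ?S) $$ (i, j) = 1\<^sub>m (2 * n) $$ (i, j)" .
  qed (use S' splitting_mat_carrier in auto)
  then show ?thesis
    using mat_mult_left_right_inverse[OF S' splitting_mat_carrier] S' invertible_mat_iff[OF splitting_mat_carrier]
    by blast
qed

text \<open>C(a, b) has the eigenvector (1, \<i>) with eigenvalue a + ib and its conjugate with the
  conjugate eigenvalue. Applied blockwise, this separates \<open>Z\<close> from its conjugate; a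
  rectangular \<open>Z\<close> takes one splitting matrix on each side.\<close>

lemma cplx_realify_splitting:
  assumes Z: "Z \<in> carrier_mat m n"
  shows "cplx_mat (realify Z) * splitting_mat n = splitting_mat m * mdsum Z (map_mat cnj Z)"
proof (rule eq_matI)
  have c: "cplx_mat (realify Z) \<in> carrier_mat (2 * m) (2 * n)" "mdsum Z (map_mat cnj Z) \<in> carrier_mat (2 * m) (2 * n)"
    "map_mat cnj Z \<in> carrier_mat m n"
    using Z by (auto intro!: carrier_matI)
  fix i j assume "i < dim_row (splitting_mat m * mdsum Z (map_mat cnj Z))" "j < dim_col (splitting_mat m * mdsum Z (map_mat cnj Z))"
  then have ij: "i < 2 * m" "j < 2 * n" "i < m + m" "j < n + n" using c splitting_mat_carrier[of m] by auto
  \<comment> \<open>Both sides have the entry \<open>s * w\<close>: \<open>w\<close> is the entry of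
    \<open>Z\<close>, or of its conjugate, in column \<open>j'\<close>, and \<open>s\<close> is the
    coordinate of the eigenvector in row \<open>i\<close>.\<close>
  define j' where "j' = (if j < n then j else j - n)"
  define w where "w = (if j < n then Z $$ (i div 2, j') else cnj (Z $$ (i div 2, j')))"
  define s where "s = (if even i then 1 else if j < n then \<i> else - \<i>)"
  have j': "j' < n" and i': "i div 2 < m" using ij by (auto simp: j'_def)
  have parity: "i mod 2 = (if even i then 0 else 1)" by (simp add: mod2_eq_if)
  have "(cplx_mat (realify Z) * splitting_mat n) $$ (i, j)
      = (\<Sum>p<n. if p = j' then s * w else 0)"
    unfolding index_mult_mat_sum[OF c(1) splitting_mat_carrier ij(1,2)] sum_lessThan_double
    using ij Z i' by (intro sum.cong HOL.refl)
      (auto simp: splitting_mat_index realify_index re_im_entry_def j'_def w_def s_def parity complex_eq_iff)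
  also have "\<dots> = s * w" using j' by simp
  also have "\<dots> = (\<Sum>l<2 * m. if l = (if j < n then i div 2 else m + i div 2) then s * w else 0)"
    using i' by simp
  also have "\<dots> = (splitting_mat m * mdsum Z (map_mat cnj Z)) $$ (i, j)"
    unfolding index_mult_mat_sum[OF splitting_mat_carrier c(2) ij(1,2)]
    using ij Z i' by (intro sum.cong HOL.refl)
      (auto simp: splitting_mat_index index_mdsum[OF Z c(3)] j'_def w_def s_def)
  finally show "(cplx_mat (realify Z) * splitting_mat n) $$ (i, j) = (splitting_mat m * mdsum Z (map_mat cnj Z)) $$ (i, j)" .
qed (use Z splitting_mat_carrier[of n] splitting_mat_carrier[of m] in auto)

lemma pencil_iso_cplx_realify:
  assumes P: "is_pencil P"
  shows "pencil_iso (pdsum P (map_pencil (map_mat cnj) P)) (map_pencil cplx_mat (map_pencil realify P))"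
proof -
  obtain m n where *: "fst P \<in> carrier_mat m n" "snd P \<in> carrier_mat m n"
    using P by (auto simp: is_pencil_def)
  have "is_pencil (pdsum P (map_pencil (map_mat cnj) P))"
    using P by (intro is_pencil_pdsum) (auto simp: is_pencil_def)
  moreover have "is_pencil (map_pencil cplx_mat (map_pencil realify P))"
    using * by (auto simp: is_pencil_def)
  moreover have "pencil_hom (pdsum P (map_pencil (map_mat cnj) P)) (map_pencil cplx_mat (map_pencil realify P))
     (splitting_mat m) (splitting_mat n)"
    unfolding pencil_hom_def
    using * cplx_realify_splitting[OF *(1)] cplx_realify_splitting[OF *(2)] splitting_mat_carrier[of m] splitting_mat_carrier[of n]
    by (auto simp: pdsum_def mult_2)
  ultimately show ?thesis
    by (rule pencil_isoI[OF _ _ _ invertible_splitting_mat invertible_splitting_mat])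
qed

lemma C2_mat_index: "p < 2 \<Longrightarrow> q < 2 \<Longrightarrow> C2_mat a b $$ (p, q) = re_im_entry (Complex a b) p q"
  by (auto simp: C2_mat_def mat_of_rows_list_def re_im_entry_def less_2_cases_iff)

lemma C_mat_eq_realify: "C_mat k a b = realify (jordan_block k (Complex a b))"
proof (rule eq_matI)
  fix i j assume "i < dim_row (realify (jordan_block k (Complex a b)))" "j < dim_col (realify (jordan_block k (Complex a b)))"
  then have "i < 2 * k" "j < 2 * k" by auto
  then show "C_mat k a b $$ (i, j) = realify (jordan_block k (Complex a b)) $$ (i, j)"
    by (auto simp: C_mat_def block2_mat_def realify_index C2_mat_index re_im_entry_def)
qed (auto simp: C_mat_def block2_mat_def)

lemma C_mat_dim [simp]: "dim_row (C_mat k a b) = 2 * k" "dim_col (C_mat k a b) = 2 * k"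
  by (simp_all add: C_mat_eq_realify)

lemma C_mat_entries:
  assumes "k \<ge> 1"
  shows "C_mat k a b $$ (0, 0) = a" "C_mat k a b $$ (0, Suc 0) = b" "C_mat k a b $$ (Suc 0, 0) = - b"
  using assms unfolding C_mat_eq_realify by (simp_all add: realify_index re_im_entry_def)

section \<open>Uniqueness of the real Kronecker canonical form\<close>

text \<open>Over the complex numbers \<open>C\<^bsub>2k\<^esub>(a, b)\<close> splits into \<open>J\<^sub>k(a \<plusminus> \<i>b)\<close>; since \<open>b > 0\<close>,
  counting \<open>J\<^sub>k(a + \<i>b)\<close> counts the real block.\<close>

inductive block_encoding :: "real mat \<times> real mat \<Rightarrow> complex mat \<times> complex mat \<Rightarrow> bool" where
  "k \<ge> 1 \<Longrightarrow> block_encoding (1\<^sub>m k, jordan_block k \<mu>) (1\<^sub>m k, jordan_block k (of_real \<mu>))"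
| "k \<ge> 1 \<Longrightarrow> block_encoding (jordan_block k 0, 1\<^sub>m k) (jordan_block k 0, 1\<^sub>m k)"
| "k \<ge> 1 \<Longrightarrow> b > 0 \<Longrightarrow> block_encoding (1\<^sub>m (2 * k), C_mat k a b) (1\<^sub>m k, jordan_block k (Complex a b))"
| "block_encoding (left_shift k, right_shift k) (left_shift k, right_shift k)"
| "block_encoding ((left_shift k)\<^sup>T, (right_shift k)\<^sup>T) ((left_shift k)\<^sup>T, (right_shift k)\<^sup>T)"

section \<open>Distinguishing the families of blocks by size and entries\<close>

lemma jordan_block_eq_iff:
  "k \<ge> 1 \<Longrightarrow> jordan_block k z = jordan_block k' w \<longleftrightarrow> k = k' \<and> z = (w :: 'a :: zero_neq_one)"
  by (metis jordan_block_index(1,2) less_eq_Suc_le One_nat_def)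

lemma one_neq_jordan_block_0:
  assumes "k \<ge> 1" shows "(1\<^sub>m k' :: 'a :: zero_neq_one mat) \<noteq> jordan_block k 0"
proof
  assume *: "(1\<^sub>m k' :: 'a mat) = jordan_block k 0"
  from arg_cong[OF this, of dim_row] have "k' = k" by simp
  with arg_cong[OF *, of "\<lambda>M. M $$ (0, 0)"] assms show False by simp
qed

lemma jordan_block_neq_C_mat:
  assumes "k' \<ge> 1" "b > 0" shows "jordan_block k \<mu> \<noteq> C_mat k' a b"
proof
  assume *: "jordan_block k \<mu> = C_mat k' a b"
  from arg_cong[OF this, of dim_row] have "k = 2 * k'" by simp
  with arg_cong[OF *, of "\<lambda>M. M $$ (Suc 0, 0)"] assms show False by (simp add: C_mat_entries)
qed

lemma one_eq_iff: "(1\<^sub>m k :: 'a :: {zero,one} mat) = 1\<^sub>m k' \<longleftrightarrow> k = k'"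
  by (metis index_one_mat(2))

lemma C_mat_eq_iff: "k \<ge> 1 \<Longrightarrow> C_mat k a b = C_mat k' a' b' \<longleftrightarrow> k = k' \<and> a = a' \<and> b = b'"
  by (metis C_mat_dim(1) C_mat_entries(1,2) mult_cancel1 zero_neq_numeral)

lemma dim_neq: "dim_row A \<noteq> dim_row B \<or> dim_col A \<noteq> dim_col B \<Longrightarrow> A \<noteq> B" by auto

lemma shift_neq:
  assumes "dim_row A = dim_col A"
  shows "A \<noteq> left_shift l" "A \<noteq> (left_shift l)\<^sup>T" "left_shift l \<noteq> A" "(left_shift l)\<^sup>T \<noteq> A"
  using assms by auto

lemma shift_eq_iff:
  "left_shift k = left_shift l \<longleftrightarrow> k = l" "(left_shift k)\<^sup>T = (left_shift l)\<^sup>T \<longleftrightarrow> k = l"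
  "left_shift k \<noteq> (left_shift l)\<^sup>T" "(left_shift l)\<^sup>T \<noteq> left_shift k"
proof -
  show "left_shift k = left_shift l \<longleftrightarrow> k = l" by (metis shift_dim(1))
  then show "(left_shift k)\<^sup>T = (left_shift l)\<^sup>T \<longleftrightarrow> k = l" by (metis transpose_mat_eq)
  show "left_shift k \<noteq> (left_shift l)\<^sup>T" "(left_shift l)\<^sup>T \<noteq> left_shift k"
    by (intro dim_neq; simp; linarith)+
qed

lemmas block_neqs = jordan_block_eq_iff one_neq_jordan_block_0 one_neq_jordan_block_0[symmetric]
  jordan_block_neq_C_mat jordan_block_neq_C_mat[symmetric] one_eq_iff C_mat_eq_iff shift_eq_iff shift_neq

text \<open>Since b > 0 keeps a + ib off the real axis, the code of a block C_2k is never that of a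
  real Jordan block.\<close>

lemma block_encoding_inj: "block_encoding K L \<Longrightarrow> block_encoding K' L \<Longrightarrow> K = K'"
  by (elim block_encoding.cases) (auto simp: block_neqs complex_eq_iff)

lemma block_encoding_fun: "block_encoding K L \<Longrightarrow> block_encoding K L' \<Longrightarrow> L = L'"
  by (elim block_encoding.cases) (auto simp: block_neqs)

lemma block_encoding_range: "block_encoding K L \<Longrightarrow> L \<in> kronecker_blocks"
  by (elim block_encoding.cases) (auto simp: kronecker_blocks_def)

lemma block_encoding_total: "K \<in> real_kronecker_blocks \<Longrightarrow> \<exists>L. block_encoding K L"
  unfolding real_kronecker_blocks_def F_mat_eq G_mat_eq
  by (elim UnE CollectE exE conjE; simp only:; blast intro: block_encoding.intros)

text \<open>The complexification of a block contains its own code once and no other code. The only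
  further summand that can occur is J_k(a - ib), which is no code because its eigenvalue has
  negative imaginary part.\<close>

lemma block_encoding_list:
  assumes "K \<in> real_kronecker_blocks"
  shows "\<exists>Ls. set Ls \<subseteq> kronecker_blocks \<and> pencil_iso (map_pencil cplx_mat K) (psum Ls) \<and>
    (\<forall>K' L. block_encoding K' L \<longrightarrow> count (mset Ls) L = (if K = K' then 1 else 0))"
proof -
  obtain L where L: "block_encoding K L" using block_encoding_total[OF assms] by blast
  have count: "count (mset [L]) L' = (if K = K' then 1 else 0)" if "block_encoding K' L'" for K' L'
    using block_encoding_fun[OF L, of L'] block_encoding_inj[OF L, of K'] that by auto
  have direct: ?thesis if "map_pencil cplx_mat K = L"
  proof (intro exI[of _ "[L]"] conjI allI impI)
    show "set [L] \<subseteq> kronecker_blocks" using block_encoding_range[OF L] by simp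
    have "is_pencil L"
      using local_pencil_is_pencil[OF local_pencil_kronecker_blocks[OF block_encoding_range[OF L]]] .
    then show "pencil_iso (map_pencil cplx_mat K) (psum [L])" using that by (simp add: pencil_iso_refl)
  qed (rule count)
  from L show ?thesis
  proof cases
    case (1 k \<mu>)
    show ?thesis by (rule direct) (auto simp: 1 of_real_hom.mat_hom_one intro!: eq_matI)
  next
    case (2 k)
    show ?thesis by (rule direct) (auto simp: 2 of_real_hom.mat_hom_one intro!: eq_matI)
  next
    case (3 k b a)
    define L' where "L' = (1\<^sub>m k :: complex mat, jordan_block k (Complex a (- b)))"
    have conj: "map_pencil (map_mat cnj) L = L'"
      unfolding 3 L'_def map_pencil_simps by (auto intro!: eq_matI simp: complex_eq_iff)
    have "is_pencil L" by (auto simp: 3 is_pencil_def)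
    from pencil_iso_sym[OF pencil_iso_cplx_realify[OF this]]
    have "pencil_iso (map_pencil cplx_mat K) (psum [L, L'])"
      unfolding conj by (simp add: 3 realify_one C_mat_eq_realify)
    moreover have "L' \<in> kronecker_blocks" using 3 by (auto simp: L'_def kronecker_blocks_def)
    moreover have not_enc: "\<not> block_encoding K' L'" for K'
    proof
      assume "block_encoding K' L'"
      then show False by cases (use 3 in \<open>auto simp: L'_def block_neqs complex_eq_iff\<close>)
    qed
    moreover have "count (mset [L, L']) L'' = (if K = K' then 1 else 0)" if enc: "block_encoding K' L''" for K' L''
    proof -
      have "L' \<noteq> L''" using not_enc[of K'] enc by metis
      then show ?thesis using count[OF enc] by (auto split: if_splits)
    qed
    ultimately show ?thesis using block_encoding_range[OF L] by (intro exI[of _ "[L, L']"]) auto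
  next
    case (4 k)
    show ?thesis by (rule direct) (auto simp: 4 shift_index intro!: eq_matI)
  next
    case (5 k)
    show ?thesis by (rule direct) (auto simp: 5 shift_index intro!: eq_matI)
  qed
qed

lemma kronecker_encoding:
  assumes "set Ks \<subseteq> real_kronecker_blocks"
  shows "\<exists>Ls. set Ls \<subseteq> kronecker_blocks \<and> pencil_iso (map_pencil cplx_mat (psum Ks)) (psum Ls) \<and>
    (\<forall>K L. block_encoding K L \<longrightarrow> count (mset Ls) L = count (mset Ks) K)"
  using assms
proof (induction Ks)
  case Nil
  show ?case unfolding map_pencil_cplx_psum
    by (intro exI[of _ "[]"]) (auto intro!: pencil_iso_refl simp: is_pencil_def)
next
  case (Cons K Ks)
  obtain Ls where Ls: "set Ls \<subseteq> kronecker_blocks" "pencil_iso (map_pencil cplx_mat (psum Ks)) (psum Ls)"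
    "\<And>K L. block_encoding K L \<Longrightarrow> count (mset Ls) L = count (mset Ks) K"
    using Cons by auto
  obtain Ls' where Ls': "set Ls' \<subseteq> kronecker_blocks" "pencil_iso (map_pencil cplx_mat K) (psum Ls')"
    "\<And>K' L. block_encoding K' L \<Longrightarrow> count (mset Ls') L = (if K = K' then 1 else 0)"
    using block_encoding_list[of K] Cons.prems by auto
  have "pencil_iso (map_pencil cplx_mat (psum (K # Ks))) (psum (Ls' @ Ls))"
    unfolding psum.simps map_pencil_cplx_pdsum psum_append using Ls(2) Ls'(2) by (intro pencil_iso_pdsum)
  then show ?case using Ls Ls' by (intro exI[of _ "Ls' @ Ls"]) auto
qed

text \<open>Complex uniqueness compares the multiplicities of codes, and the multiplicity of a code
  is that of the real block it encodes.\<close>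

theorem real_kronecker_form_unique:
  assumes "set Ks \<subseteq> real_kronecker_blocks" "set Ks' \<subseteq> real_kronecker_blocks" "pencil_iso (psum Ks) (psum Ks')"
  shows "mset Ks = mset Ks'"
proof -
  obtain Ls where Ls: "set Ls \<subseteq> kronecker_blocks" "pencil_iso (map_pencil cplx_mat (psum Ks)) (psum Ls)"
    "\<And>K L. block_encoding K L \<Longrightarrow> count (mset Ls) L = count (mset Ks) K"
    using kronecker_encoding[OF assms(1)] by auto
  obtain Ls' where Ls': "set Ls' \<subseteq> kronecker_blocks" "pencil_iso (map_pencil cplx_mat (psum Ks')) (psum Ls')"
    "\<And>K L. block_encoding K L \<Longrightarrow> count (mset Ls') L = count (mset Ks') K"
    using kronecker_encoding[OF assms(2)] by auto
  have "mset Ls = mset Ls'"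
    using kronecker_form_unique[OF Ls(1) Ls'(1)] Ls(2) Ls'(2) pencil_iso_cplx[OF assms(3)]
      pencil_iso_sym pencil_iso_trans by blast
  show ?thesis
  proof (rule multiset_eqI)
    fix K
    show "count (mset Ks) K = count (mset Ks') K"
    proof (cases "K \<in> real_kronecker_blocks")
      case True
      then obtain L where "block_encoding K L" using block_encoding_total by blast
      then show ?thesis using Ls(3) Ls'(3) \<open>mset Ls = mset Ls'\<close> by metis
    next
      case False
      then have "K \<notin> set Ks" "K \<notin> set Ks'" using assms by auto
      then show ?thesis by (metis count_eq_zero_iff set_mset_mset)
    qed
  qed
qed

section \<open>Reduction of bidiagonal pencils\<close>

lemma bij_betw_lessThanI:
  fixes f :: "nat \<Rightarrow> nat"
  assumes "\<And>i. i < n \<Longrightarrow> f i < n" "\<And>i j. i < n \<Longrightarrow> j < n \<Longrightarrow> f i = f j \<Longrightarrow> i = j"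
  shows "bij_betw f {..<n} {..<n}"
proof -
  have inj: "inj_on f {..<n}" using assms(2) by (intro inj_onI) simp
  have "f ` {..<n} \<subseteq> {..<n}" using assms(1) by (intro image_subsetI) simp
  with inj show ?thesis by (simp add: bij_betw_def endo_inj_surj)
qed

text \<open>Rows and columns are permuted independently, as strict equivalence allows; congruence
  would tie the two permutations together.\<close>

definition reindex_mat :: "(nat \<Rightarrow> nat) \<Rightarrow> (nat \<Rightarrow> nat) \<Rightarrow> 'a mat \<Rightarrow> 'a mat" where
  "reindex_mat \<sigma> \<tau> A = mat (dim_row A) (dim_col A) (\<lambda>(i, j). A $$ (\<sigma> i, \<tau> j))"

lemma reindex_mat_dim [simp]:
  "dim_row (reindex_mat \<sigma> \<tau> A) = dim_row A" "dim_col (reindex_mat \<sigma> \<tau> A) = dim_col A"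
  by (simp_all add: reindex_mat_def)

lemma reindex_mat_index:
  "i < dim_row A \<Longrightarrow> j < dim_col A \<Longrightarrow> reindex_mat \<sigma> \<tau> A $$ (i, j) = A $$ (\<sigma> i, \<tau> j)"
  by (simp add: reindex_mat_def)

lemma pencil_iso_reindex:
  fixes A B :: "'a :: field mat"
  assumes A: "A \<in> carrier_mat m n" and B: "B \<in> carrier_mat m n"
    and \<sigma>: "bij_betw \<sigma> {..<m} {..<m}" and \<tau>: "bij_betw \<tau> {..<n} {..<n}"
  shows "pencil_iso (A, B) (reindex_mat \<sigma> \<tau> A, reindex_mat \<sigma> \<tau> B)"
proof -
  \<comment> \<open>\<open>pm k f\<close> has its 1 of row i in column f i. Thus
    \<open>pm m \<sigma> * M\<close> has row \<sigma> i of \<open>M\<close> as its row i, and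
    multiplying the reindexed matrix by \<open>pm n \<tau>\<close> restores its column
    order.\<close>
  define pm where "pm = (\<lambda>k f. mat k k (\<lambda>(i, j). if f i = j then 1 else 0) :: 'a mat)"
  have pm: "pm k f \<in> carrier_mat k k" for k f by (simp add: pm_def)
  have inv: "invertible_mat (pm k f)" if f: "bij_betw f {..<k} {..<k}" for k f
  proof -
    have T: "(pm k f)\<^sup>T \<in> carrier_mat k k" using pm[of k f] by simp
    have "pm k f * (pm k f)\<^sup>T = 1\<^sub>m k"
    proof (rule eq_matI)
      fix i j assume "i < dim_row (1\<^sub>m k :: 'a mat)" "j < dim_col (1\<^sub>m k :: 'a mat)"
      then have ij: "i < k" "j < k" by auto
      have "(pm k f * (pm k f)\<^sup>T) $$ (i, j) = (\<Sum>l<k. if l = f i then if f i = f j then 1 else 0 else 0)"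
        unfolding index_mult_mat_sum[OF pm T ij] using ij by (intro sum.cong) (auto simp: pm_def)
      moreover have "f i < k" "f i = f j \<longleftrightarrow> i = j"
        using f ij by (auto simp: bij_betw_def inj_on_def)
      ultimately show "(pm k f * (pm k f)\<^sup>T) $$ (i, j) = 1\<^sub>m k $$ (i, j)" using ij by simp
    qed (auto simp: pm_def)
    then show ?thesis
      using mat_mult_left_right_inverse[OF pm T] T invertible_mat_iff[OF pm] by blast
  qed
  have eq: "pm m \<sigma> * M = reindex_mat \<sigma> \<tau> M * pm n \<tau>" if M: "M \<in> carrier_mat m n" for M
  proof (rule eq_matI)
    have R: "reindex_mat \<sigma> \<tau> M \<in> carrier_mat m n" using M by (auto intro!: carrier_matI)
    fix i j assume "i < dim_row (reindex_mat \<sigma> \<tau> M * pm n \<tau>)" "j < dim_col (reindex_mat \<sigma> \<tau> M * pm n \<tau>)"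
    then have ij: "i < m" "j < n" using M pm[of n \<tau>] by auto
    have "\<sigma> i < m" using \<sigma> ij by (auto simp: bij_betw_def)
    have "(pm m \<sigma> * M) $$ (i, j) = (\<Sum>l<m. if l = \<sigma> i then M $$ (\<sigma> i, j) else 0)"
      unfolding index_mult_mat_sum[OF pm M ij] using ij by (intro sum.cong) (auto simp: pm_def)
    also have "\<dots> = (\<Sum>x<n. if x = j then M $$ (\<sigma> i, j) else 0)" using \<open>\<sigma> i < m\<close> ij by simp
    also have "\<dots> = (\<Sum>l<n. if \<tau> l = j then M $$ (\<sigma> i, j) else 0)"
      using sum.reindex_bij_betw[OF \<tau>, of "\<lambda>x. if x = j then M $$ (\<sigma> i, j) else 0"] by simp
    also have "\<dots> = (reindex_mat \<sigma> \<tau> M * pm n \<tau>) $$ (i, j)"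
      unfolding index_mult_mat_sum[OF R pm ij] using ij M by (intro sum.cong) (auto simp: pm_def reindex_mat_index)
    finally show "(pm m \<sigma> * M) $$ (i, j) = (reindex_mat \<sigma> \<tau> M * pm n \<tau>) $$ (i, j)" .
  qed (use M pm[of n \<tau>] pm[of m \<sigma>] in auto)
  show ?thesis
    using A B eq[OF A] eq[OF B] pm[of n \<tau>] pm[of m \<sigma>]
    by (intro pencil_isoI[OF _ _ _ inv[OF \<sigma>] inv[OF \<tau>]]) (auto simp: is_pencil_def pencil_hom_def)
qed

text \<open>\<open>krylov M k p\<close> is the vector \<open>M\<^sup>p e\<^bsub>k-1\<^esub>\<close>; in reverse order these vectors form a Jordan
  chain of a nilpotent \<open>M\<close>.\<close>

primrec krylov :: "'a :: comm_ring_1 mat \<Rightarrow> nat \<Rightarrow> nat \<Rightarrow> nat \<Rightarrow> 'a" where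
  "krylov M k 0 i = (if i = k - 1 then 1 else 0)"
| "krylov M k (Suc p) i = (\<Sum>l<k. M $$ (i, l) * krylov M k p l)"

text \<open>Each application of \<open>M\<close> moves the last nonzero coordinate up by one place
  and multiplies it by a superdiagonal entry. For p < k it therefore stands at k - 1 - p, and the
  k-th power kills the start vector. Sums in place of differences avoid truncated
  subtraction.\<close>

lemma krylov_strictly_upper:
  fixes M :: "'a :: field mat"
  assumes zero: "\<And>i j. i < k \<Longrightarrow> j \<le> i \<Longrightarrow> M $$ (i, j) = 0"
    and nz: "\<And>i. Suc i < k \<Longrightarrow> M $$ (i, Suc i) \<noteq> 0"
  shows "(\<forall>i<k. k \<le> i + p \<longrightarrow> krylov M k p i = 0) \<and> (\<forall>i. i + p + 1 = k \<longrightarrow> krylov M k p i \<noteq> 0)"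
proof (induction p)
  case 0
  show ?case by auto
next
  case (Suc p)
  have "krylov M k (Suc p) i = 0" if i: "i < k" "k \<le> i + Suc p" for i
  proof -
    have "M $$ (i, l) * krylov M k p l = 0" if "l < k" for l
      using zero[of i l] Suc i that by (cases "l \<le> i") auto
    then show ?thesis unfolding krylov.simps by (intro sum.neutral ballI) auto
  qed
  moreover have "krylov M k (Suc p) i \<noteq> 0" if i: "i + Suc p + 1 = k" for i
  proof -
    have "M $$ (i, l) * krylov M k p l = (if l = Suc i then M $$ (i, Suc i) * krylov M k p (Suc i) else 0)"
      if "l < k" for l
      using zero[of i l] Suc i that by (cases "l \<le> i") auto
    then have "krylov M k (Suc p) i = (\<Sum>l<k. if l = Suc i then M $$ (i, Suc i) * krylov M k p (Suc i) else 0)"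
      by simp
    also have "\<dots> = M $$ (i, Suc i) * krylov M k p (Suc i)" using i by simp
    finally show ?thesis using nz[of i] Suc i by simp
  qed
  ultimately show ?case by auto
qed

text \<open>The columns of \<open>S\<close> are the powers of \<open>M\<close> applied to the last
  unit vector, highest power first. The positions of their last nonzero coordinates make
  \<open>S\<close> triangular with nonzero diagonal.\<close>

lemma strictly_upper_jordan:
  fixes M :: "'a :: field mat"
  assumes M: "M \<in> carrier_mat k k"
    and zero: "\<And>i j. i < k \<Longrightarrow> j \<le> i \<Longrightarrow> M $$ (i, j) = 0"
    and nz: "\<And>i. Suc i < k \<Longrightarrow> M $$ (i, Suc i) \<noteq> 0"
  shows "pencil_iso (1\<^sub>m k, M) (1\<^sub>m k, jordan_block k 0)"
proof -
  define S where "S = mat k k (\<lambda>(i, j). krylov M k (k - 1 - j) i)"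
  have S: "S \<in> carrier_mat k k" by (simp add: S_def)
  note kr = krylov_strictly_upper[of k M, OF zero nz]
  have "upper_triangular S"
    using kr by (auto simp: S_def)
  moreover have "S $$ (i, i) \<noteq> 0" if "i < k" for i
    using kr[of "k - 1 - i"] that by (auto simp: S_def)
  then have "0 \<notin> set (diag_mat S)" using S by (auto simp: diag_mat_def)
  ultimately have inv: "invertible_mat S"
    unfolding invertible_mat_iff_det[OF S] det_upper_triangular[OF \<open>upper_triangular S\<close> S]
    by (simp add: prod_list_zero_iff)
  have "S * jordan_block k 0 = M * S"
  proof (rule eq_matI)
    fix i j assume "i < dim_row (M * S)" "j < dim_col (M * S)"
    then have ij: "i < k" "j < k" using M S by auto
    have "(M * S) $$ (i, j) = krylov M k (Suc (k - 1 - j)) i"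
      unfolding index_mult_mat_sum[OF M S ij] using ij by (simp add: S_def)
    also have "\<dots> = (S * jordan_block k 0) $$ (i, j)"
    proof (cases j)
      \<comment> \<open>In the first column the k-th power appears; it annihilates the start vector,
        matching the zero first column of the Jordan block.\<close>
      case 0
      then show ?thesis unfolding jordan_block_mult_index(1)[OF S ij] using kr[of k] ij by simp
    next
      case (Suc j')
      then have "Suc (k - 1 - j) = k - 1 - j'" using ij by simp
      then show ?thesis unfolding jordan_block_mult_index(1)[OF S ij] using Suc ij by (simp add: S_def)
    qed
    finally show "(S * jordan_block k 0) $$ (i, j) = (M * S) $$ (i, j)" ..
  qed (use M S in auto)
  then have "pencil_iso (1\<^sub>m k, jordan_block k 0) (1\<^sub>m k, M)"
    using M S inv by (intro pencil_isoI[of _ _ S S]) (auto simp: is_pencil_def pencil_hom_def)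
  then show ?thesis by (rule pencil_iso_sym)
qed

text \<open>Solving P M = D by back substitution from the last row shows that M is strictly upper
  triangular and satisfies P(i, i) M(i, i + 1) = D(i, i + 1), so its superdiagonal is
  nonzero.\<close>

lemma upper_triangular_pencil_nilpotent:
  fixes P D :: "'a :: field mat"
  assumes P: "P \<in> carrier_mat k k" and D: "D \<in> carrier_mat k k" and up: "upper_triangular P"
    and diag: "\<And>i. i < k \<Longrightarrow> P $$ (i, i) \<noteq> 0"
    and zero: "\<And>i j. i < k \<Longrightarrow> j \<le> i \<Longrightarrow> D $$ (i, j) = 0"
    and nz: "\<And>i. Suc i < k \<Longrightarrow> D $$ (i, Suc i) \<noteq> 0"
  shows "pencil_iso (P, D) (1\<^sub>m k, jordan_block k 0)"
proof -
  have "0 \<notin> set (diag_mat P)" using P diag by (auto simp: diag_mat_def)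
  then have "invertible_mat P"
    unfolding invertible_mat_iff_det[OF P] det_upper_triangular[OF up P]
    by (simp add: prod_list_zero_iff)
  then obtain P' where P': "P' \<in> carrier_mat k k" "P * P' = 1\<^sub>m k" "P' * P = 1\<^sub>m k"
    using invertible_mat_iff[OF P] by blast
  define M where "M = P' * D"
  have M: "M \<in> carrier_mat k k" using P' D by (simp add: M_def)
  have PM: "P * M = D" unfolding M_def assoc_mult_mat[OF P P'(1) D, symmetric] using P' D by simp
  have row: "D $$ (i, j) = P $$ (i, i) * M $$ (i, j) + (\<Sum>l\<in>{Suc i..<k}. P $$ (i, l) * M $$ (l, j))"
    if ij: "i < k" "j < k" for i j
  proof -
    have "D $$ (i, j) = (\<Sum>l<k. P $$ (i, l) * M $$ (l, j))"
      using index_mult_mat_sum[OF P M ij] PM by simp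
    also have "\<dots> = (\<Sum>l\<in>{i..<k}. P $$ (i, l) * M $$ (l, j))"
      using upper_triangularD[OF up, of _ i] P ij by (intro sum.mono_neutral_right) auto
    also have "\<dots> = P $$ (i, i) * M $$ (i, j) + (\<Sum>l\<in>{Suc i..<k}. P $$ (i, l) * M $$ (l, j))"
      using ij by (simp add: sum.atLeast_Suc_lessThan)
    finally show ?thesis .
  qed
  have Mzero: "M $$ (i, j) = 0" if "i < k" "j \<le> i" for i j
    using that
  proof (induction "k - i" arbitrary: i rule: less_induct)
    case less
    have "(\<Sum>l\<in>{Suc i..<k}. P $$ (i, l) * M $$ (l, j)) = 0"
      using less by (intro sum.neutral) auto
    then show ?case using row[of i j] zero[of i j] diag[of i] less.prems by simp
  qed
  have Mnz: "M $$ (i, Suc i) \<noteq> 0" if "Suc i < k" for i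
  proof -
    have "(\<Sum>l\<in>{Suc i..<k}. P $$ (i, l) * M $$ (l, Suc i)) = 0"
      using Mzero by (intro sum.neutral) auto
    then show ?thesis using row[of i "Suc i"] nz[of i] that by auto
  qed
  have "invertible_mat P'" using P P' invertible_mat_iff by blast
  moreover have "invertible_mat (1\<^sub>m k :: 'a mat)" by (simp add: invertible_mat_iff_det[of _ k])
  ultimately have "pencil_iso (P, D) (1\<^sub>m k, M)"
    using P D P' M by (intro pencil_isoI[of _ _ P' "1\<^sub>m k"]) (auto simp: is_pencil_def pencil_hom_def M_def)
  then show ?thesis using strictly_upper_jordan[OF M Mzero Mnz] by (rule pencil_iso_trans)
qed

lemma upper_triangular_pencil_jordan:
  fixes P Q :: "'a :: field mat"
  assumes P: "P \<in> carrier_mat k k" and Q: "Q \<in> carrier_mat k k" and up: "upper_triangular P"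
    and diag: "\<And>i. i < k \<Longrightarrow> P $$ (i, i) \<noteq> 0"
    and eq: "\<And>i j. i < k \<Longrightarrow> j \<le> i \<Longrightarrow> Q $$ (i, j) = z * P $$ (i, j)"
    and neq: "\<And>i. Suc i < k \<Longrightarrow> Q $$ (i, Suc i) \<noteq> z * P $$ (i, Suc i)"
  shows "pencil_iso (P, Q) (1\<^sub>m k, jordan_block k z)"
proof -
  have "pencil_iso (P, Q - z \<cdot>\<^sub>m P) (1\<^sub>m k, jordan_block k 0)"
    using assms by (intro upper_triangular_pencil_nilpotent) auto
  from pencil_iso_linear[OF this, of 1 0 z 1]
  have "pencil_iso (1 \<cdot>\<^sub>m P + 0 \<cdot>\<^sub>m (Q - z \<cdot>\<^sub>m P), z \<cdot>\<^sub>m P + 1 \<cdot>\<^sub>m (Q - z \<cdot>\<^sub>m P))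
    (1 \<cdot>\<^sub>m 1\<^sub>m k + 0 \<cdot>\<^sub>m jordan_block k 0, z \<cdot>\<^sub>m 1\<^sub>m k + 1 \<cdot>\<^sub>m jordan_block k 0)" .
  moreover have "1 \<cdot>\<^sub>m P + 0 \<cdot>\<^sub>m (Q - z \<cdot>\<^sub>m P) = P" "z \<cdot>\<^sub>m P + 1 \<cdot>\<^sub>m (Q - z \<cdot>\<^sub>m P) = Q"
    "1 \<cdot>\<^sub>m 1\<^sub>m k + 0 \<cdot>\<^sub>m jordan_block k (0 :: 'a) = 1\<^sub>m k"
    "z \<cdot>\<^sub>m 1\<^sub>m k + 1 \<cdot>\<^sub>m jordan_block k 0 = jordan_block k z"
    using P Q by (auto intro!: eq_matI)
  ultimately show ?thesis by simp
qed

section \<open>The tridiagonal blocks\<close>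

text \<open>Common shape of T_k(a), of its transpose and of the complex matrix whose realification
  is hat T.\<close>

definition tridiag :: "nat \<Rightarrow> 'a :: zero \<Rightarrow> 'a \<Rightarrow> 'a mat" where
  "tridiag k u l = mat k k (\<lambda>(i, j). if j = Suc i then u else if i = Suc j then l else 0)"

definition bidiag :: "nat \<Rightarrow> 'a :: zero \<Rightarrow> 'a \<Rightarrow> 'a mat" where
  "bidiag k d u = mat k k (\<lambda>(i, j). if i = j then d else if j = Suc i then u else 0)"

lemma tridiag_dim [simp]: "dim_row (tridiag k u l) = k" "dim_col (tridiag k u l) = k"
  by (simp_all add: tridiag_def)

lemma bidiag_dim [simp]: "dim_row (bidiag k d u) = k" "dim_col (bidiag k d u) = k"
  by (simp_all add: bidiag_def)

lemma tridiag_index: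
  "i < k \<Longrightarrow> j < k \<Longrightarrow> tridiag k u l $$ (i, j) = (if j = Suc i then u else if i = Suc j then l else 0)"
  by (simp add: tridiag_def)

lemma bidiag_index:
  "i < k \<Longrightarrow> j < k \<Longrightarrow> bidiag k d u $$ (i, j) = (if i = j then d else if j = Suc i then u else 0)"
  by (simp add: bidiag_def)

lemma tridiag_transpose: "(tridiag k u l)\<^sup>T = tridiag k l u"
  by (rule eq_matI) (auto simp: tridiag_index)

text \<open>The eigenvalue is the quotient of the diagonals. The superdiagonal of the shifted pencil
  is w - (z / x) y, which is nonzero exactly if x w and y z differ.\<close>

lemma pencil_iso_bidiag:
  fixes x y z w :: "'a :: field"
  assumes "x \<noteq> 0" "x * w \<noteq> y * z"
  shows "pencil_iso (bidiag l x y, bidiag l z w) (1\<^sub>m l, jordan_block l (z / x))"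
  using assms by (intro upper_triangular_pencil_jordan) (auto simp: bidiag_index field_simps)

text \<open>Nonzero entries join indices of opposite parity, so odd rows meet only even columns and
  even rows only odd columns. In their second halves \<sigma> and \<tau> run downwards, because in
  increasing order the block of even rows and odd columns would be lower bidiagonal.\<close>

lemma tridiag_even_split:
  fixes c d :: "'a :: field"
  shows "pencil_iso (tridiag (2 * l) d 1, tridiag (2 * l) 1 c)
    (pdsum (bidiag l 1 d, bidiag l c 1) (bidiag l d 1, bidiag l 1 c))"
proof -
  define \<sigma> where "\<sigma> = (\<lambda>p. if p < l then 2 * p + 1 else 2 * (2 * l - 1 - p))"
  define \<tau> where "\<tau> = (\<lambda>q. if q < l then 2 * q else 2 * (2 * l - 1 - q) + 1)"
  have \<sigma>: "bij_betw \<sigma> {..<2 * l} {..<2 * l}" and \<tau>: "bij_betw \<tau> {..<2 * l} {..<2 * l}"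
    unfolding \<sigma>_def \<tau>_def by (intro bij_betw_lessThanI; simp split: if_splits; presburger)+
  have "reindex_mat \<sigma> \<tau> (tridiag (2 * l) u v) = mdsum (bidiag l v u) (bidiag l u v)" for u v :: 'a
  proof (rule eq_matI)
    fix p q assume "p < dim_row (mdsum (bidiag l v u) (bidiag l u v))" "q < dim_col (mdsum (bidiag l v u) (bidiag l u v))"
    then have pq: "p < 2 * l" "q < 2 * l" by auto
    then have "\<sigma> p < 2 * l" "\<tau> q < 2 * l" by (auto simp: \<sigma>_def \<tau>_def)
    then have "reindex_mat \<sigma> \<tau> (tridiag (2 * l) u v) $$ (p, q)
        = (if \<tau> q = Suc (\<sigma> p) then u else if \<sigma> p = Suc (\<tau> q) then v else 0)"
      using pq by (simp add: reindex_mat_index tridiag_index)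
    also have "\<dots> = mdsum (bidiag l v u) (bidiag l u v) $$ (p, q)"
    proof (cases "p < l"; cases "q < l")
      assume "p < l" "q < l"
      then show ?thesis using pq by (simp add: index_mdsum[of _ l l _ l l] carrier_matI bidiag_index \<sigma>_def \<tau>_def)
    next
      assume "p < l" "\<not> q < l"
      then have "\<tau> q \<noteq> Suc (\<sigma> p)" "\<sigma> p \<noteq> Suc (\<tau> q)" unfolding \<sigma>_def \<tau>_def by (simp; presburger)+
      then show ?thesis using pq \<open>p < l\<close> \<open>\<not> q < l\<close>
        by (simp add: index_mdsum[of _ l l _ l l] carrier_matI bidiag_index)
    next
      assume "\<not> p < l" "q < l"
      then have "\<tau> q \<noteq> Suc (\<sigma> p)" "\<sigma> p \<noteq> Suc (\<tau> q)" unfolding \<sigma>_def \<tau>_def by (simp; presburger)+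
      then show ?thesis using pq \<open>\<not> p < l\<close> \<open>q < l\<close>
        by (simp add: index_mdsum[of _ l l _ l l] carrier_matI bidiag_index)
    next
      assume a: "\<not> p < l" "\<not> q < l"
      then have "\<tau> q = Suc (\<sigma> p) \<longleftrightarrow> p = q" "\<sigma> p = Suc (\<tau> q) \<longleftrightarrow> q = Suc p"
        using pq unfolding \<sigma>_def \<tau>_def by auto
      moreover have "p - l = q - l \<longleftrightarrow> p = q" "q - l = Suc (p - l) \<longleftrightarrow> q = Suc p" using a by auto
      ultimately show ?thesis using pq a
        by (simp add: index_mdsum[of _ l l _ l l] carrier_matI bidiag_index)
    qed
    finally show "reindex_mat \<sigma> \<tau> (tridiag (2 * l) u v) $$ (p, q) = mdsum (bidiag l v u) (bidiag l u v) $$ (p, q)" .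
  qed auto
  then show ?thesis
    using pencil_iso_reindex[OF _ _ \<sigma> \<tau>, of "tridiag (2 * l) d 1" "tridiag (2 * l) 1 c"]
    by (simp add: pdsum_def carrier_matI)
qed

text \<open>\<open>c\<close> and \<open>d\<close> are kept apart because the complex application has
  d = conj(c). The condition on c d makes both shifted superdiagonals nonzero.\<close>

lemma tridiag_even:
  fixes c d :: "'a :: field"
  assumes "c * d \<noteq> 1" "d \<noteq> 0"
  shows "pencil_iso (tridiag (2 * l) d 1, tridiag (2 * l) 1 c)
    (psum [(1\<^sub>m l, jordan_block l c), (1\<^sub>m l, jordan_block l (1 / d))])"
proof -
  have "pencil_iso (bidiag l 1 d, bidiag l c 1) (1\<^sub>m l, jordan_block l c)"
    using pencil_iso_bidiag[of 1 1 d c l] assms by (simp add: mult.commute)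
  moreover have "pencil_iso (bidiag l d 1, bidiag l 1 c) (1\<^sub>m l, jordan_block l (1 / d))"
    using pencil_iso_bidiag[of d c 1 1 l] assms by (simp add: mult.commute)
  ultimately show ?thesis
    using tridiag_even_split[of l d c] by (auto intro: pencil_iso_trans pencil_iso_pdsum)
qed

text \<open>Serves to list the two blocks of T_2l(0) in the order of the theorem.\<close>

lemma pencil_iso_pdsum_commute:
  fixes P Q :: "'a :: field mat \<times> 'a mat"
  assumes P: "is_pencil P" and Q: "is_pencil Q"
  shows "pencil_iso (pdsum P Q) (pdsum Q P)"
proof -
  obtain m n where P: "fst P \<in> carrier_mat m n" "snd P \<in> carrier_mat m n"
    using P by (auto simp: is_pencil_def)
  obtain p q where Q: "fst Q \<in> carrier_mat p q" "snd Q \<in> carrier_mat p q"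
    using Q by (auto simp: is_pencil_def)
  define \<rho> where "\<rho> = (\<lambda>a b i. if i < b then a + i else i - b :: nat)"
  have \<rho>: "bij_betw (\<rho> a b) {..<a + b} {..<a + b}" for a b
    unfolding \<rho>_def by (intro bij_betw_lessThanI) (auto split: if_splits)
  have eq: "reindex_mat (\<rho> m p) (\<rho> n q) (mdsum A B) = mdsum B A"
    if A: "A \<in> carrier_mat m n" and B: "B \<in> carrier_mat p q" for A B :: "'a mat"
  proof (rule eq_matI)
    fix i j assume "i < dim_row (mdsum B A)" "j < dim_col (mdsum B A)"
    then have ij: "i < p + m" "j < q + n" using A B by auto
    then have "\<rho> m p i < m + p" "\<rho> n q j < n + q" by (auto simp: \<rho>_def)
    then show "reindex_mat (\<rho> m p) (\<rho> n q) (mdsum A B) $$ (i, j) = mdsum B A $$ (i, j)"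
      using ij A B by (simp add: reindex_mat_index index_mdsum[OF A B] index_mdsum[OF B A]) (auto simp: \<rho>_def)
  qed (use A B in auto)
  show ?thesis
    using pencil_iso_reindex[OF mdsum_carrier[OF P(1) Q(1)] mdsum_carrier[OF P(2) Q(2)] \<rho> \<rho>]
      eq[OF P(1) Q(1)] eq[OF P(2) Q(2)] by (simp add: pdsum_def)
qed

lemma tridiag_even_0:
  "pencil_iso (tridiag (2 * l) 0 1, tridiag (2 * l) 1 (0 :: 'a :: field))
    (psum [(jordan_block l 0, 1\<^sub>m l), (1\<^sub>m l, jordan_block l 0)])"
proof -
  have eq: "bidiag l (1 :: 'a) 0 = 1\<^sub>m l" "bidiag l (0 :: 'a) 1 = jordan_block l 0"
    by (auto intro!: eq_matI simp: bidiag_index)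
  have pen: "is_pencil (1\<^sub>m l :: 'a mat, jordan_block l 0)" "is_pencil (jordan_block l 0, 1\<^sub>m l :: 'a mat)"
    by (simp_all add: is_pencil_def)
  show ?thesis
    using pencil_iso_trans[OF tridiag_even_split[of l "0 :: 'a" 0, unfolded eq] pencil_iso_pdsum_commute[OF pen]] by simp
qed

text \<open>Counting from 0, there are l odd and l + 1 even indices, so the two parity classes give
  an l x (l + 1) and an (l + 1) x l block instead of two square ones.\<close>

lemma tridiag_odd_0:
  "pencil_iso (tridiag (2 * l + 1) 0 1, tridiag (2 * l + 1) 1 (0 :: 'a :: field))
    (psum [(left_shift l, right_shift l), ((left_shift l)\<^sup>T, (right_shift l)\<^sup>T)])"
proof -
  define \<sigma> where "\<sigma> = (\<lambda>p. if p < l then 2 * p + 1 else 2 * (2 * l - p))"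
  define \<tau> where "\<tau> = (\<lambda>q. if q < Suc l then 2 * q else 2 * (2 * l - q) + 1)"
  let ?n = "2 * l + 1"
  \<comment> \<open>The condition \<open>l < p\<close> excludes p = l, which stands for the last row
    2l and has no superdiagonal entry.\<close>
  have parity: "(\<sigma> p = Suc (\<tau> q) \<longleftrightarrow> (if p < l then p = q else q = Suc p)) \<and>
     (\<tau> q = Suc (\<sigma> p) \<longleftrightarrow> (if p < l then q = Suc p else q = p \<and> l < p))" if pq: "p < ?n" "q < ?n" for p q
  proof -
    \<comment> \<open>Named complements replace truncated subtraction, which leaves linear equations
      and parity.\<close>
    define u v where "u = 2 * l - p" and "v = 2 * l - q"
    have uv: "p + u = 2 * l" "q + v = 2 * l" using pq by (auto simp: u_def v_def)
    have \<sigma>p: "\<sigma> p = (if p < l then 2 * p + 1 else 2 * u)" and \<tau>q: "\<tau> q = (if q < Suc l then 2 * q else 2 * v + 1)"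
      by (simp_all add: \<sigma>_def \<tau>_def u_def v_def)
    have even_odd: "2 * a \<noteq> Suc (2 * b)" "Suc (2 * a) \<noteq> 2 * b" for a b :: nat by presburger+
    show ?thesis unfolding \<sigma>p \<tau>q using uv
      by (cases "p < l"; cases "q < Suc l") (auto simp: even_odd)
  qed
  have \<sigma>: "bij_betw \<sigma> {..<?n} {..<?n}" and \<tau>: "bij_betw \<tau> {..<?n} {..<?n}"
    unfolding \<sigma>_def \<tau>_def by (intro bij_betw_lessThanI; simp split: if_splits; presburger)+
  have "reindex_mat \<sigma> \<tau> (tridiag ?n 0 1) = mdsum (left_shift l) ((left_shift l)\<^sup>T :: 'a mat)
     \<and> reindex_mat \<sigma> \<tau> (tridiag ?n 1 0) = mdsum (right_shift l) ((right_shift l)\<^sup>T :: 'a mat)"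
  proof (intro conjI eq_matI)
    fix p q assume "p < dim_row (mdsum (left_shift l) ((left_shift l)\<^sup>T :: 'a mat))"
      "q < dim_col (mdsum (left_shift l) ((left_shift l)\<^sup>T :: 'a mat))"
    then have pq: "p < ?n" "q < ?n" by auto
    then have lt: "\<sigma> p < ?n" "\<tau> q < ?n" by (auto simp: \<sigma>_def \<tau>_def)
    have "reindex_mat \<sigma> \<tau> (tridiag ?n 0 1) $$ (p, q) = (if \<sigma> p = Suc (\<tau> q) then 1 else 0 :: 'a)"
      using pq lt by (simp add: reindex_mat_index tridiag_index)
    also have "\<dots> = (if if p < l then p = q else q = Suc p then 1 else 0)"
      using parity[OF pq] by (simp only: if_True)
    also have "\<dots> = (if p < l then if q < Suc l then left_shift l $$ (p, q) else 0
        else if q < Suc l then 0 else (left_shift l)\<^sup>T $$ (p - l, q - Suc l))"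
      by (cases "p < l"; cases "q < Suc l") (use pq in \<open>auto simp: shift_index\<close>)
    also have "\<dots> = mdsum (left_shift l) ((left_shift l)\<^sup>T) $$ (p, q)"
      using pq by (intro index_mdsum[symmetric]) auto
    finally show "reindex_mat \<sigma> \<tau> (tridiag ?n 0 1) $$ (p, q) = mdsum (left_shift l) ((left_shift l)\<^sup>T :: 'a mat) $$ (p, q)" .
  next
    fix p q assume "p < dim_row (mdsum (right_shift l) ((right_shift l)\<^sup>T :: 'a mat))"
      "q < dim_col (mdsum (right_shift l) ((right_shift l)\<^sup>T :: 'a mat))"
    then have pq: "p < ?n" "q < ?n" by auto
    then have lt: "\<sigma> p < ?n" "\<tau> q < ?n" by (auto simp: \<sigma>_def \<tau>_def)
    have "reindex_mat \<sigma> \<tau> (tridiag ?n 1 0) $$ (p, q) = (if \<tau> q = Suc (\<sigma> p) then 1 else 0 :: 'a)"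
      using pq lt by (simp add: reindex_mat_index tridiag_index)
    also have "\<dots> = (if if p < l then q = Suc p else q = p \<and> l < p then 1 else 0)"
      using parity[OF pq] by (simp only: if_True)
    also have "\<dots> = (if p < l then if q < Suc l then right_shift l $$ (p, q) else 0
        else if q < Suc l then 0 else (right_shift l)\<^sup>T $$ (p - l, q - Suc l))"
      by (cases "p < l"; cases "q < Suc l") (use pq in \<open>auto simp: shift_index\<close>)
    also have "\<dots> = mdsum (right_shift l) ((right_shift l)\<^sup>T) $$ (p, q)"
      using pq by (intro index_mdsum[symmetric]) auto
    finally show "reindex_mat \<sigma> \<tau> (tridiag ?n 1 0) $$ (p, q) = mdsum (right_shift l) ((right_shift l)\<^sup>T :: 'a mat) $$ (p, q)" .
  qed auto
  then show ?thesis
    using pencil_iso_reindex[OF _ _ \<sigma> \<tau>, of "tridiag ?n 0 1" "tridiag ?n 1 (0 :: 'a)"]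
    by (simp add: pdsum_def carrier_matI)
qed

section \<open>The matrix \<Gamma>_k over arbitrary coefficients and its path ordering\<close>

definition gamma :: "nat \<Rightarrow> 'a :: comm_ring_1 mat" where
  "gamma k = mat k k (\<lambda>(i, j).
     if i = 0 \<and> j = 0 then 1 else if j = Suc i then 1 else if i = Suc j then (- 1) ^ i else 0)"

lemma gamma_dim [simp]: "dim_row (gamma k) = k" "dim_col (gamma k) = k"
  by (simp_all add: gamma_def)

lemma gamma_index:
  "i < k \<Longrightarrow> j < k \<Longrightarrow> gamma k $$ (i, j) =
     (if i = 0 \<and> j = 0 then 1 else if j = Suc i then 1 else if i = Suc j then (- 1) ^ i else 0)"
  by (simp add: gamma_def)

text \<open>Up to signs and a factor \<open>2\<close>, \<open>\<Gamma> + \<Gamma>\<^sup>T\<close> and \<open>\<Gamma> - \<Gamma>\<^sup>T\<close> are partial permutation matrices whose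
  supports alternate along a single path through all the indices. Listing rows and columns along
  that path makes both \<open>\<Gamma>\<close> and \<open>\<Gamma>\<^sup>T\<close> upper bidiagonal.\<close>

definition path_row :: "nat \<Rightarrow> nat \<Rightarrow> nat" where
  "path_row k i = (if 2 * i + 1 < k then k - 2 - 2 * i else 2 * i + 1 - k)"

definition path_col :: "nat \<Rightarrow> nat \<Rightarrow> nat" where
  "path_col k i = (if 2 * i < k then k - 1 - 2 * i else 2 * i - k)"

lemma odd_double_neq: "Suc (2 * a) \<noteq> 2 * b" "2 * b \<noteq> Suc (2 * a)" for a b :: nat
  by presburger+

text \<open>The downward and the upward half of each path have opposite parity, so equal values from
  different halves would identify an odd with an even number; within a half the map is strictly
  monotone.\<close>

lemma path_bij: "bij_betw (path_row k) {..<k} {..<k}" "bij_betw (path_col k) {..<k} {..<k}"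
proof -
  show "bij_betw (path_col k) {..<k} {..<k}"
  proof (rule bij_betw_lessThanI)
    show "path_col k i < k" if "i < k" for i using that by (auto simp: path_col_def)
    fix i j assume ij: "i < k" "j < k" and eq: "path_col k i = path_col k j"
    have "i \<le> j" if "path_col k i = path_col k j" "i < k" "j < k" for i j
    proof (rule ccontr)
      assume "\<not> i \<le> j"
      then consider "2 * i < k" "2 * j < k" | "k \<le> 2 * i" "2 * j < k" | "k \<le> 2 * i" "k \<le> 2 * j"
        by linarith
      then show False
      proof cases
        case 2
        then have "Suc (path_col k i + path_col k j) = 2 * (i - j)" by (auto simp: path_col_def)
        then have "Suc (2 * path_col k i) = 2 * (i - j)" using that by simp
        then show False using odd_double_neq by blast
      qed (use that \<open>\<not> i \<le> j\<close> in \<open>auto simp: path_col_def\<close>)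
    qed
    then show "i = j" using ij eq by (intro antisym) auto
  qed
  show "bij_betw (path_row k) {..<k} {..<k}"
  proof (rule bij_betw_lessThanI)
    show "path_row k i < k" if "i < k" for i using that by (auto simp: path_row_def)
    fix i j assume ij: "i < k" "j < k" and eq: "path_row k i = path_row k j"
    have "i \<le> j" if "path_row k i = path_row k j" "i < k" "j < k" for i j
    proof (rule ccontr)
      assume "\<not> i \<le> j"
      then consider "2 * i + 1 < k" "2 * j + 1 < k" | "k \<le> 2 * i + 1" "2 * j + 1 < k" | "k \<le> 2 * i + 1" "k \<le> 2 * j + 1"
        by linarith
      then show False
      proof cases
        case 2
        then have "Suc (path_row k i + path_row k j) = 2 * (i - j)" by (auto simp: path_row_def)
        then have "Suc (2 * path_row k i) = 2 * (i - j)" using that by simp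
        then show False using odd_double_neq by blast
      qed (use that \<open>\<not> i \<le> j\<close> in \<open>auto simp: path_row_def\<close>)
    qed
    then show "i = j" using ij eq by (intro antisym) auto
  qed
qed

text \<open>Within one half of the path the two indices are at least 3 apart. In the mixed case
  their sum is 2 (i - j): it is even, so they are not neighbours, and positive, so they are not both
  0.\<close>

lemma path_below:
  assumes "j < i" "i < k"
  shows "path_col k j \<noteq> Suc (path_row k i)" "path_row k i \<noteq> Suc (path_col k j)"
    "\<not> (path_row k i = 0 \<and> path_col k j = 0)"
proof -
  consider "2 * i + 1 < k" "2 * j < k" | "k \<le> 2 * i + 1" "2 * j < k" | "k \<le> 2 * i + 1" "k \<le> 2 * j"
    using assms by linarith
  then have "path_col k j \<noteq> Suc (path_row k i) \<and> path_row k i \<noteq> Suc (path_col k j) \<and>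
    \<not> (path_row k i = 0 \<and> path_col k j = 0)"
  proof cases
    case 2
    then have sum: "path_row k i + path_col k j = 2 * (i - j)" by (auto simp: path_row_def path_col_def)
    show ?thesis
    proof (intro conjI notI)
      assume "path_col k j = Suc (path_row k i)"
      with sum have "Suc (2 * path_row k i) = 2 * (i - j)" by simp
      then show False using odd_double_neq by blast
    next
      assume "path_row k i = Suc (path_col k j)"
      with sum have "Suc (2 * path_col k j) = 2 * (i - j)" by simp
      then show False using odd_double_neq by blast
    next
      assume "path_row k i = 0 \<and> path_col k j = 0"
      with sum assms show False by simp
    qed
  qed (use assms in \<open>auto simp: path_row_def path_col_def\<close>)
  then show "path_col k j \<noteq> Suc (path_row k i)" "path_row k i \<noteq> Suc (path_col k j)"
    "\<not> (path_row k i = 0 \<and> path_col k j = 0)" by auto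
qed

lemma path_less:
  assumes "i < k" shows "path_row k i < k" "path_col k i < k"
  using assms by (auto simp: path_row_def path_col_def)

text \<open>The cases are the way down, the turn at the entry (0, 0), which lies on this diagonal
  only for odd k, and the way up. For neighbours t and t + 1 the two mirrored entries have quotient
  (-1)^(t + 1), and here t has the parity of k.\<close>

lemma gamma_path_diag:
  assumes i: "i < k"
  shows "gamma k $$ (path_col k i, path_row k i) \<noteq> (0 :: 'a :: field_char_0)"
    "gamma k $$ (path_row k i, path_col k i) = (- 1) ^ (k + 1) * (gamma k $$ (path_col k i, path_row k i) :: 'a)"
proof -
  note lt = path_less[OF i]
  consider "2 * i + 1 < k" | "2 * i + 1 = k" | "k < 2 * i + 1" by linarith
  then have "gamma k $$ (path_col k i, path_row k i) \<noteq> (0 :: 'a) \<and>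
    gamma k $$ (path_row k i, path_col k i) = (- 1) ^ (k + 1) * (gamma k $$ (path_col k i, path_row k i) :: 'a)"
  proof cases
    case 1
    define t where "t = path_row k i"
    have t: "path_row k i = t" "path_col k i = Suc t" "k = t + 2 + 2 * i"
      using 1 by (auto simp: path_row_def path_col_def t_def)
    have "gamma k $$ (Suc t, t) = (- 1 :: 'a) ^ Suc t" "gamma k $$ (t, Suc t) = (1 :: 'a)"
      using lt t(1,2) by (simp_all add: gamma_index)
    then show ?thesis unfolding t(1,2) by (simp add: t(3) power_add flip: power_mult_distrib)
  next
    case 2
    then have "path_row k i = 0" "path_col k i = 0" by (auto simp: path_row_def path_col_def)
    moreover have "(- 1 :: 'a) ^ (k + 1) = 1" unfolding 2[symmetric] by simp
    ultimately show ?thesis using i by (simp add: gamma_index)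
  next
    case 3
    define t where "t = path_col k i"
    have t: "path_row k i = Suc t" "path_col k i = t" "k + t = 2 * i"
      using 3 i by (auto simp: path_row_def path_col_def t_def)
    have "gamma k $$ (Suc t, t) = (- 1 :: 'a) ^ Suc t" "gamma k $$ (t, Suc t) = (1 :: 'a)"
      using lt t(1,2) by (simp_all add: gamma_index)
    moreover have "even t \<longleftrightarrow> even k" using arg_cong[OF t(3), of even] by auto
    ultimately show ?thesis unfolding t(1,2) by (simp add: minus_one_power_iff)
  qed
  then show "gamma k $$ (path_col k i, path_row k i) \<noteq> (0 :: 'a)"
    "gamma k $$ (path_row k i, path_col k i) = (- 1) ^ (k + 1) * (gamma k $$ (path_col k i, path_row k i) :: 'a)"
    by auto
qed

text \<open>Now t and k have opposite parity, and the turn occurs for even k. The quotient has the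
  sign opposite to that on the diagonal, so one eigenvalue cannot cancel both.\<close>

lemma gamma_path_superdiag:
  assumes i: "Suc i < k"
  shows "gamma k $$ (path_col k (Suc i), path_row k i) \<noteq> (0 :: 'a :: field_char_0)"
    "gamma k $$ (path_row k i, path_col k (Suc i)) = - ((- 1) ^ (k + 1)) * (gamma k $$ (path_col k (Suc i), path_row k i) :: 'a)"
proof -
  have lt: "path_row k i < k" "path_col k (Suc i) < k" using path_less i by auto
  consider "2 * i + 2 < k" | "2 * i + 2 = k" | "k < 2 * i + 2" by linarith
  then have "gamma k $$ (path_col k (Suc i), path_row k i) \<noteq> (0 :: 'a) \<and>
    gamma k $$ (path_row k i, path_col k (Suc i)) = - ((- 1) ^ (k + 1)) * (gamma k $$ (path_col k (Suc i), path_row k i) :: 'a)"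
  proof cases
    case 1
    define t where "t = path_col k (Suc i)"
    have t: "path_row k i = Suc t" "path_col k (Suc i) = t" "k = t + 3 + 2 * i"
      using 1 by (auto simp: path_row_def path_col_def t_def)
    have g: "gamma k $$ (Suc t, t) = (- 1 :: 'a) ^ Suc t" "gamma k $$ (t, Suc t) = (1 :: 'a)"
      using lt t(1,2) by (simp_all add: gamma_index)
    have "even k \<longleftrightarrow> odd t" by (simp add: t(3))
    then show ?thesis unfolding t(1,2) g by (simp add: minus_one_power_iff)
  next
    case 2
    then have "path_row k i = 0" "path_col k (Suc i) = 0" by (auto simp: path_row_def path_col_def)
    moreover have "(- 1 :: 'a) ^ (k + 1) = - 1" unfolding 2[symmetric] by simp
    ultimately show ?thesis using i by (simp add: gamma_index)
  next
    case 3
    define t where "t = path_row k i"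
    have t: "path_row k i = t" "path_col k (Suc i) = Suc t" "k + t = 2 * i + 1"
      using 3 i by (auto simp: path_row_def path_col_def t_def)
    have g: "gamma k $$ (Suc t, t) = (- 1 :: 'a) ^ Suc t" "gamma k $$ (t, Suc t) = (1 :: 'a)"
      using lt t(1,2) by (simp_all add: gamma_index)
    have "even t \<longleftrightarrow> odd k" using arg_cong[OF t(3), of even] by auto
    then show ?thesis unfolding t(1,2) g by (simp add: minus_one_power_iff)
  qed
  then show "gamma k $$ (path_col k (Suc i), path_row k i) \<noteq> (0 :: 'a)"
    "gamma k $$ (path_row k i, path_col k (Suc i)) = - ((- 1) ^ (k + 1)) * (gamma k $$ (path_col k (Suc i), path_row k i) :: 'a)"
    by auto
qed

text \<open>There are two scalars because transposing a realified c \<Gamma> conjugates c. On the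
  superdiagonal the shifted pencil equals twice the entry of \<open>?Q\<close>, which is nonzero in
  characteristic 0.\<close>

lemma gamma_pencil:
  fixes c d :: "'a :: field_char_0"
  assumes "c \<noteq> 0" "d \<noteq> 0"
  shows "pencil_iso (d \<cdot>\<^sub>m (gamma k)\<^sup>T, c \<cdot>\<^sub>m gamma k) (1\<^sub>m k, jordan_block k ((- 1) ^ (k + 1) * c / d))"
proof -
  let ?P = "reindex_mat (path_row k) (path_col k) (d \<cdot>\<^sub>m (gamma k)\<^sup>T)"
  let ?Q = "reindex_mat (path_row k) (path_col k) (c \<cdot>\<^sub>m gamma k)"
  have P: "?P $$ (i, j) = d * gamma k $$ (path_col k j, path_row k i)"
    and Q: "?Q $$ (i, j) = c * gamma k $$ (path_row k i, path_col k j)" if "i < k" "j < k" for i j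
    using that path_less[OF that(1)] path_less[OF that(2)] by (auto simp: reindex_mat_index)
  have below: "?P $$ (i, j) = 0" "?Q $$ (i, j) = 0" if "j < i" "i < k" for i j
    using that path_below[OF that] path_less[of i k] path_less[of j k]
    by (auto simp: P Q gamma_index)
  have "pencil_iso (d \<cdot>\<^sub>m (gamma k)\<^sup>T, c \<cdot>\<^sub>m gamma k) (?P, ?Q)"
    by (rule pencil_iso_reindex[OF _ _ path_bij]) (auto intro!: carrier_matI)
  also have "pencil_iso (?P, ?Q) (1\<^sub>m k, jordan_block k ((- 1) ^ (k + 1) * c / d))"
  proof (rule upper_triangular_pencil_jordan)
    show "upper_triangular ?P" using below by auto
    show "?P $$ (i, i) \<noteq> 0" if "i < k" for i
      using gamma_path_diag(1)[OF that, where 'a = 'a] assms that by (simp add: P)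
    show "?Q $$ (i, j) = (- 1) ^ (k + 1) * c / d * ?P $$ (i, j)" if "i < k" "j \<le> i" for i j
    proof (cases "j = i")
      case True
      then show ?thesis using gamma_path_diag(2)[OF that(1), where 'a = 'a] assms that by (simp add: P Q)
    next
      case False
      then show ?thesis using below[of j i] that by simp
    qed
    show "?Q $$ (i, Suc i) \<noteq> (- 1) ^ (k + 1) * c / d * ?P $$ (i, Suc i)" if i: "Suc i < k" for i
    proof -
      define g where "g = (gamma k $$ (path_col k (Suc i), path_row k i) :: 'a)"
      have "?Q $$ (i, Suc i) = - ((- 1) ^ (k + 1) * c * g)" "?P $$ (i, Suc i) = d * g"
        using gamma_path_superdiag(2)[OF i, where 'a = 'a] i by (simp_all add: P Q g_def)
      moreover have "(- 1) ^ (k + 1) * c * g \<noteq> 0"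
        using gamma_path_superdiag(1)[OF i, where 'a = 'a] assms by (simp add: g_def)
      ultimately show ?thesis using assms by (simp add: eq_neg_iff_add_eq_0 neg_eq_iff_add_eq_0)
    qed
  qed (auto intro!: carrier_matI)
  finally show ?thesis .
qed

section \<open>Kronecker forms of the canonical summands\<close>

lemma is_real_KCF_iff:
  "is_real_KCF m n A B Ks \<longleftrightarrow>
     set Ks \<subseteq> real_kronecker_blocks \<and> A \<in> carrier_mat m n \<and> pencil_iso (A, B) (psum Ks)"
  by (auto simp: is_real_KCF_def strictly_real_equivalent_iff_iso pair_direct_sum_eq_psum)

lemma T_mat_eq: "T_mat k a = tridiag k 1 a" "(T_mat k a)\<^sup>T = tridiag k a 1"
proof -
  show *: "T_mat k a = tridiag k 1 a" by (simp add: T_mat_def tridiag_def)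
  show "(T_mat k a)\<^sup>T = tridiag k a 1" unfolding * by (rule tridiag_transpose)
qed

lemma real_kronecker_blocks_intros:
  "k \<ge> 1 \<Longrightarrow> (1\<^sub>m k, jordan_block k \<mu>) \<in> real_kronecker_blocks"
  "k \<ge> 1 \<Longrightarrow> (jordan_block k 0, 1\<^sub>m k) \<in> real_kronecker_blocks"
  "k \<ge> 1 \<Longrightarrow> b > 0 \<Longrightarrow> (1\<^sub>m (2 * k), C_mat k a b) \<in> real_kronecker_blocks"
  "(F_mat k, G_mat k) \<in> real_kronecker_blocks" "((F_mat k)\<^sup>T, (G_mat k)\<^sup>T) \<in> real_kronecker_blocks"
  unfolding real_kronecker_blocks_def by blast+

lemma KCF_T_odd:
  "is_real_KCF (2 * l + 1) (2 * l + 1) ((T_mat (2 * l + 1) 0)\<^sup>T) (T_mat (2 * l + 1) 0)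
     [(F_mat l, G_mat l), ((F_mat l)\<^sup>T, (G_mat l)\<^sup>T)]"
  unfolding is_real_KCF_iff T_mat_eq(2)
  unfolding T_mat_eq(1)
  using tridiag_odd_0[of l, where 'a = real]
  by (auto simp: real_kronecker_blocks_intros F_mat_eq G_mat_eq intro!: carrier_matI
      intro: real_kronecker_blocks_intros[unfolded F_mat_eq G_mat_eq])

lemma KCF_T_even_0:
  assumes "l \<ge> 1"
  shows "is_real_KCF (2 * l) (2 * l) ((T_mat (2 * l) 0)\<^sup>T) (T_mat (2 * l) 0)
     [(jordan_block l 0, 1\<^sub>m l), (1\<^sub>m l, jordan_block l 0)]"
  unfolding is_real_KCF_iff T_mat_eq(2)
  unfolding T_mat_eq(1)
  using tridiag_even_0[of l, where 'a = real] assms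
  by (auto intro!: carrier_matI real_kronecker_blocks_intros)

lemma KCF_T_even:
  assumes "l \<ge> 1" "a \<noteq> 0" "a \<noteq> 1" "a \<noteq> - 1"
  shows "is_real_KCF (2 * l) (2 * l) ((T_mat (2 * l) a)\<^sup>T) (T_mat (2 * l) a)
     [(1\<^sub>m l, jordan_block l a), (1\<^sub>m l, jordan_block l (1 / a))]"
proof -
  have "a * a \<noteq> 1" using assms by (simp add: square_eq_1_iff)
  then show ?thesis
    unfolding is_real_KCF_iff T_mat_eq(2) unfolding T_mat_eq(1) using tridiag_even[of a a l] assms
    by (auto intro!: carrier_matI real_kronecker_blocks_intros)
qed

text \<open>Transposing C(a, b) changes the sign of b, so the real transpose is the realified
  conjugate transpose. This is the origin of the conjugate parameters.\<close>

lemma realify_transpose: "(realify Z)\<^sup>T = realify ((map_mat cnj Z)\<^sup>T)"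
proof (rule eq_matI)
  fix i j assume "i < dim_row (realify ((map_mat cnj Z)\<^sup>T))" "j < dim_col (realify ((map_mat cnj Z)\<^sup>T))"
  then have ij: "i < 2 * dim_col Z" "j < 2 * dim_row Z" by auto
  then have ij': "i div 2 < dim_col Z" "j div 2 < dim_row Z" by auto
  have parity: "i mod 2 = 0 \<or> i mod 2 = 1" "j mod 2 = 0 \<or> j mod 2 = 1" by auto
  show "(realify Z)\<^sup>T $$ (i, j) = realify ((map_mat cnj Z)\<^sup>T) $$ (i, j)"
    using ij ij' parity by (simp add: realify_index) (auto simp: re_im_entry_def)
qed auto

lemma That_mat_eq:
  "That_mat m a b = realify (tridiag m 1 (Complex a b))"
  "(That_mat m a b)\<^sup>T = realify (tridiag m (cnj (Complex a b)) 1)"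
proof -
  show *: "That_mat m a b = realify (tridiag m 1 (Complex a b))"
  proof (rule eq_matI)
    fix i j assume "i < dim_row (realify (tridiag m 1 (Complex a b)))" "j < dim_col (realify (tridiag m 1 (Complex a b)))"
    then have "i < 2 * m" "j < 2 * m" by auto
    then show "That_mat m a b $$ (i, j) = realify (tridiag m 1 (Complex a b)) $$ (i, j)"
      by (auto simp: That_mat_def block2_mat_def realify_index tridiag_index C2_mat_index re_im_entry_def)
  qed (auto simp: That_mat_def block2_mat_def)
  have "(map_mat cnj (tridiag m 1 (Complex a b)))\<^sup>T = tridiag m (cnj (Complex a b)) 1"
    by (rule eq_matI) (auto simp: tridiag_index)
  then show "(That_mat m a b)\<^sup>T = realify (tridiag m (cnj (Complex a b)) 1)"
    unfolding * realify_transpose by simp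
qed

lemma map_pencil_realify_jordan:
  "map_pencil realify (1\<^sub>m k, jordan_block k z) = (1\<^sub>m (2 * k), C_mat k (Re z) (Im z))"
  by (simp add: realify_one C_mat_eq_realify)

text \<open>With c = a + ib the eigenvalues are c and 1 / conj(c) = c / |c|^2. The second is the
  inverse point for the unit circle rather than 1 / c, so both imaginary parts are positive as the
  block type demands.\<close>

lemma KCF_That:
  assumes "k \<ge> 1" "a\<^sup>2 + b\<^sup>2 \<noteq> 1" "b > 0"
  shows "is_real_KCF (4 * k) (4 * k) ((That_mat (2 * k) a b)\<^sup>T) (That_mat (2 * k) a b)
     [(1\<^sub>m (2 * k), C_mat k a b), (1\<^sub>m (2 * k), C_mat k (a / (a\<^sup>2 + b\<^sup>2)) (b / (a\<^sup>2 + b\<^sup>2)))]"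
proof -
  define c where "c = Complex a b"
  have "c * cnj c = complex_of_real (a\<^sup>2 + b\<^sup>2)"
    unfolding complex_mult_cnj by (simp add: c_def)
  then have "c * cnj c \<noteq> 1" using assms(2) by (metis of_real_eq_1_iff)
  moreover have "cnj c \<noteq> 0" using assms(3) by (simp add: c_def complex_eq_iff)
  ultimately have "pencil_iso (map_pencil realify (tridiag (2 * k) (cnj c) 1, tridiag (2 * k) 1 c))
      (map_pencil realify (pdsum (1\<^sub>m k, jordan_block k c) (1\<^sub>m k, jordan_block k (1 / cnj c))))"
    using tridiag_even[of c "cnj c" k] by (intro pencil_iso_realify) simp
  moreover have "map_pencil realify (tridiag (2 * k) (cnj c) 1, tridiag (2 * k) 1 c)
      = ((That_mat (2 * k) a b)\<^sup>T, That_mat (2 * k) a b)"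
    unfolding That_mat_eq(2) unfolding That_mat_eq(1) by (simp add: c_def)
  moreover have "map_pencil realify (pdsum (1\<^sub>m k, jordan_block k c) (1\<^sub>m k, jordan_block k (1 / cnj c)))
      = psum [(1\<^sub>m (2 * k), C_mat k (Re c) (Im c)), (1\<^sub>m (2 * k), C_mat k (Re (1 / cnj c)) (Im (1 / cnj c)))]"
    by (simp add: map_pencil_realify_pdsum map_pencil_realify_jordan del: map_pencil_simps(3))
  ultimately have "pencil_iso ((That_mat (2 * k) a b)\<^sup>T, That_mat (2 * k) a b)
      (psum [(1\<^sub>m (2 * k), C_mat k (Re c) (Im c)), (1\<^sub>m (2 * k), C_mat k (Re (1 / cnj c)) (Im (1 / cnj c)))])"
    by simp
  moreover have "Re (1 / cnj c) = a / (a\<^sup>2 + b\<^sup>2)" "Im (1 / cnj c) = b / (a\<^sup>2 + b\<^sup>2)"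
    by (simp_all add: c_def Re_divide Im_divide)
  moreover have "b / (a\<^sup>2 + b\<^sup>2) > 0" using assms(3) by (simp add: add_nonneg_pos)
  moreover have "(That_mat (2 * k) a b)\<^sup>T \<in> carrier_mat (4 * k) (4 * k)"
    by (auto simp: That_mat_eq(2) intro!: carrier_matI)
  ultimately show ?thesis using assms
    by (auto simp: is_real_KCF_iff c_def intro!: real_kronecker_blocks_intros)
qed

lemma kronecker_Gamma_sign:
  "kronecker (Gamma_mat k) (mat11 \<epsilon>) = \<epsilon> \<cdot>\<^sub>m gamma k"
  by (rule eq_matI) (auto simp: kronecker_def Gamma_mat_def gamma_def)

lemma KCF_Gamma_sign:
  assumes "k \<ge> 1" "\<epsilon> \<in> {1, - 1}"
  shows "is_real_KCF k k ((kronecker (Gamma_mat k) (mat11 \<epsilon>))\<^sup>T) (kronecker (Gamma_mat k) (mat11 \<epsilon>))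
     [(1\<^sub>m k, jordan_block k ((- 1) ^ (k + 1)))]"
proof -
  have "(\<epsilon> \<cdot>\<^sub>m gamma k)\<^sup>T = \<epsilon> \<cdot>\<^sub>m (gamma k)\<^sup>T" by (rule eq_matI) auto
  moreover have "\<epsilon> \<noteq> 0" using assms(2) by auto
  ultimately show ?thesis
    unfolding is_real_KCF_iff kronecker_Gamma_sign using gamma_pencil[of \<epsilon> \<epsilon> k] assms(1)
    by (auto intro!: carrier_matI real_kronecker_blocks_intros)
qed

lemma C2_mat_dim [simp]: "dim_row (C2_mat a b) = 2" "dim_col (C2_mat a b) = 2"
  by (simp_all add: C2_mat_def mat_of_rows_list_def)

lemma kronecker_Gamma_C:
  "kronecker (Gamma_mat k) (C2_mat a b) = realify (Complex a b \<cdot>\<^sub>m gamma k)"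
  "(kronecker (Gamma_mat k) (C2_mat a b))\<^sup>T = realify (cnj (Complex a b) \<cdot>\<^sub>m (gamma k)\<^sup>T)"
proof -
  have dim: "dim_row (Gamma_mat k) = k" "dim_col (Gamma_mat k) = k" by (simp_all add: Gamma_mat_def)
  have G: "gamma k $$ (i, j) = complex_of_real (Gamma_mat k $$ (i, j))" if "i < k" "j < k" for i j
    using that by (simp add: gamma_index Gamma_mat_def)
  have scale: "re_im_entry (z * complex_of_real x) p q = x * re_im_entry z p q" for z x p q
    by (simp add: re_im_entry_def)
  show *: "kronecker (Gamma_mat k) (C2_mat a b) = realify (Complex a b \<cdot>\<^sub>m gamma k)"
  proof (rule eq_matI)
    fix i j assume "i < dim_row (realify (Complex a b \<cdot>\<^sub>m gamma k))" "j < dim_col (realify (Complex a b \<cdot>\<^sub>m gamma k))"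
    then have ij: "i < 2 * k" "j < 2 * k" "i div 2 < k" "j div 2 < k" by auto
    then show "kronecker (Gamma_mat k) (C2_mat a b) $$ (i, j) = realify (Complex a b \<cdot>\<^sub>m gamma k) $$ (i, j)"
      by (simp add: kronecker_def dim realify_index G scale C2_mat_index mult.commute[of k])
  qed (auto simp: kronecker_def dim)
  have "(map_mat cnj (Complex a b \<cdot>\<^sub>m gamma k))\<^sup>T = cnj (Complex a b) \<cdot>\<^sub>m (gamma k)\<^sup>T"
    by (rule eq_matI) (auto simp: G)
  then show "(kronecker (Gamma_mat k) (C2_mat a b))\<^sup>T = realify (cnj (Complex a b) \<cdot>\<^sub>m (gamma k)\<^sup>T)"
    unfolding * realify_transpose by simp
qed

text \<open>For |c| = 1 the quotient c / conj(c) is c^2, with real part a^2 - b^2 and imaginary part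
  2ab. The imaginary part can still have either sign or vanish.\<close>

lemma Gamma_C_pencil:
  assumes "a\<^sup>2 + b\<^sup>2 = 1"
  shows "pencil_iso ((kronecker (Gamma_mat k) (C2_mat a b))\<^sup>T, kronecker (Gamma_mat k) (C2_mat a b))
     (1\<^sub>m (2 * k), C_mat k ((- 1) ^ (k + 1) * (a\<^sup>2 - b\<^sup>2)) ((- 1) ^ (k + 1) * (2 * a * b)))"
proof -
  define c where "c = Complex a b"
  have one: "c * cnj c = 1"
    unfolding complex_mult_cnj using assms by (simp add: c_def)
  then have nz: "c \<noteq> 0" "cnj c \<noteq> 0" by auto
  have "c / cnj c = c * c" using one nz by (simp add: field_simps)
  then have z: "(- 1) ^ (k + 1) * c / cnj c = complex_of_real ((- 1) ^ (k + 1)) * (c * c)"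
    unfolding times_divide_eq_right[symmetric] by simp
  have parts: "Re (complex_of_real x * (c * c)) = x * (a\<^sup>2 - b\<^sup>2)" "Im (complex_of_real x * (c * c)) = x * (2 * a * b)" for x
    by (simp_all add: c_def power2_eq_square)
  show ?thesis
    unfolding kronecker_Gamma_C(2) unfolding kronecker_Gamma_C(1)
    using pencil_iso_realify[OF gamma_pencil[OF nz, of k]]
    unfolding z map_pencil_realify_jordan parts by (simp add: c_def)
qed

text \<open>Swapping the two coordinates inside every 2 x 2 block exchanges C(a, b) with C(a, -b)
  and fixes the identity; \<open>\<sigma>\<close> flips the last binary digit of an index.\<close>

lemma C_mat_conj: "pencil_iso (1\<^sub>m (2 * k), C_mat k a b) (1\<^sub>m (2 * k), C_mat k a (- b))"
proof -
  define \<sigma> where "\<sigma> = (\<lambda>i :: nat. if even i then Suc i else i - 1)"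
  have div: "\<sigma> i div 2 = i div 2" and mod: "\<sigma> i mod 2 = 1 - i mod 2" for i
    by (cases "even i"; auto simp: \<sigma>_def elim!: oddE)+
  have lt: "\<sigma> i < 2 * k" if "i < 2 * k" for i
  proof -
    have "\<sigma> i div 2 < k" using that by (simp add: div less_mult_imp_div_less mult.commute)
    then show ?thesis by auto
  qed
  have inj: "i = j" if "\<sigma> i = \<sigma> j" for i j
  proof -
    have "i div 2 = j div 2" using div[of i] div[of j] that by simp
    moreover have "1 - i mod 2 = 1 - j mod 2" using mod[of i] mod[of j] that by simp
    then have "i mod 2 = j mod 2" using mod_less_divisor[of 2 i] mod_less_divisor[of 2 j] by linarith
    ultimately show ?thesis by (metis div_mult_mod_eq)
  qed
  have bij: "bij_betw \<sigma> {..<2 * k} {..<2 * k}"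
    using lt inj by (rule bij_betw_lessThanI)
  have "reindex_mat \<sigma> \<sigma> (C_mat k a b) = C_mat k a (- b)"
  proof (rule eq_matI)
    fix i j assume "i < dim_row (C_mat k a (- b))" "j < dim_col (C_mat k a (- b))"
    then have ij: "i < 2 * k" "j < 2 * k" "i div 2 < k" "j div 2 < k" by auto
    have parity: "i mod 2 = 0 \<or> i mod 2 = 1" "j mod 2 = 0 \<or> j mod 2 = 1" by auto
    show "reindex_mat \<sigma> \<sigma> (C_mat k a b) $$ (i, j) = C_mat k a (- b) $$ (i, j)"
      using ij lt[of i] lt[of j] parity unfolding C_mat_eq_realify
      by (simp add: reindex_mat_index realify_index div mod) (auto simp: re_im_entry_def)
  qed auto
  moreover have "reindex_mat \<sigma> \<sigma> (1\<^sub>m (2 * k) :: real mat) = 1\<^sub>m (2 * k)"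
    by (rule eq_matI) (auto simp: reindex_mat_index lt dest: inj)
  ultimately show ?thesis
    using pencil_iso_reindex[OF _ _ bij bij, of "1\<^sub>m (2 * k)" "C_mat k a b"] by (simp add: carrier_matI)
qed

text \<open>The parity of k and the sign of a decide the sign of the imaginary part;
  \<open>C_mat_conj\<close> normalises it to a positive one.\<close>

lemma KCF_Gamma_C:
  assumes "k \<ge> 1" "a\<^sup>2 + b\<^sup>2 = 1" "b > 0" "a \<noteq> 0"
  shows "is_real_KCF (2 * k) (2 * k) ((kronecker (Gamma_mat k) (C2_mat a b))\<^sup>T) (kronecker (Gamma_mat k) (C2_mat a b))
     [(1\<^sub>m (2 * k), C_mat k ((- 1) ^ (k + 1) * (a\<^sup>2 - b\<^sup>2)) (2 * \<bar>a * b\<bar>))]"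
proof -
  define p q where "p = (- 1) ^ (k + 1) * (a\<^sup>2 - b\<^sup>2)" and "q = (- 1) ^ (k + 1) * (2 * a * b)"
  have "\<bar>q\<bar> = 2 * \<bar>a * b\<bar>" by (simp add: q_def abs_mult power_abs)
  then consider "2 * \<bar>a * b\<bar> = q" | "2 * \<bar>a * b\<bar> = - q" by linarith
  then have "pencil_iso (1\<^sub>m (2 * k), C_mat k p q) (1\<^sub>m (2 * k), C_mat k p (2 * \<bar>a * b\<bar>))"
  proof cases
    case 1
    show ?thesis unfolding 1 by (rule pencil_iso_refl) (auto simp: is_pencil_def intro!: carrier_matI)
  next
    case 2
    show ?thesis unfolding 2 by (rule C_mat_conj)
  qed
  with Gamma_C_pencil[OF assms(2), of k]
  have "pencil_iso ((kronecker (Gamma_mat k) (C2_mat a b))\<^sup>T, kronecker (Gamma_mat k) (C2_mat a b))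
     (1\<^sub>m (2 * k), C_mat k p (2 * \<bar>a * b\<bar>))"
    unfolding p_def q_def by (rule pencil_iso_trans)
  moreover have "2 * \<bar>a * b\<bar> > 0" using assms by simp
  moreover have "(kronecker (Gamma_mat k) (C2_mat a b))\<^sup>T \<in> carrier_mat (2 * k) (2 * k)"
    by (auto simp: kronecker_Gamma_C(2) intro!: carrier_matI)
  ultimately show ?thesis using assms(1)
    unfolding is_real_KCF_iff p_def by (simp add: real_kronecker_blocks_intros)
qed

text \<open>A real parameter realifies to J_k(x) \<otimes> I_2. The perfect shuffle, which lists the
  even indices before the odd ones, turns this into I_2 \<otimes> J_k(x).\<close>

lemma realify_of_real_split:
  "pencil_iso (1\<^sub>m (2 * k), C_mat k x 0) (psum [(1\<^sub>m k, jordan_block k x), (1\<^sub>m k, jordan_block k x)])"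
proof -
  define \<sigma> where "\<sigma> = (\<lambda>i. if i < k then 2 * i else 2 * (i - k) + 1)"
  have bij: "bij_betw \<sigma> {..<2 * k} {..<2 * k}"
    unfolding \<sigma>_def by (intro bij_betw_lessThanI; simp split: if_splits; presburger)
  have lt: "\<sigma> i < 2 * k" if "i < 2 * k" for i using that by (auto simp: \<sigma>_def)
  have eq: "reindex_mat \<sigma> \<sigma> (realify Z) = mdsum A A"
    if Z: "Z \<in> carrier_mat k k" and A: "A \<in> carrier_mat k k"
      and ZA: "\<And>i j. i < k \<Longrightarrow> j < k \<Longrightarrow> Z $$ (i, j) = complex_of_real (A $$ (i, j))" for Z A
  proof (rule eq_matI)
    fix i j assume "i < dim_row (mdsum A A)" "j < dim_col (mdsum A A)"
    then have ij: "i < k + k" "j < k + k" using A by auto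
    then have "reindex_mat \<sigma> \<sigma> (realify Z) $$ (i, j) = re_im_entry (Z $$ (\<sigma> i div 2, \<sigma> j div 2)) (\<sigma> i mod 2) (\<sigma> j mod 2)"
      using Z lt[of i] lt[of j] by (simp add: reindex_mat_index realify_index)
    also have "\<dots> = mdsum A A $$ (i, j)"
      using ij unfolding index_mdsum[OF A A ij]
      by (cases "i < k"; cases "j < k") (simp_all add: \<sigma>_def ZA re_im_entry_def)
    finally show "reindex_mat \<sigma> \<sigma> (realify Z) $$ (i, j) = mdsum A A $$ (i, j)" .
  qed (use Z A in auto)
  have "reindex_mat \<sigma> \<sigma> (realify (1\<^sub>m k)) = mdsum (1\<^sub>m k) (1\<^sub>m k)" by (rule eq) auto
  moreover have "reindex_mat \<sigma> \<sigma> (realify (jordan_block k (Complex x 0))) = mdsum (jordan_block k x) (jordan_block k x)"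
    by (rule eq) (auto simp: complex_eq_iff)
  ultimately show ?thesis
    using pencil_iso_reindex[OF _ _ bij bij, of "1\<^sub>m (2 * k)" "C_mat k x 0"]
    by (simp add: realify_one C_mat_eq_realify pdsum_def carrier_matI)
qed

text \<open>Here c = \<i> and c^2 = -1, so the eigenvalue is the real number (-1)^k and the
  realified block splits.\<close>

lemma KCF_Gamma_i:
  assumes "k \<ge> 1"
  shows "is_real_KCF (2 * k) (2 * k) ((kronecker (Gamma_mat k) (C2_mat 0 1))\<^sup>T) (kronecker (Gamma_mat k) (C2_mat 0 1))
     [(1\<^sub>m k, jordan_block k ((- 1) ^ k)), (1\<^sub>m k, jordan_block k ((- 1) ^ k))]"
proof -
  have "pencil_iso ((kronecker (Gamma_mat k) (C2_mat 0 1))\<^sup>T, kronecker (Gamma_mat k) (C2_mat 0 1))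
     (1\<^sub>m (2 * k), C_mat k ((- 1) ^ k) 0)"
    using Gamma_C_pencil[of 0 1 k] by simp
  moreover have "(kronecker (Gamma_mat k) (C2_mat 0 1))\<^sup>T \<in> carrier_mat (2 * k) (2 * k)"
    by (auto simp: kronecker_Gamma_C(2) intro!: carrier_matI)
  ultimately show ?thesis using assms pencil_iso_trans[OF _ realify_of_real_split]
    unfolding is_real_KCF_iff by (simp add: real_kronecker_blocks_intros)
qed

section \<open>Recovering the canonical form from the Kronecker form\<close>

definition tri_summands :: "real mat set" where
  "tri_summands = tri_i \<union> tri_ii \<union> tri_iii"

definition self_KCF :: "real mat \<Rightarrow> (real mat \<times> real mat) list \<Rightarrow> bool" where
  "self_KCF B Ks \<longleftrightarrow> is_real_KCF (dim_row B) (dim_row B) (B\<^sup>T) B Ks"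

text \<open>The choice is harmless because any two Kronecker forms of (B^T, B) agree as multisets;
  the value carries information only where a form exists.\<close>

definition KCF_mset :: "real mat \<Rightarrow> (real mat \<times> real mat) multiset" where
  "KCF_mset B = mset (SOME Ks. self_KCF B Ks)"

lemma self_KCF_iff:
  "self_KCF B Ks \<longleftrightarrow> set Ks \<subseteq> real_kronecker_blocks \<and> B \<in> carrier_mat (dim_row B) (dim_row B) \<and>
     pencil_iso (B\<^sup>T, B) (psum Ks)"
  unfolding self_KCF_def is_real_KCF_iff by auto

lemma self_KCF_unique: "self_KCF B Ks \<Longrightarrow> self_KCF B Ks' \<Longrightarrow> mset Ks = mset Ks'"
  unfolding self_KCF_iff by (metis real_kronecker_form_unique pencil_iso_sym pencil_iso_trans)

lemma KCF_mset_eq: "self_KCF B Ks \<Longrightarrow> KCF_mset B = mset Ks"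
  unfolding KCF_mset_def by (metis self_KCF_unique someI)

lemma tri_dims [simp]:
  "dim_row (T_mat k a) = k" "dim_row (That_mat m a b) = 2 * m"
  "dim_row (kronecker (Gamma_mat k) (mat11 \<epsilon>)) = k" "dim_row (kronecker (Gamma_mat k) (C2_mat a b)) = 2 * k"
  unfolding T_mat_def That_mat_def block2_mat_def kronecker_Gamma_sign kronecker_Gamma_C(1) by simp_all

lemma self_KCF_summands:
  "self_KCF (T_mat (2 * l + 1) 0) [(F_mat l, G_mat l), ((F_mat l)\<^sup>T, (G_mat l)\<^sup>T)]"
  "l \<ge> 1 \<Longrightarrow> self_KCF (T_mat (2 * l) 0) [(jordan_block l 0, 1\<^sub>m l), (1\<^sub>m l, jordan_block l 0)]"
  "l \<ge> 1 \<Longrightarrow> a \<noteq> 0 \<Longrightarrow> a \<noteq> 1 \<Longrightarrow> a \<noteq> - 1 \<Longrightarrow>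
     self_KCF (T_mat (2 * l) a) [(1\<^sub>m l, jordan_block l a), (1\<^sub>m l, jordan_block l (1 / a))]"
  "k \<ge> 1 \<Longrightarrow> a\<^sup>2 + b\<^sup>2 \<noteq> 1 \<Longrightarrow> b > 0 \<Longrightarrow> self_KCF (That_mat (2 * k) a b)
     [(1\<^sub>m (2 * k), C_mat k a b), (1\<^sub>m (2 * k), C_mat k (a / (a\<^sup>2 + b\<^sup>2)) (b / (a\<^sup>2 + b\<^sup>2)))]"
  "k \<ge> 1 \<Longrightarrow> \<epsilon> \<in> {1, - 1} \<Longrightarrow>
     self_KCF (kronecker (Gamma_mat k) (mat11 \<epsilon>)) [(1\<^sub>m k, jordan_block k ((- 1) ^ (k + 1)))]"
  "k \<ge> 1 \<Longrightarrow> self_KCF (kronecker (Gamma_mat k) (C2_mat 0 1))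
     [(1\<^sub>m k, jordan_block k ((- 1) ^ k)), (1\<^sub>m k, jordan_block k ((- 1) ^ k))]"
  "k \<ge> 1 \<Longrightarrow> a\<^sup>2 + b\<^sup>2 = 1 \<Longrightarrow> b > 0 \<Longrightarrow> a \<noteq> 0 \<Longrightarrow> self_KCF (kronecker (Gamma_mat k) (C2_mat a b))
     [(1\<^sub>m (2 * k), C_mat k ((- 1) ^ (k + 1) * (a\<^sup>2 - b\<^sup>2)) (2 * \<bar>a * b\<bar>))]"
  unfolding self_KCF_def tri_dims
  using KCF_T_odd KCF_T_even_0 KCF_T_even KCF_That KCF_Gamma_sign KCF_Gamma_i KCF_Gamma_C
  by (simp_all del: One_nat_def)

lemma tri_summands_cases [consumes 1, case_names T_odd T_even_0 T_even That Gamma_sign Gamma_i Gamma_C]: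
  assumes "B \<in> tri_summands"
  obtains l where "B = T_mat (2 * l + 1) 0"
  | l where "l \<ge> 1" "B = T_mat (2 * l) 0"
  | l a where "l \<ge> 1" "a \<noteq> 0" "a \<noteq> 1" "a \<noteq> - 1" "B = T_mat (2 * l) a"
  | k a b where "k \<ge> 1" "a\<^sup>2 + b\<^sup>2 \<noteq> 1" "b > 0" "B = That_mat (2 * k) a b"
  | k \<epsilon> where "k \<ge> 1" "\<epsilon> \<in> {1, - 1}" "B = kronecker (Gamma_mat k) (mat11 \<epsilon>)"
  | k where "k \<ge> 1" "B = kronecker (Gamma_mat k) (C2_mat 0 1)"
  | k a b where "k \<ge> 1" "a\<^sup>2 + b\<^sup>2 = 1" "b > 0" "a \<noteq> 0" "B = kronecker (Gamma_mat k) (C2_mat a b)"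
proof -
  from assms consider "B \<in> tri_i" | "B \<in> tri_ii" | "B \<in> tri_iii" by (auto simp: tri_summands_def)
  then show thesis
  proof cases
    case 1
    then obtain k a where *: "B = T_mat k a" "k \<ge> 1" "a \<noteq> 1" "a \<noteq> - 1" "odd k \<longrightarrow> a = 0"
      unfolding tri_i_def by blast
    show thesis
    proof (cases "odd k")
      case True
      then obtain l where "k = 2 * l + 1" by (elim oddE)
      then show thesis using * True that(1) by simp
    next
      case False
      then have "even k" by simp
      then obtain l where "k = 2 * l" by (elim evenE)
      then show thesis using * that(2)[of l] that(3)[of l a] by (cases "a = 0") auto
    qed
  next
    case 2
    then show thesis using that(4) unfolding tri_ii_def by blast
  next
    case 3
    then consider k \<epsilon> where "k \<ge> 1" "\<epsilon> \<in> {1, - 1}" "B = kronecker (Gamma_mat k) (mat11 \<epsilon>)"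
      | k a b where "k \<ge> 1" "a\<^sup>2 + b\<^sup>2 = 1" "b > 0" "B = kronecker (Gamma_mat k) (C2_mat a b)"
      unfolding tri_iii_def by blast
    then show thesis
    proof cases
      case 1
      then show thesis using that(5) by blast
    next
      case (2 k a b)
      \<comment> \<open>For a = 0 the conditions a^2 + b^2 = 1 and b > 0 leave only b = 1.\<close>
      then show thesis using that(6)[of k] that(7)[of k a b]
        by (cases "a = 0") (auto simp: power2_eq_1_iff)
    qed
  qed
qed

lemma self_KCF_tri:
  assumes "B \<in> tri_summands"
  shows "\<exists>Ks. self_KCF B Ks \<and> Ks \<noteq> []"
  using assms
proof (cases B rule: tri_summands_cases)
  case T_odd
  then show ?thesis using self_KCF_summands(1) by blast
next
  case T_even_0
  then show ?thesis using self_KCF_summands(2) by blast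
next
  case T_even
  then show ?thesis using self_KCF_summands(3) by blast
next
  case That
  then show ?thesis using self_KCF_summands(4) by blast
next
  case Gamma_sign
  then show ?thesis using self_KCF_summands(5) by blast
next
  case Gamma_i
  then show ?thesis using self_KCF_summands(6) by blast
next
  case Gamma_C
  then show ?thesis using self_KCF_summands(7) by blast
qed

lemma KCF_mset_nonempty: "B \<in> tri_summands \<Longrightarrow> KCF_mset B \<noteq> {#}"
  using self_KCF_tri KCF_mset_eq by fastforce

lemma self_KCF_direct_sum:
  assumes "set Bs \<subseteq> tri_summands"
  shows "\<exists>Ks. self_KCF (diag_block_mat Bs) Ks \<and> mset Ks = (\<Sum>B\<in>#mset Bs. KCF_mset B)"
  using assms
proof (induction Bs)
  case Nil
  have "(0\<^sub>m 0 0 :: real mat)\<^sup>T = 0\<^sub>m 0 0" by (rule eq_matI) auto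
  then have "self_KCF (diag_block_mat []) []"
    by (auto simp: self_KCF_iff is_pencil_def intro!: pencil_iso_refl)
  then show ?case by (intro exI[of _ "[]"]) simp
next
  case (Cons B Bs)
  obtain Ks where Ks: "self_KCF (diag_block_mat Bs) Ks" "mset Ks = (\<Sum>B\<in>#mset Bs. KCF_mset B)"
    using Cons by auto
  obtain Ls where Ls: "self_KCF B Ls" using self_KCF_tri[of B] Cons.prems by auto
  have "pencil_iso (pdsum (B\<^sup>T, B) ((diag_block_mat Bs)\<^sup>T, diag_block_mat Bs)) (psum (Ls @ Ks))"
    unfolding psum_append using Ks Ls by (intro pencil_iso_pdsum) (auto simp: self_KCF_iff)
  then have iso: "pencil_iso ((mdsum B (diag_block_mat Bs))\<^sup>T, mdsum B (diag_block_mat Bs)) (psum (Ls @ Ks))"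
    by (simp only: pdsum_def mdsum_transpose fst_conv snd_conv)
  have "mdsum B (diag_block_mat Bs) \<in> carrier_mat (dim_row B + dim_row (diag_block_mat Bs))
      (dim_row B + dim_row (diag_block_mat Bs))"
    using Ks(1) Ls unfolding self_KCF_iff by (blast intro: mdsum_carrier)
  with iso have "self_KCF (diag_block_mat (B # Bs)) (Ls @ Ks)"
    using Ks(1) Ls unfolding self_KCF_iff diag_block_mat_Cons dim_mdsum set_append by blast
  moreover have "mset (Ls @ Ks) = (\<Sum>B\<in>#mset (B # Bs). KCF_mset B)"
    using Ks(2) KCF_mset_eq[OF Ls] by simp
  ultimately show ?case by blast
qed

section \<open>From congruence to an equation between multisets\<close>

lemma real_congruent_pencil_iso:
  assumes "real_congruent n A B"
  shows "pencil_iso (A\<^sup>T, A) (B\<^sup>T, B)"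
proof -
  obtain S where *: "A \<in> carrier_mat n n" "B \<in> carrier_mat n n" "S \<in> carrier_mat n n" "invertible_mat S"
    "S * A * S\<^sup>T = B" using assms unfolding real_congruent_def by blast
  have ST: "S\<^sup>T \<in> carrier_mat n n" and AT: "A\<^sup>T \<in> carrier_mat n n" and BT: "B\<^sup>T \<in> carrier_mat n n"
    using *(1-3) by simp_all
  have "invertible_mat (S\<^sup>T)"
    using *(4) unfolding invertible_mat_iff_det[OF *(3)] invertible_mat_iff_det[OF ST] by (simp add: det_transpose[OF *(3)])
  moreover have "S * A\<^sup>T * S\<^sup>T = B\<^sup>T"
  proof -
    have "B\<^sup>T = (S\<^sup>T)\<^sup>T * (S * A)\<^sup>T"
      unfolding *(5)[symmetric] by (rule transpose_mult[OF mult_carrier_mat[OF *(3,1)] ST])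
    also have "(S * A)\<^sup>T = A\<^sup>T * S\<^sup>T" by (rule transpose_mult[OF *(3,1)])
    finally show ?thesis unfolding assoc_mult_mat[OF *(3) AT ST] by simp
  qed
  ultimately have "strictly_real_equivalent n n (A\<^sup>T, A) (B\<^sup>T, B)"
    using * ST AT BT unfolding strictly_real_equivalent_def fst_conv snd_conv by blast
  then show ?thesis unfolding strictly_real_equivalent_iff_iso by blast
qed

text \<open>Turns the comparison of canonical forms into an equation between sums of multisets, one
  for each summand.\<close>

lemma mset_KCF_of_canonical_form:
  assumes "is_second_canonical_form n A Bs" "is_real_KCF n n (A\<^sup>T) A Ks"
  shows "mset Ks = (\<Sum>B\<in>#mset Bs. KCF_mset B)"
proof -
  have Bs: "set Bs \<subseteq> tri_summands" and cong: "real_congruent n A (diag_block_mat Bs)"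
    using assms(1) by (auto simp: is_second_canonical_form_def tri_summands_def)
  obtain Ls where Ls: "self_KCF (diag_block_mat Bs) Ls" "mset Ls = (\<Sum>B\<in>#mset Bs. KCF_mset B)"
    using self_KCF_direct_sum[OF Bs] by blast
  have "pencil_iso (psum Ks) (psum Ls)"
    using assms(2) Ls(1) real_congruent_pencil_iso[OF cong] unfolding is_real_KCF_iff self_KCF_iff
    by (blast intro: pencil_iso_sym pencil_iso_trans)
  then show ?thesis
    using real_kronecker_form_unique[of Ks Ls] assms(2) Ls unfolding is_real_KCF_iff self_KCF_iff by simp
qed

text \<open>\<open>block_class x S\<close>: the canonical summands whose Kronecker form contains the block \<open>x\<close> are
  those in \<open>S\<close>. Since they are all related, a single block suffices to identify its summand.\<close>

inductive block_class :: "real mat \<times> real mat \<Rightarrow> real mat set \<Rightarrow> bool" where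
  "block_class (left_shift l, right_shift l) {T_mat (2 * l + 1) 0}"
| "block_class ((left_shift l)\<^sup>T, (right_shift l)\<^sup>T) {T_mat (2 * l + 1) 0}"
| "l \<ge> 1 \<Longrightarrow> block_class (jordan_block l 0, 1\<^sub>m l) {T_mat (2 * l) 0}"
| "l \<ge> 1 \<Longrightarrow> block_class (1\<^sub>m l, jordan_block l 0) {T_mat (2 * l) 0}"
| "l \<ge> 1 \<Longrightarrow> a \<noteq> 0 \<Longrightarrow> a \<noteq> 1 \<Longrightarrow> a \<noteq> - 1 \<Longrightarrow>
     block_class (1\<^sub>m l, jordan_block l a) {T_mat (2 * l) a, T_mat (2 * l) (1 / a)}"
| "k \<ge> 1 \<Longrightarrow> block_class (1\<^sub>m k, jordan_block k ((- 1) ^ (k + 1)))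
     {kronecker (Gamma_mat k) (mat11 1), kronecker (Gamma_mat k) (mat11 (- 1))}"
| "k \<ge> 1 \<Longrightarrow> block_class (1\<^sub>m k, jordan_block k ((- 1) ^ k)) {kronecker (Gamma_mat k) (C2_mat 0 1)}"
| "k \<ge> 1 \<Longrightarrow> p\<^sup>2 + q\<^sup>2 \<noteq> 1 \<Longrightarrow> q > 0 \<Longrightarrow> block_class (1\<^sub>m (2 * k), C_mat k p q)
     {That_mat (2 * k) p q, That_mat (2 * k) (p / (p\<^sup>2 + q\<^sup>2)) (q / (p\<^sup>2 + q\<^sup>2))}"
| "k \<ge> 1 \<Longrightarrow> p\<^sup>2 + q\<^sup>2 = 1 \<Longrightarrow> q > 0 \<Longrightarrow> block_class (1\<^sub>m (2 * k), C_mat k p q)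
     {kronecker (Gamma_mat k) (C2_mat a b) | a b. a\<^sup>2 + b\<^sup>2 = 1 \<and> b > 0 \<and> a \<noteq> 0 \<and>
        p = (- 1) ^ (k + 1) * (a\<^sup>2 - b\<^sup>2) \<and> q = 2 * \<bar>a * b\<bar>}"

text \<open>For given k the eigenvalue (-1)^(k + 1) belongs to \<Gamma>_k \<otimes> [\<plusminus>1],
  its negative to \<Gamma>_k \<otimes> C(0, 1), and every other real one to T_2k. For C_2k(p, q) the
  position on or off the unit circle decides.\<close>

lemma block_class_fun: "block_class x S \<Longrightarrow> block_class x S' \<Longrightarrow> S = S'"
  by (erule block_class.cases; erule block_class.cases)
    (auto simp: block_neqs minus_one_power_iff split: if_splits)

text \<open>Inversion in the unit circle is an involution of the upper half plane, and it maps
  points off the circle to points off the circle.\<close>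

lemma inverse_point:
  fixes a b :: real
  assumes "b > 0"
  defines "r \<equiv> a\<^sup>2 + b\<^sup>2"
  shows "r > 0" "(a / r)\<^sup>2 + (b / r)\<^sup>2 = 1 / r" "r \<noteq> 1 \<Longrightarrow> (a / r)\<^sup>2 + (b / r)\<^sup>2 \<noteq> 1" "b / r > 0"
    "a / r / ((a / r)\<^sup>2 + (b / r)\<^sup>2) = a" "b / r / ((a / r)\<^sup>2 + (b / r)\<^sup>2) = b"
proof -
  show r: "r > 0" using assms by (simp add: add_nonneg_pos)
  have "(a / r)\<^sup>2 + (b / r)\<^sup>2 = r / r\<^sup>2" by (simp add: power_divide r_def add_divide_distrib)
  then show e: "(a / r)\<^sup>2 + (b / r)\<^sup>2 = 1 / r" using r by (simp add: power2_eq_square)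
  show "(a / r)\<^sup>2 + (b / r)\<^sup>2 \<noteq> 1" if "r \<noteq> 1" using r that unfolding e by simp
  show "b / r > 0" using assms r by simp
  show "a / r / ((a / r)\<^sup>2 + (b / r)\<^sup>2) = a" "b / r / ((a / r)\<^sup>2 + (b / r)\<^sup>2) = b" unfolding e using r by auto
qed

text \<open>The square of a complex number of modulus 1 has modulus 1; \<open>e\<close> stands for
  the sign (-1)^(k + 1).\<close>

lemma unit_square:
  fixes a b e :: real
  assumes "a\<^sup>2 + b\<^sup>2 = 1" "e\<^sup>2 = 1"
  shows "(e * (a\<^sup>2 - b\<^sup>2))\<^sup>2 + (2 * \<bar>a * b\<bar>)\<^sup>2 = 1"
proof -
  have "(e * (a\<^sup>2 - b\<^sup>2))\<^sup>2 + (2 * \<bar>a * b\<bar>)\<^sup>2 = (a\<^sup>2 - b\<^sup>2)\<^sup>2 + 4 * a\<^sup>2 * b\<^sup>2"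
    using assms(2) by (simp add: power_mult_distrib)
  also have "\<dots> = (a\<^sup>2 + b\<^sup>2)\<^sup>2" by (simp add: power2_eq_square algebra_simps)
  finally show ?thesis using assms(1) by simp
qed

lemma block_class_cover:
  assumes "B \<in> tri_summands" "x \<in># KCF_mset B"
  shows "\<exists>S. block_class x S \<and> B \<in> S"
  using assms(1)
proof (cases B rule: tri_summands_cases)
  case (T_odd l)
  then have "x = (left_shift l, right_shift l) \<or> x = ((left_shift l)\<^sup>T, (right_shift l)\<^sup>T)"
    using assms(2) KCF_mset_eq[OF self_KCF_summands(1)[of l]] by (auto simp: F_mat_eq G_mat_eq)
  then show ?thesis using T_odd block_class.intros(1,2)[of l] by auto
next
  case (T_even_0 l)
  then have "x = (jordan_block l 0, 1\<^sub>m l) \<or> x = (1\<^sub>m l, jordan_block l 0)"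
    using assms(2) KCF_mset_eq[OF self_KCF_summands(2)[of l]] by auto
  then show ?thesis using T_even_0 block_class.intros(3,4)[of l] by auto
next
  case (T_even l a)
  then have "x = (1\<^sub>m l, jordan_block l a) \<or> x = (1\<^sub>m l, jordan_block l (1 / a))"
    using assms(2) KCF_mset_eq[OF self_KCF_summands(3)[of l a]] by auto
  moreover have "1 / a \<noteq> 0" "1 / a \<noteq> 1" "1 / a \<noteq> - 1" using T_even by (auto simp: field_simps)
  ultimately show ?thesis using T_even block_class.intros(5)[of l a] block_class.intros(5)[of l "1 / a"] by auto
next
  case (That k a b)
  define r where "r = a\<^sup>2 + b\<^sup>2"
  note inv = inverse_point[OF That(3), of a, folded r_def]
  have x: "x = (1\<^sub>m (2 * k), C_mat k a b) \<or> x = (1\<^sub>m (2 * k), C_mat k (a / r) (b / r))"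
    using That assms(2) KCF_mset_eq[OF self_KCF_summands(4)[of k a b]] by (auto simp: r_def)
  \<comment> \<open>Inverting the inverse point returns (a, b), so the second block has the same
    pair of summands as its class.\<close>
  have "block_class (1\<^sub>m (2 * k), C_mat k (a / r) (b / r)) {That_mat (2 * k) (a / r) (b / r), That_mat (2 * k) a b}"
    using block_class.intros(8)[of k "a / r" "b / r"] That inv(3,4) unfolding inv(5,6) by (simp add: r_def)
  moreover have "block_class (1\<^sub>m (2 * k), C_mat k a b) {That_mat (2 * k) a b, That_mat (2 * k) (a / r) (b / r)}"
    using block_class.intros(8)[of k a b] That by (simp add: r_def)
  ultimately show ?thesis using x That(4) by blast
next
  case (Gamma_sign k \<epsilon>)
  then have "x = (1\<^sub>m k, jordan_block k ((- 1) ^ (k + 1)))"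
    using assms(2) KCF_mset_eq[OF self_KCF_summands(5)[of k \<epsilon>]] by auto
  then show ?thesis using Gamma_sign block_class.intros(6)[of k] by blast
next
  case (Gamma_i k)
  then have "x = (1\<^sub>m k, jordan_block k ((- 1) ^ k))"
    using assms(2) KCF_mset_eq[OF self_KCF_summands(6)[of k]] by auto
  then show ?thesis using Gamma_i block_class.intros(7)[of k] by blast
next
  case (Gamma_C k a b)
  define p q where "p = (- 1) ^ (k + 1) * (a\<^sup>2 - b\<^sup>2)" and "q = 2 * \<bar>a * b\<bar>"
  have x: "x = (1\<^sub>m (2 * k), C_mat k p q)"
    using Gamma_C assms(2) KCF_mset_eq[OF self_KCF_summands(7)[of k a b]] by (auto simp: p_def q_def)
  have "p\<^sup>2 + q\<^sup>2 = 1" unfolding p_def q_def using Gamma_C(2) by (intro unit_square) (auto simp: minus_one_power_iff)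
  moreover have "q > 0" using Gamma_C by (simp add: q_def)
  ultimately have "block_class x {kronecker (Gamma_mat k) (C2_mat a b) | a b. a\<^sup>2 + b\<^sup>2 = 1 \<and> b > 0 \<and> a \<noteq> 0 \<and>
      p = (- 1) ^ (k + 1) * (a\<^sup>2 - b\<^sup>2) \<and> q = 2 * \<bar>a * b\<bar>}" (is "block_class x ?S")
    unfolding x using Gamma_C(1) by (intro block_class.intros(9))
  moreover have "B \<in> ?S" using Gamma_C(2-5) p_def q_def by blast
  ultimately show ?thesis by blast
qed

lemma block_class_related:
  assumes "block_class x S" "B \<in> S" "B' \<in> S"
  shows "tri_replacement_or_sign B B'"
  using assms(1)
proof cases
  case (5 l a)
  have "tri_replacement (T_mat (2 * l) a) (T_mat (2 * l) (1 / a))"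
    using 5 by (intro tri_replacement.T) auto
  \<comment> \<open>The way back is the same rule applied at 1 / a.\<close>
  moreover have "tri_replacement (T_mat (2 * l) (1 / a)) (T_mat (2 * l) (1 / (1 / a)))"
    using 5 by (intro tri_replacement.T) (auto simp: field_simps)
  ultimately show ?thesis using 5 assms(2,3)
    by (auto intro: tri_replacement_or_sign.replacement tri_replacement.refl)
next
  case (6 k)
  have neg: "- kronecker (Gamma_mat k) (mat11 \<epsilon>) = kronecker (Gamma_mat k) (mat11 (- \<epsilon>))" for \<epsilon>
    unfolding kronecker_Gamma_sign by (rule eq_matI) auto
  have "tri_replacement_or_sign (kronecker (Gamma_mat k) (mat11 \<epsilon>)) (kronecker (Gamma_mat k) (mat11 (- \<epsilon>)))"
    if "\<epsilon> \<in> {1, - 1}" for \<epsilon>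
    using tri_replacement_or_sign.Gamma_sign[OF 6(3) that HOL.refl] unfolding neg .
  from this[of 1] this[of "- 1"] show ?thesis using 6 assms(2,3)
    by (auto intro: tri_replacement_or_sign.replacement tri_replacement.refl)
next
  case (8 k p q)
  define r where "r = p\<^sup>2 + q\<^sup>2"
  note inv = inverse_point[OF 8(5), of p, folded r_def]
  have "tri_replacement (That_mat (2 * k) p q) (That_mat (2 * k) (p / r) (q / r))"
    using tri_replacement.That[of k p q] 8 by (simp add: r_def)
  moreover have "tri_replacement (That_mat (2 * k) (p / r) (q / r)) (That_mat (2 * k) p q)"
    using tri_replacement.That[of k "p / r" "q / r"] 8 inv(3,4) unfolding inv(5,6) by (simp add: r_def)
  ultimately show ?thesis using 8 assms(2,3)
    by (auto simp: r_def intro: tri_replacement_or_sign.replacement tri_replacement.refl)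
next
  case (9 k p q)
  obtain a b where B: "B = kronecker (Gamma_mat k) (C2_mat a b)" "a\<^sup>2 + b\<^sup>2 = 1" "b > 0"
    "p = (- 1) ^ (k + 1) * (a\<^sup>2 - b\<^sup>2)" using assms(2) 9 by blast
  obtain a' b' where B': "B' = kronecker (Gamma_mat k) (C2_mat a' b')" "a'\<^sup>2 + b'\<^sup>2 = 1" "b' > 0"
    "p = (- 1) ^ (k + 1) * (a'\<^sup>2 - b'\<^sup>2)" using assms(3) 9 by blast
  \<comment> \<open>The value p fixes a^2 - b^2 and the circle fixes a^2 + b^2; with b > 0 only the
    sign of a stays open.\<close>
  have "a\<^sup>2 - b\<^sup>2 = a'\<^sup>2 - b'\<^sup>2" using B(4) B'(4) by simp
  then have "b\<^sup>2 = b'\<^sup>2" "a\<^sup>2 = a'\<^sup>2" using B(2) B'(2) by linarith+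
  then have "b = b'" "a' = a \<or> a' = - a" using B(3) B'(3) by (auto simp: power2_eq_iff)
  then show ?thesis
    using tri_replacement_or_sign.Gamma_C[OF 9(3) B(2,3)] B(1) B'(1)
    by (auto intro: tri_replacement_or_sign.replacement tri_replacement.refl)
qed (use assms(2,3) in \<open>auto intro: tri_replacement_or_sign.replacement tri_replacement.refl\<close>)

text \<open>The replacements for T and hat T exchange the two blocks of the form. The sign of
  \<Gamma>_k \<otimes> [\<plusminus>1] cancels in its single block, and a change of sign of a
  affects neither a^2 - b^2 nor |ab|.\<close>

lemma related_KCF_mset:
  assumes "tri_replacement_or_sign B B'"
  shows "KCF_mset B = KCF_mset B'"
  using assms
proof cases
  case replacement
  then show ?thesis
  proof cases
    case (T k a)
    from \<open>even k\<close> obtain l where k: "k = 2 * l" by (elim evenE) auto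
    then have l: "l \<ge> 1" using T by simp
    have "1 / a \<noteq> 0" "1 / a \<noteq> 1" "1 / a \<noteq> - 1" using T by (auto simp: field_simps)
    then show ?thesis
      using T l KCF_mset_eq[OF self_KCF_summands(3)[of l a]] KCF_mset_eq[OF self_KCF_summands(3)[of l "1 / a"]]
      by (simp add: k add_mset_commute)
  next
    case (That k a b)
    define r where "r = a\<^sup>2 + b\<^sup>2"
    note inv = inverse_point[OF That(5), of a, folded r_def]
    have "KCF_mset (That_mat (2 * k) a b) = {#(1\<^sub>m (2 * k), C_mat k a b), (1\<^sub>m (2 * k), C_mat k (a / r) (b / r))#}"
      using KCF_mset_eq[OF self_KCF_summands(4)[of k a b]] That by (simp add: r_def)
    moreover have "KCF_mset (That_mat (2 * k) (a / r) (b / r)) = {#(1\<^sub>m (2 * k), C_mat k (a / r) (b / r)), (1\<^sub>m (2 * k), C_mat k a b)#}"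
      using KCF_mset_eq[OF self_KCF_summands(4)[of k "a / r" "b / r"]] That inv(3,4) unfolding inv(5,6) by (simp add: r_def)
    ultimately show ?thesis using That by (simp add: r_def add_mset_commute)
  qed simp
next
  case (Gamma_sign k \<epsilon>)
  have "- B = kronecker (Gamma_mat k) (mat11 (- \<epsilon>))"
    unfolding Gamma_sign kronecker_Gamma_sign by (rule eq_matI) auto
  moreover have "- \<epsilon> \<in> {1, - 1}" using Gamma_sign by auto
  ultimately show ?thesis
    using KCF_mset_eq[OF self_KCF_summands(5)[of k \<epsilon>]] KCF_mset_eq[OF self_KCF_summands(5)[of k "- \<epsilon>"]] Gamma_sign
    by simp
next
  case (Gamma_C k a b)
  show ?thesis
  proof (cases "a = 0")
    case True
    then show ?thesis using Gamma_C by simp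
  next
    case False
    then show ?thesis
      using KCF_mset_eq[OF self_KCF_summands(7)[of k a b]] KCF_mset_eq[OF self_KCF_summands(7)[of k "- a" b]] Gamma_C
      by simp
  qed
qed

text \<open>One common member of \<open>f B\<close> and \<open>f B'\<close> already gives
  \<open>R B B'\<close>, hence \<open>f B = f B'\<close>, so whole values cancel and no partial
  overlap can block the induction. Nonempty values leave no summand over on one side.\<close>

lemma rel_mset_iff_sum_eq:
  assumes related: "\<And>B B'. R B B' \<Longrightarrow> f B = f B'"
    and nonempty: "\<And>B. B \<in> T \<Longrightarrow> f B \<noteq> {#}"
    and overlap: "\<And>B B' x. B \<in> T \<Longrightarrow> B' \<in> T \<Longrightarrow> x \<in># f B \<Longrightarrow> x \<in># f B' \<Longrightarrow> R B B'"
    and X: "set_mset X \<subseteq> T" and Y: "set_mset Y \<subseteq> T"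
  shows "rel_mset R X Y \<longleftrightarrow> (\<Sum>B\<in>#X. f B) = (\<Sum>B\<in>#Y. f B)"
proof
  assume "rel_mset R X Y"
  then obtain xs ys where *: "mset xs = X" "mset ys = Y" "list_all2 R xs ys" unfolding rel_mset_def by blast
  from *(3) have "(\<Sum>B\<in>#mset xs. f B) = (\<Sum>B\<in>#mset ys. f B)"
    by (induction rule: list_all2_induct) (auto dest: related)
  then show "(\<Sum>B\<in>#X. f B) = (\<Sum>B\<in>#Y. f B)" using * by simp
next
  assume "(\<Sum>B\<in>#X. f B) = (\<Sum>B\<in>#Y. f B)"
  with X Y show "rel_mset R X Y"
  proof (induction X arbitrary: Y)
    case empty
    have "Y = {#}"
    proof (rule ccontr)
      assume "Y \<noteq> {#}"
      then obtain B Y' where "Y = add_mset B Y'" by (meson multiset_cases)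
      with empty nonempty[of B] show False by simp
    qed
    then show ?case by (simp add: rel_mset_Zero)
  next
    case (add B X)
    obtain x where x: "x \<in># f B" using nonempty[of B] add.prems by auto
    then have "x \<in># (\<Sum>B\<in>#Y. f B)" using add.prems(3)[symmetric] by simp
    then obtain B' where B': "B' \<in># Y" "x \<in># f B'" by (auto simp: in_Union_mset_iff)
    obtain Y' where Y': "Y = add_mset B' Y'" using B'(1) by (meson multi_member_split)
    have R: "R B B'" using overlap[of B B' x] x B' add.prems by auto
    have "rel_mset R X Y'"
      using add.prems Y' related[OF R] by (intro add.IH) auto
    then show ?case unfolding Y' using R by (intro rel_mset_Plus)
  qed
qed

lemma KCF_mset_overlap:
  assumes "B \<in> tri_summands" "B' \<in> tri_summands" "x \<in># KCF_mset B" "x \<in># KCF_mset B'"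
  shows "tri_replacement_or_sign B B'"
  using block_class_cover[OF assms(1,3)] block_class_cover[OF assms(2,4)] block_class_fun block_class_related by metis

theorem canonical_form_iff_KCF:
  assumes "is_second_canonical_form n A Bs" "is_second_canonical_form n A' Bs'"
    "is_real_KCF n n (A\<^sup>T) A Ks" "is_real_KCF n n (A'\<^sup>T) A' Ks'"
  shows "mset Ks = mset Ks' \<longleftrightarrow> rel_mset tri_replacement_or_sign (mset Bs) (mset Bs')"
proof -
  have "set Bs \<subseteq> tri_summands" "set Bs' \<subseteq> tri_summands"
    using assms(1,2) by (simp_all add: is_second_canonical_form_def tri_summands_def)
  then have "set_mset (mset Bs) \<subseteq> tri_summands" "set_mset (mset Bs') \<subseteq> tri_summands" by simp_all
  then have "rel_mset tri_replacement_or_sign (mset Bs) (mset Bs') \<longleftrightarrow>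
      (\<Sum>B\<in>#mset Bs. KCF_mset B) = (\<Sum>B\<in>#mset Bs'. KCF_mset B)"
    by (intro rel_mset_iff_sum_eq[where T = tri_summands])
      (rule related_KCF_mset KCF_mset_nonempty KCF_mset_overlap; assumption)+
  then show ?thesis
    unfolding mset_KCF_of_canonical_form[OF assms(1,3)] mset_KCF_of_canonical_form[OF assms(2,4)] by blast
qed

theorem theorem5p2:
  fixes n :: nat
  shows
    "(\<forall>A A' Bs Bs' Ks Ks'.
        is_second_canonical_form n A Bs \<and> is_second_canonical_form n A' Bs' \<and>
        is_real_KCF n n (A\<^sup>T) A Ks \<and> is_real_KCF n n (A'\<^sup>T) A' Ks' \<longrightarrow>
          (rel_mset tri_replacement (mset Bs) (mset Bs') \<longrightarrow> mset Ks = mset Ks') \<and>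
          (mset Ks = mset Ks' \<longleftrightarrow> rel_mset tri_replacement_or_sign (mset Bs) (mset Bs')))
     \<and>
     (\<forall>k a. k \<ge> 1 \<and> a \<noteq> 1 \<and> a \<noteq> -1 \<and> (odd k \<longrightarrow> a = 0) \<longrightarrow>
        (\<forall>l. k = 2 * l + 1 \<longrightarrow>
           is_real_KCF k k ((T_mat k a)\<^sup>T) (T_mat k a)
             [(F_mat l, G_mat l), ((F_mat l)\<^sup>T, (G_mat l)\<^sup>T)]) \<and>
        (\<forall>l. k = 2 * l \<and> a = 0 \<longrightarrow>
           is_real_KCF k k ((T_mat k a)\<^sup>T) (T_mat k a)
             [(jordan_block l 0, 1\<^sub>m l), (1\<^sub>m l, jordan_block l 0)]) \<and>
        (\<forall>l. k = 2 * l \<and> a \<noteq> 0 \<longrightarrow>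
           is_real_KCF k k ((T_mat k a)\<^sup>T) (T_mat k a)
             [(1\<^sub>m l, jordan_block l a), (1\<^sub>m l, jordan_block l (1 / a))]))
     \<and>
     (\<forall>k a b. k \<ge> 1 \<and> a\<^sup>2 + b\<^sup>2 \<noteq> 1 \<and> b > 0 \<longrightarrow>
        is_real_KCF (4 * k) (4 * k) ((That_mat (2 * k) a b)\<^sup>T) (That_mat (2 * k) a b)
          [(1\<^sub>m (2 * k), C_mat k a b),
           (1\<^sub>m (2 * k), C_mat k (a / (a\<^sup>2 + b\<^sup>2)) (b / (a\<^sup>2 + b\<^sup>2)))])
     \<and>
     (\<forall>k \<epsilon>. k \<ge> 1 \<and> \<epsilon> \<in> {1, -1} \<longrightarrow>
        is_real_KCF k k ((kronecker (Gamma_mat k) (mat11 \<epsilon>))\<^sup>T) (kronecker (Gamma_mat k) (mat11 \<epsilon>))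
          [(1\<^sub>m k, jordan_block k ((- 1) ^ (k + 1)))])
     \<and>
     (\<forall>k a b. k \<ge> 1 \<and> a\<^sup>2 + b\<^sup>2 = 1 \<and> b > 0 \<longrightarrow>
        (a = 0 \<and> b = 1 \<longrightarrow>
           is_real_KCF (2 * k) (2 * k)
             ((kronecker (Gamma_mat k) (C2_mat a b))\<^sup>T) (kronecker (Gamma_mat k) (C2_mat a b))
             [(1\<^sub>m k, jordan_block k ((- 1) ^ k)), (1\<^sub>m k, jordan_block k ((- 1) ^ k))]) \<and>
        (a \<noteq> 0 \<longrightarrow>
           is_real_KCF (2 * k) (2 * k)
             ((kronecker (Gamma_mat k) (C2_mat a b))\<^sup>T) (kronecker (Gamma_mat k) (C2_mat a b))
             [(1\<^sub>m (2 * k), C_mat k ((- 1) ^ (k + 1) * (a\<^sup>2 - b\<^sup>2)) (2 * \<bar>a * b\<bar>))]))"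
proof (intro conjI)
  show "\<forall>A A' Bs Bs' Ks Ks'.
        is_second_canonical_form n A Bs \<and> is_second_canonical_form n A' Bs' \<and>
        is_real_KCF n n (A\<^sup>T) A Ks \<and> is_real_KCF n n (A'\<^sup>T) A' Ks' \<longrightarrow>
          (rel_mset tri_replacement (mset Bs) (mset Bs') \<longrightarrow> mset Ks = mset Ks') \<and>
          (mset Ks = mset Ks' \<longleftrightarrow> rel_mset tri_replacement_or_sign (mset Bs) (mset Bs'))"
  proof (intro allI impI)
    fix A A' Bs Bs' Ks Ks'
    assume "is_second_canonical_form n A Bs \<and> is_second_canonical_form n A' Bs' \<and>
        is_real_KCF n n (A\<^sup>T) A Ks \<and> is_real_KCF n n (A'\<^sup>T) A' Ks'"
    then have iff: "mset Ks = mset Ks' \<longleftrightarrow> rel_mset tri_replacement_or_sign (mset Bs) (mset Bs')"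
      using canonical_form_iff_KCF by blast
    \<comment> \<open>The first claim is one direction of the equivalence, because replacements are
      among the changes that it permits.\<close>
    have "rel_mset tri_replacement (mset Bs) (mset Bs') \<longrightarrow> rel_mset tri_replacement_or_sign (mset Bs) (mset Bs')"
      unfolding rel_mset_def using list_all2_mono tri_replacement_or_sign.replacement by blast
    with iff show "(rel_mset tri_replacement (mset Bs) (mset Bs') \<longrightarrow> mset Ks = mset Ks') \<and>
          (mset Ks = mset Ks' \<longleftrightarrow> rel_mset tri_replacement_or_sign (mset Bs) (mset Bs'))" by blast
  qed
qed (use KCF_T_odd KCF_T_even_0 KCF_T_even KCF_That KCF_Gamma_sign KCF_Gamma_i KCF_Gamma_C in \<open>auto simp del: One_nat_def\<close>)

end
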